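(* Let $u\in\mathcal{E}$. Then $\mu_u=\alpha\lambda$, where the function $\alpha:\mathbb{T}\to[0,\infty]$ has the following properties: (i) $\alpha\in L^1(\lambda)$; (ii) $\alpha(e^{i\theta})=\int_{\mathbb{D}}P(z,e^{i\theta})\,\Delta u(z)$ for $e^{i\theta}\in\mathbb{T}$; (iii) $\alpha$ is lower semicontinuous on $\mathbb{T}$; (iv) there is a constant $c>0$ such that $\alpha(e^{i\theta})\ge c$ on $\mathbb{T}$; (v) $\alpha$ need not be bounded, i.e. there exists $u\in\mathcal{E}$ for which the corresponding function $\alpha$ is unbounded on $\mathbb{T}$.
   Context: $\mathbb{D}=\{z\in\mathbb{C}:|z|<1\}$, $\mathbb{T}=\partial\mathbb{D}$, $\lambda$ is the normalized Lebesgue measure on $\mathbb{T}$, and $P(z,e^{i\theta})=\frac{1-|z|^2}{|e^{i\theta}-z|^2}$ is the Poisson kernel. $\Delta$ is the distributional Laplace operator normalized so that $\Delta\log|z|=\delta_0$; for a subharmonic function $v$, $\Delta v$ is a positive measure. $\mathcal{E}$ is the set of continuous subharmonic functions $u:\mathbb{D}\to[-\infty,0)$ such that $u(z)\to0$ as $|z|\to1$ and $\int_{\mathbb{D}}\Delta u<\infty$. For $u\in\mathcal{E}$ and $r<0$ put $B_{u,r}=\{z\in\mathbb{D}:u(z)<r\}$, $S_{u,r}=\{z\in\mathbb{D}:u(z)=r\}$, $u_r=\max\{u,r\}$, and $\mu_{u,r}=\Delta u_r-\chi_{\mathbb{D}\setminus B_{u,r}}\Delta u$; this is a positive measure supported by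 $S_{u,r}$. By a theorem of Demailly, as $r\to0^-$ the measures $\mu_{u,r}$ converge weak-$*$ in $C^*(\overline{\mathbb{D}})$ to a positive measure $\mu_u$ supported by $\mathbb{T}$. *)

theory Defs
  imports "HOL-Analysis.Analysis"
begin

abbreviation unit_disc :: "complex set"  (\<open>\<D>\<close>)
  where "\<D> \<equiv> ball 0 1"

abbreviation unit_circle :: "complex set"  (\<open>\<T>\<close>)
  where "\<T> \<equiv> sphere 0 1"

text \<open>
  Measures on the disc, on the circle or on the closed disc are all Borel measures on the
  complex plane that vanish outside the set in question.
\<close>

definition circle_measure :: "complex measure"
  where "circle_measure = distr (uniform_measure lborel {0..<2 * pi}) borel cis"

definition poisson_kernel :: "complex \<Rightarrow> complex \<Rightarrow> real"
  where "poisson_kernel z \<zeta> = (1 - (norm z)\<^sup>2) / (norm (\<zeta> - z))\<^sup>2"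

text \<open>
  The integral of an extended real function, positive part minus negative part
  (\<^const>\<open>e2ennreal\<close> maps negative numbers to 0). An upper semicontinuous function with values
  in $[-\infty,\infty)$ is bounded above on circles, so $\infty - \infty$ does not occur below.
\<close>

definition circle_mean :: "(complex \<Rightarrow> ereal) \<Rightarrow> complex \<Rightarrow> real \<Rightarrow> ereal"
  where "circle_mean u a \<rho> =
    enn2ereal (\<integral>\<^sup>+\<zeta>\<in>\<T>. e2ennreal (u (a + of_real \<rho> * \<zeta>)) \<partial>circle_measure) -
    enn2ereal (\<integral>\<^sup>+\<zeta>\<in>\<T>. e2ennreal (- u (a + of_real \<rho> * \<zeta>)) \<partial>circle_measure)"

definition subharmonic_on :: "complex set \<Rightarrow> (complex \<Rightarrow> ereal) \<Rightarrow> bool"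
  where "subharmonic_on S u \<longleftrightarrow>
    (\<forall>z\<in>S. u z < \<infinity>) \<and>
    (\<forall>t. openin (top_of_set S) {z\<in>S. u z < t}) \<and>
    (\<forall>a \<rho>. 0 < \<rho> \<longrightarrow> cball a \<rho> \<subseteq> S \<longrightarrow> u a \<le> circle_mean u a \<rho>)"

definition dir_deriv :: "complex \<Rightarrow> (complex \<Rightarrow> real) \<Rightarrow> complex \<Rightarrow> real"
  where "dir_deriv v f = (\<lambda>z. frechet_derivative f (at z) v)"

text \<open>$C^\infty$: differentiable, with all directional derivatives again $C^\infty$.\<close>

coinductive smooth :: "(complex \<Rightarrow> real) \<Rightarrow> bool"
  where "(\<And>z. f differentiable (at z)) \<Longrightarrow> (\<And>v. smooth (dir_deriv v f)) \<Longrightarrow> smooth f"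

definition classical_laplacian :: "(complex \<Rightarrow> real) \<Rightarrow> complex \<Rightarrow> real"
  where "classical_laplacian f z = dir_deriv 1 (dir_deriv 1 f) z + dir_deriv \<i> (dir_deriv \<i> f) z"

definition test_function :: "complex set \<Rightarrow> (complex \<Rightarrow> real) \<Rightarrow> bool"
  where "test_function S \<phi> \<longleftrightarrow>
    smooth \<phi> \<and> compact (closure {z. \<phi> z \<noteq> 0}) \<and> closure {z. \<phi> z \<noteq> 0} \<subseteq> S"

text \<open>Finiteness of the integrals forces \<open>u\<close> to be finite almost everywhere.\<close>

definition locally_integrable_on :: "complex set \<Rightarrow> (complex \<Rightarrow> ereal) \<Rightarrow> bool"
  where "locally_integrable_on S u \<longleftrightarrow>
    u \<in> borel_measurable (restrict_space borel S) \<and>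
    (\<forall>K. compact K \<longrightarrow> K \<subseteq> S \<longrightarrow> (\<integral>\<^sup>+z\<in>K. e2ennreal \<bar>u z\<bar> \<partial>lborel) < \<infinity>)"

text \<open>
  \<open>has_laplacian u \<nu>\<close>: on the disc the distributional Laplacian of \<open>u\<close> is the positive Radon
  measure \<open>\<nu>\<close>. The factor $1/(2\pi)$ is the normalization $\Delta\log|z| = \delta_0$.
\<close>

definition has_laplacian :: "(complex \<Rightarrow> ereal) \<Rightarrow> complex measure \<Rightarrow> bool"
  where "has_laplacian u \<nu> \<longleftrightarrow>
    locally_integrable_on \<D> u \<and>
    sets \<nu> = sets borel \<and> emeasure \<nu> (- \<D>) = 0 \<and>
    (\<forall>K. compact K \<longrightarrow> K \<subseteq> \<D> \<longrightarrow> emeasure \<nu> K < \<infinity>) \<and>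
    (\<forall>\<phi>. test_function \<D> \<phi> \<longrightarrow>
      (LINT z|\<nu>. \<phi> z) =
        (LINT z:\<D>|lborel. real_of_ereal (u z) * classical_laplacian \<phi> z) / (2 * pi))"

definition laplacian :: "(complex \<Rightarrow> ereal) \<Rightarrow> complex measure"
  where "laplacian u = (THE \<nu>. has_laplacian u \<nu>)"

text \<open>Values of \<open>u\<close> outside the disc are irrelevant throughout.\<close>

definition class_E :: "(complex \<Rightarrow> ereal) set"  (\<open>\<E>\<close>)
  where "\<E> = {u. continuous_on \<D> u \<and> subharmonic_on \<D> u \<and> (\<forall>z\<in>\<D>. u z < 0) \<and>
    (u \<longlongrightarrow> 0) (filtercomap norm (at_left 1)) \<and>
    (\<exists>\<nu>. has_laplacian u \<nu> \<and> emeasure \<nu> \<D> < \<infinity>)}"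

definition sublevel :: "(complex \<Rightarrow> ereal) \<Rightarrow> real \<Rightarrow> complex set"
  where "sublevel u r = {z\<in>\<D>. u z < ereal r}"

definition truncation :: "(complex \<Rightarrow> ereal) \<Rightarrow> real \<Rightarrow> complex \<Rightarrow> ereal"
  where "truncation u r z = max (u z) (ereal r)"

definition level_measure :: "(complex \<Rightarrow> ereal) \<Rightarrow> real \<Rightarrow> complex measure"
  where "level_measure u r =
    diff_measure (laplacian (truncation u r))
      (density (laplacian u) (indicator (\<D> - sublevel u r)))"

definition weak_star_limit ::
    "(real \<Rightarrow> complex measure) \<Rightarrow> complex measure \<Rightarrow> real filter \<Rightarrow> bool"
  where "weak_star_limit M \<mu> F \<longleftrightarrow>
    (\<forall>\<phi> :: complex \<Rightarrow> real. continuous_on (cball 0 1) \<phi> \<longrightarrow>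
      ((\<lambda>r. LINT z:cball 0 1|M r. \<phi> z) \<longlongrightarrow> (LINT z:cball 0 1|\<mu>. \<phi> z)) F)"

definition demailly_measure :: "(complex \<Rightarrow> ereal) \<Rightarrow> complex measure"
  where "demailly_measure u = (THE \<mu>.
    sets \<mu> = sets borel \<and> finite_measure \<mu> \<and> emeasure \<mu> (- cball 0 1) = 0 \<and>
    weak_star_limit (level_measure u) \<mu> (at_left 0))"

definition lower_semicontinuous_on :: "complex set \<Rightarrow> (complex \<Rightarrow> ennreal) \<Rightarrow> bool"
  where "lower_semicontinuous_on S f \<longleftrightarrow> (\<forall>t. openin (top_of_set S) {x\<in>S. t < f x})"

end

theory Submission
  imports "HOL-Probability.Helly_Selection" Defs
begin

text \<open>
  Let \<open>\<nu> = \<Delta>u\<close>. The theorem rests on one formula: if \<open>h\<close> is harmonic, then the level measure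
  \<open>\<mu>\<^bsub>u,r\<^esub>\<close> integrates \<open>h\<close> to \<open>\<integral>\<^bsub>{u < r}\<^esub> h d\<nu>\<close> (\<open>level_measure_properties\<close>). Indeed, \<open>u\<close> and its truncation
  agree near the circle, so their Laplacians pair to the same number with \<open>h\<close>, cut off near the
  circle. As \<open>r\<close> tends to 0, the sublevel sets exhaust the disc and the level sets move to the
  circle. Hence the limit measure integrates \<open>h\<close> to \<open>\<integral> h d\<nu>\<close>, and by the Poisson formula and
  Tonelli's theorem this is the integral of \<open>h \<alpha>\<close> over the circle, with \<open>\<alpha>\<close> the integral of the
  Poisson kernel against \<open>\<nu>\<close>. On the circle the harmonic polynomials are dense among continuous
  functions, which identifies the limit (\<open>weak_star_limit_swept\<close>, \<open>demailly_measure_eq\<close>).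

  For the formula to have a meaning, the Laplacian of the truncation has to exist as a
  measure, unique, and dominating \<open>\<nu>\<close> outside the sublevel set. The distributional Laplacian is
  treated as a limit of circle averages (\<open>laplacian_limit\<close>), through which the sub-mean-value property
  gives positivity; a cutoff argument yields Kato's inequality (\<open>kato\<close>), that is, positivity
  of the level measure as a functional on test functions. The measure is then provided by
  \<open>riesz_representation_square\<close>: discrete approximations of the functional are lifted to the unit
  interval along a square-filling curve, and Helly's selection theorem applies to the lifts.
  Uniqueness is \<open>measure_eqI_test_functions\<close>.

  The total integral of \<open>\<alpha>\<close> is the mass of \<open>\<nu>\<close>, because each Poisson kernel has integral 1. Lower
  semicontinuity is Fatou's lemma. The lower bound holds because the Poisson kernel is at least
  \<open>(1 - |z|) / 2\<close> and \<open>\<nu>\<close> does not vanish; the latter (\<open>mass_pos\<close>) follows by comparing \<open>u\<close> with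
  a quadratic function.

  An unbounded \<open>\<alpha>\<close> arises from \<open>u = - \<Sum>\<^sub>n c\<^sub>n (1 - |b\<^sub>n|\<^sup>2)\<close>, where \<open>b\<^sub>n\<close> is the disc automorphism with
  zero at \<open>1 - \<tau>\<^sub>n\<close> and \<open>\<tau>\<^sub>n\<close> tends to 0. Every term has circle averages in closed form
  (\<open>circle_avg_moebius_gap\<close>) and a mass bounded uniformly in \<open>n\<close>, but at the boundary point 1 it
  contributes an amount of order \<open>c\<^sub>n / \<tau>\<^sub>n\<close> to \<open>\<alpha>\<close>. The weights are small enough for \<open>u\<close> to tend to 0 at
  the circle and large enough for these contributions to be unbounded.
\<close>

section \<open>Smooth functions of one real variable\<close>

text \<open>
  The one-variable counterpart of \<^const>\<open>smooth\<close>; its members are the outer functions that may be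
  composed with smooth functions on the plane.
\<close>

coinductive smooth1 :: "(real \<Rightarrow> real) \<Rightarrow> bool"
  where "(\<And>x. (f has_real_derivative f' x) (at x)) \<Longrightarrow> smooth1 f' \<Longrightarrow> smooth1 f"

text \<open>
  For \<open>k = 0\<close> this is the classical smooth function that vanishes exactly on the negative half line.
  The other values of \<open>k\<close> are there because each derivative is a combination of two functions
  of the family.
\<close>

definition flat :: "nat \<Rightarrow> real \<Rightarrow> real"
  where "flat k x = (if x > 0 then (1 / x) ^ k * exp (- (1 / x)) else 0)"

text \<open>
  Coinduction up to algebraic operations: the derivative of a product is a sum of products, so a
  product cannot be shown smooth by a coinduction on products alone. The class below contains a
  derivative of each of its members, and therefore all its members are smooth.
\<close>

inductive smooth1_closure :: "(real \<Rightarrow> real) \<Rightarrow> bool"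
  where
    base: "smooth1 f \<Longrightarrow> smooth1_closure f"
  | flat: "smooth1_closure (flat k)"
  | const: "smooth1_closure (\<lambda>x. c)"
  | ident: "smooth1_closure (\<lambda>x. x)"
  | exp: "smooth1_closure exp"
  | add: "smooth1_closure f \<Longrightarrow> smooth1_closure g \<Longrightarrow> smooth1_closure (\<lambda>x. f x + g x)"
  | mult: "smooth1_closure f \<Longrightarrow> smooth1_closure g \<Longrightarrow> smooth1_closure (\<lambda>x. f x * g x)"
  | comp: "smooth1_closure f \<Longrightarrow> smooth1_closure g \<Longrightarrow> smooth1_closure (\<lambda>x. f (g x))"
  | inverse: "smooth1_closure f \<Longrightarrow> (\<And>x. f x \<noteq> 0) \<Longrightarrow> smooth1_closure (\<lambda>x. inverse (f x))"

lemma flat_at_right_0: "((\<lambda>x. flat k x) \<longlongrightarrow> 0) (at_right 0)"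
proof -
  have "((\<lambda>x::real. x ^ k / exp x) \<longlongrightarrow> 0) at_top"
    by (rule tendsto_power_div_exp_0)
  then have "((\<lambda>x::real. (inverse x) ^ k / exp (inverse x)) \<longlongrightarrow> 0) (at_right 0)"
    by (rule filterlim_compose[OF _ filterlim_inverse_at_top_right])
  then show ?thesis
    by (rule Lim_transform_eventually)
      (auto simp: flat_def eventually_at_right_field exp_minus field_simps intro!: exI[of _ 1])
qed

lemma flat_DERIV: "(flat k has_real_derivative flat (k + 2) x - k * flat (k + 1) x) (at x)"
proof -
  consider "x > 0" | "x < 0" | "x = 0" by linarith
  then show ?thesis
  proof cases
    case 1
    have "((\<lambda>x. (1 / x) ^ k * exp (- (1 / x))) has_real_derivative flat (k + 2) x - k * flat (k + 1) x) (at x)"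
      using 1
      apply (auto intro!: derivative_eq_intros simp: flat_def)
      apply (cases k)
       apply (auto simp: field_simps power2_eq_square)
      done
    moreover have "\<forall>\<^sub>F y in nhds x. flat k y = (1 / y) ^ k * exp (- (1 / y))"
      using 1 by (auto simp: flat_def eventually_nhds intro!: exI[of _ "{0<..}"])
    ultimately show ?thesis
      by (subst DERIV_cong_ev[OF refl _ refl])
  next
    case 2
    have "((\<lambda>x. 0) has_real_derivative flat (k + 2) x - k * flat (k + 1) x) (at x)"
      using 2 by (auto simp: flat_def)
    moreover have "\<forall>\<^sub>F y in nhds x. flat k y = 0"
      using 2 by (auto simp: flat_def eventually_nhds intro!: exI[of _ "{..<0}"])
    ultimately show ?thesis
      by (subst DERIV_cong_ev[OF refl _ refl])
  next
    case 3
    (* The difference quotient of one member at 0 is, from the right, the next member. *)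
    have "((\<lambda>h. (flat k (0 + h) - flat k 0) / h) \<longlongrightarrow> 0) (at_right 0)"
      by (rule Lim_transform_eventually[OF flat_at_right_0[of "k + 1"]])
        (auto simp: flat_def eventually_at_right_field intro!: exI[of _ 1])
    moreover have "((\<lambda>h. (flat k (0 + h) - flat k 0) / h) \<longlongrightarrow> 0) (at_left 0)"
      by (rule Lim_transform_eventually[OF tendsto_const])
        (auto simp: flat_def eventually_at_left_field intro!: exI[of _ "-1"])
    ultimately have "((\<lambda>h. (flat k (0 + h) - flat k 0) / h) \<longlongrightarrow> 0) (at 0)"
      by (simp add: filterlim_split_at_real)
    then show ?thesis using 3 by (simp add: DERIV_def flat_def)
  qed
qed

lemma smooth1_closure_deriv:
  "smooth1_closure f \<Longrightarrow> \<exists>f'. (\<forall>x. (f has_real_derivative f' x) (at x)) \<and> smooth1_closure f'"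
proof (induction rule: smooth1_closure.induct)
  case (base f)
  then show ?case by cases (auto intro: smooth1_closure.base)
next
  case (flat k)
  have "smooth1_closure (\<lambda>x. flat (k + 2) x + (- real k) * flat (k + 1) x)"
    by (intro smooth1_closure.add smooth1_closure.mult[OF smooth1_closure.const] smooth1_closure.flat)
  with flat_DERIV[of k] show ?case by (intro exI[of _ "\<lambda>x. flat (k + 2) x + (- real k) * flat (k + 1) x"]) simp
next
  case (const c)
  show ?case by (intro exI[of _ "\<lambda>x. 0"]) (simp add: smooth1_closure.const)
next
  case ident
  show ?case by (intro exI[of _ "\<lambda>x. 1"]) (simp add: smooth1_closure.const)
next
  case exp
  show ?case by (intro exI[of _ exp]) (auto intro: DERIV_exp smooth1_closure.exp)
next
  case (add f g)
  then obtain f' g' where "\<forall>x. (f has_real_derivative f' x) (at x)" "smooth1_closure f'"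
    "\<forall>x. (g has_real_derivative g' x) (at x)" "smooth1_closure g'" by blast
  then show ?case
    by (intro exI[of _ "\<lambda>x. f' x + g' x"]) (auto intro!: DERIV_add smooth1_closure.add)
next
  case (mult f g)
  then obtain f' g' where "\<forall>x. (f has_real_derivative f' x) (at x)" "smooth1_closure f'"
    "\<forall>x. (g has_real_derivative g' x) (at x)" "smooth1_closure g'" by blast
  with mult.hyps show ?case
    by (intro exI[of _ "\<lambda>x. f' x * g x + g' x * f x"])
      (auto intro!: DERIV_mult smooth1_closure.add smooth1_closure.mult)
next
  case (comp f g)
  then obtain f' g' where "\<forall>x. (f has_real_derivative f' x) (at x)" "smooth1_closure f'"
    "\<forall>x. (g has_real_derivative g' x) (at x)" "smooth1_closure g'" by blast
  with comp.hyps show ?case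
    by (intro exI[of _ "\<lambda>x. f' (g x) * g' x"])
      (auto intro!: DERIV_chain2[of f] smooth1_closure.comp[of f'] smooth1_closure.mult)
next
  case (inverse f)
  then obtain f' where f': "\<forall>x. (f has_real_derivative f' x) (at x)" "smooth1_closure f'" by blast
  have "smooth1_closure (\<lambda>x. (-1) * (inverse (f x) * f' x * inverse (f x)))"
    using inverse f'
    by (intro smooth1_closure.mult[OF smooth1_closure.const]
        smooth1_closure.mult[OF smooth1_closure.mult] smooth1_closure.inverse) auto
  with f' inverse show ?case
    by (intro exI[of _ "\<lambda>x. (-1) * (inverse (f x) * f' x * inverse (f x))"])
      (auto intro!: DERIV_inverse')
qed

lemma smooth1_closure_smooth1: "smooth1_closure f \<Longrightarrow> smooth1 f"
proof (coinduction arbitrary: f rule: smooth1.coinduct)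
  case smooth1
  then obtain f' where "\<forall>x. (f has_real_derivative f' x) (at x)" "smooth1_closure f'"
    using smooth1_closure_deriv by blast
  then show ?case by auto
qed

lemma smooth1_intros:
  "smooth1 (flat k)"
  "smooth1 (\<lambda>x. c)"
  "smooth1 (\<lambda>x. x)"
  "smooth1 exp"
  "smooth1 f \<Longrightarrow> smooth1 g \<Longrightarrow> smooth1 (\<lambda>x. f x + g x)"
  "smooth1 f \<Longrightarrow> smooth1 g \<Longrightarrow> smooth1 (\<lambda>x. f x * g x)"
  "smooth1 f \<Longrightarrow> smooth1 g \<Longrightarrow> smooth1 (\<lambda>x. f (g x))"
  "smooth1 f \<Longrightarrow> (\<And>x. f x \<noteq> 0) \<Longrightarrow> smooth1 (\<lambda>x. inverse (f x))"
proof -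
  note base = smooth1_closure.base
  show "smooth1 (flat k)" "smooth1 (\<lambda>x. c)" "smooth1 (\<lambda>x. x)" "smooth1 exp"
    by (rule smooth1_closure_smooth1, rule smooth1_closure.flat smooth1_closure.const
        smooth1_closure.ident smooth1_closure.exp)+
  show "smooth1 f \<Longrightarrow> smooth1 g \<Longrightarrow> smooth1 (\<lambda>x. f x + g x)"
    by (rule smooth1_closure_smooth1, rule smooth1_closure.add; rule base)
  show "smooth1 f \<Longrightarrow> smooth1 g \<Longrightarrow> smooth1 (\<lambda>x. f x * g x)"
    by (rule smooth1_closure_smooth1, rule smooth1_closure.mult; rule base)
  show "smooth1 f \<Longrightarrow> smooth1 g \<Longrightarrow> smooth1 (\<lambda>x. f (g x))"
    by (rule smooth1_closure_smooth1, rule smooth1_closure.comp[of f g]; rule base)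
  show "smooth1 f \<Longrightarrow> (\<And>x. f x \<noteq> 0) \<Longrightarrow> smooth1 (\<lambda>x. inverse (f x))"
    by (rule smooth1_closure_smooth1, rule smooth1_closure.inverse, rule base)
qed

lemma flat_pos: "flat 0 x > 0 \<longleftrightarrow> x > 0"
  and flat_nonneg: "flat 0 x \<ge> 0"
  and flat_eq_0: "x \<le> 0 \<Longrightarrow> flat 0 x = 0"
  by (auto simp: flat_def)

lemma flat_mono: "x \<le> y \<Longrightarrow> flat 0 x \<le> flat 0 y"
  by (auto simp: flat_def field_simps)

text \<open>
  The denominator is positive because \<open>x\<close> and \<open>1 - x\<close> are never both nonpositive. The quotient
  increases from 0 to 1 on the unit interval and is constant outside it.
\<close>

definition smooth_step :: "real \<Rightarrow> real"
  where "smooth_step x = flat 0 x * inverse (flat 0 x + flat 0 (1 - x))"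

lemma smooth_step_denom: "flat 0 x + flat 0 (1 - x) > 0"
  using flat_pos[of x] flat_pos[of "1 - x"] flat_nonneg[of x] flat_nonneg[of "1 - x"]
  by (cases "x > 0") (auto simp: add_pos_nonneg add_nonneg_pos)

lemma smooth1_smooth_step: "smooth1 smooth_step"
proof -
  have "smooth1 (\<lambda>x. flat 0 x * inverse (flat 0 x + flat 0 (1 + (-1) * x)))"
  proof (intro smooth1_intros(6,8,5))
    show "smooth1 (\<lambda>x. flat 0 (1 + (-1) * x))"
      by (rule smooth1_intros(7)[OF smooth1_intros(1)]) (intro smooth1_intros(2,3,5,6))
    show "flat 0 x + flat 0 (1 + (-1) * x) \<noteq> 0" for x
      using smooth_step_denom[of x] by simp
  qed (rule smooth1_intros(1))+
  then show ?thesis by (simp add: smooth_step_def[abs_def])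
qed

lemma smooth_step_eq_0: "x \<le> 0 \<Longrightarrow> smooth_step x = 0"
  and smooth_step_eq_1: "x \<ge> 1 \<Longrightarrow> smooth_step x = 1"
  using smooth_step_denom[of x]
  by (auto simp: smooth_step_def flat_eq_0)

lemma smooth_step_mono: "x \<le> y \<Longrightarrow> smooth_step x \<le> smooth_step y"
proof -
  assume "x \<le> y"
  then have le: "flat 0 x \<le> flat 0 y" "flat 0 (1 - y) \<le> flat 0 (1 - x)"
    by (auto intro: flat_mono)
  have "flat 0 x * (flat 0 y + flat 0 (1 - y)) \<le> flat 0 y * (flat 0 x + flat 0 (1 - x))"
    using mult_mono[OF le flat_nonneg flat_nonneg] by (simp add: algebra_simps)
  then show ?thesis
    using smooth_step_denom[of x] smooth_step_denom[of y]
    by (simp add: smooth_step_def field_simps)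
qed

lemma smooth_step_bounds: "0 \<le> smooth_step x" "smooth_step x \<le> 1"
  using smooth_step_mono[of "min x 0" x] smooth_step_mono[of x "max x 1"]
  by (auto simp: smooth_step_eq_0 smooth_step_eq_1)

section \<open>Smooth functions and test functions in the plane\<close>

lemma dir_deriv_eq: "(f has_derivative f') (at z) \<Longrightarrow> dir_deriv v f z = f' v"
  by (simp add: dir_deriv_def frechet_derivative_at[symmetric])

lemma differentiable_dir_deriv:
  "f differentiable at z \<Longrightarrow> (f has_derivative (\<lambda>v. dir_deriv v f z)) (at z)"
  by (simp add: dir_deriv_def frechet_derivative_works)

lemma smooth_differentiable: "smooth f \<Longrightarrow> f differentiable at z"
  by (erule smooth.cases) auto

lemma smooth_dir_deriv: "smooth f \<Longrightarrow> smooth (dir_deriv v f)"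
  by (erule smooth.cases) auto

lemma smooth_has_derivative: "smooth f \<Longrightarrow> (f has_derivative (\<lambda>v. dir_deriv v f z)) (at z)"
  by (intro differentiable_dir_deriv smooth_differentiable)

lemma smooth_continuous_on: "smooth f \<Longrightarrow> continuous_on A f"
  by (metis continuous_at_imp_continuous_on has_derivative_continuous smooth_has_derivative)

lemma smooth_borel_measurable [measurable_dest]: "smooth f \<Longrightarrow> f \<in> borel_measurable borel"
  by (intro borel_measurable_continuous_onI smooth_continuous_on)

text \<open>
  The same device as for one variable. The functions \<open>z \<mapsto> Re (c z\<^sup>n)\<close> form a family closed
  under directional derivatives; they provide the constants, the coordinates and later the harmonic
  polynomials.
\<close>

inductive smooth_closure :: "(complex \<Rightarrow> real) \<Rightarrow> bool"
  where
    base: "smooth f \<Longrightarrow> smooth_closure f"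
  | power: "smooth_closure (\<lambda>z. Re (c * z ^ n))"
  | add: "smooth_closure f \<Longrightarrow> smooth_closure g \<Longrightarrow> smooth_closure (\<lambda>z. f z + g z)"
  | mult: "smooth_closure f \<Longrightarrow> smooth_closure g \<Longrightarrow> smooth_closure (\<lambda>z. f z * g z)"
  | comp: "smooth1 h \<Longrightarrow> smooth_closure f \<Longrightarrow> smooth_closure (\<lambda>z. h (f z))"

lemma has_derivative_Re_power:
  "((\<lambda>z. Re (c * z ^ n)) has_derivative (\<lambda>v. Re (c * of_nat n * v * z ^ (n - 1)))) (at z)"
  by (auto intro!: derivative_eq_intros simp: algebra_simps)

lemma dir_deriv_Re_power:
  "dir_deriv v (\<lambda>z. Re (c * z ^ n)) = (\<lambda>z. Re ((c * of_nat n * v) * z ^ (n - 1)))"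
  by (rule ext, rule dir_deriv_eq, rule has_derivative_Re_power)

lemma has_derivative_smooth1_comp:
  assumes "(h has_real_derivative h' (f z)) (at (f z))" "(f has_derivative f') (at z)"
  shows "((\<lambda>z. h (f z)) has_derivative (\<lambda>v. h' (f z) * f' v)) (at z)"
  using has_derivative_compose[OF assms(2), of h "\<lambda>v. h' (f z) * v"] assms(1)
  by (simp add: has_field_derivative_def mult_commute_abs)

lemma smooth_closure_deriv:
  "smooth_closure f \<Longrightarrow>
    (\<forall>z. f differentiable at z) \<and> (\<forall>v. smooth_closure (dir_deriv v f))"
proof (induction rule: smooth_closure.induct)
  case (base f)
  then show ?case
    by (auto intro: smooth_differentiable smooth_closure.base smooth_dir_deriv)
next
  case (power c n)
  then show ?case
    unfolding dir_deriv_Re_power differentiable_def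
    using has_derivative_Re_power[of c n] smooth_closure.power by blast
next
  case (add f g)
  have D: "((\<lambda>z. f z + g z) has_derivative (\<lambda>v. dir_deriv v f z + dir_deriv v g z)) (at z)" for z
    using add.IH by (intro has_derivative_add differentiable_dir_deriv) auto
  have "dir_deriv v (\<lambda>z. f z + g z) = (\<lambda>z. dir_deriv v f z + dir_deriv v g z)" for v
    by (rule ext, rule dir_deriv_eq, rule D)
  then show ?case
    using add.IH D by (auto simp: differentiable_def[of "\<lambda>z. f z + g z"] intro!: smooth_closure.add)
next
  case (mult f g)
  have D: "((\<lambda>z. f z * g z) has_derivative
      (\<lambda>v. f z * dir_deriv v g z + dir_deriv v f z * g z)) (at z)" for z
    using mult.IH by (intro has_derivative_mult differentiable_dir_deriv) auto
  have "dir_deriv v (\<lambda>z. f z * g z) = (\<lambda>z. f z * dir_deriv v g z + dir_deriv v f z * g z)" for v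
    by (rule ext, rule dir_deriv_eq, rule D)
  then show ?case
    using mult D
    by (auto simp: differentiable_def[of "\<lambda>z. f z * g z"] intro!: smooth_closure.add smooth_closure.mult)
next
  case (comp h f)
  from comp.hyps(1) obtain h' where h': "\<And>x. (h has_real_derivative h' x) (at x)" "smooth1 h'"
    by cases auto
  have D: "((\<lambda>z. h (f z)) has_derivative (\<lambda>v. h' (f z) * dir_deriv v f z)) (at z)" for z
    using comp.IH by (intro has_derivative_smooth1_comp h' differentiable_dir_deriv) auto
  have "dir_deriv v (\<lambda>z. h (f z)) = (\<lambda>z. h' (f z) * dir_deriv v f z)" for v
    by (rule ext, rule dir_deriv_eq, rule D)
  then show ?case
    using comp D h'(2)
    by (auto simp: differentiable_def[of "\<lambda>z. h (f z)"]
        intro!: smooth_closure.mult smooth_closure.comp[of h'])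
qed

lemma smooth_closure_smooth: "smooth_closure f \<Longrightarrow> smooth f"
proof (coinduction arbitrary: f rule: smooth.coinduct)
  case smooth
  then show ?case using smooth_closure_deriv[of f] by auto
qed

lemma smooth_Re_power: "smooth (\<lambda>z. Re (c * z ^ n))"
  by (intro smooth_closure_smooth smooth_closure.power)

lemma smooth_add: "smooth f \<Longrightarrow> smooth g \<Longrightarrow> smooth (\<lambda>z. f z + g z)"
  by (rule smooth_closure_smooth, rule smooth_closure.add; rule smooth_closure.base)

lemma smooth_mult: "smooth f \<Longrightarrow> smooth g \<Longrightarrow> smooth (\<lambda>z. f z * g z)"
  by (rule smooth_closure_smooth, rule smooth_closure.mult; rule smooth_closure.base)

lemma smooth_comp: "smooth1 h \<Longrightarrow> smooth f \<Longrightarrow> smooth (\<lambda>z. h (f z))"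
  by (rule smooth_closure_smooth, rule smooth_closure.comp[of h f]) (simp_all add: smooth_closure.base)

lemma smooth_const: "smooth (\<lambda>z. c)"
  using smooth_Re_power[of "complex_of_real c" 0] by simp

lemma smooth_Re: "smooth Re" and smooth_Im: "smooth Im"
  using smooth_Re_power[of 1 1] smooth_Re_power[of "-\<i>" 1] by simp_all

lemma smooth_cmult: "smooth f \<Longrightarrow> smooth (\<lambda>z. c * f z)"
  by (intro smooth_mult smooth_const)

lemma smooth_diff: "smooth f \<Longrightarrow> smooth g \<Longrightarrow> smooth (\<lambda>z. f z - g z)"
  using smooth_add[OF _ smooth_cmult[of g "-1"]] by simp

lemma smooth_sum: "(\<And>i. i \<in> I \<Longrightarrow> smooth (f i)) \<Longrightarrow> smooth (\<lambda>z. \<Sum>i\<in>I. f i z)"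
  by (induction I rule: infinite_finite_induct) (auto intro: smooth_const smooth_add)

lemma smooth_norm_square: "smooth (\<lambda>z. (norm (z - a))\<^sup>2)"
proof -
  have "smooth (\<lambda>z. (Re z - Re a) * (Re z - Re a) + (Im z - Im a) * (Im z - Im a))"
    by (intro smooth_add smooth_mult smooth_diff smooth_Re smooth_Im smooth_const)
  then show ?thesis
    unfolding cmod_power2 unfolding power2_eq_square by simp
qed

lemma dir_deriv_add:
  assumes "smooth f" "smooth g"
  shows "dir_deriv v (\<lambda>z. f z + g z) = (\<lambda>z. dir_deriv v f z + dir_deriv v g z)"
  by (rule ext, rule dir_deriv_eq) (intro has_derivative_add smooth_has_derivative assms)

lemma dir_deriv_cmult:
  assumes "smooth f"
  shows "dir_deriv v (\<lambda>z. c * f z) = (\<lambda>z. c * dir_deriv v f z)"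
  by (rule ext, rule dir_deriv_eq) (intro has_derivative_mult_right smooth_has_derivative assms)

lemma classical_laplacian_add:
  assumes "smooth f" "smooth g"
  shows "classical_laplacian (\<lambda>z. f z + g z) z = classical_laplacian f z + classical_laplacian g z"
  using assms by (simp add: classical_laplacian_def dir_deriv_add smooth_dir_deriv)

lemma classical_laplacian_cmult:
  assumes "smooth f"
  shows "classical_laplacian (\<lambda>z. c * f z) z = c * classical_laplacian f z"
  using assms by (simp add: classical_laplacian_def dir_deriv_cmult smooth_dir_deriv algebra_simps)

lemma smooth_classical_laplacian: "smooth f \<Longrightarrow> smooth (classical_laplacian f)"
  unfolding classical_laplacian_def[abs_def] by (intro smooth_add smooth_dir_deriv)

lemma classical_laplacian_Re_power: "classical_laplacian (\<lambda>z. Re (c * z ^ n)) z = 0"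
  unfolding classical_laplacian_def dir_deriv_Re_power by (simp add: mult.assoc)

text \<open>
  Derivatives depend only on the germ of a function. This is how cutoff functions disappear from a
  Laplacian wherever they are locally constant.
\<close>

lemma dir_deriv_local:
  assumes "open S" "\<And>z. z \<in> S \<Longrightarrow> f z = g z" "z \<in> S"
  shows "dir_deriv v f z = dir_deriv v g z"
proof -
  have "(f has_derivative D) (at z) \<longleftrightarrow> (g has_derivative D) (at z)" for D
    using has_derivative_transform_within_open[of f D z UNIV S g]
      has_derivative_transform_within_open[of g D z UNIV S f] assms by auto
  then show ?thesis by (simp add: dir_deriv_def frechet_derivative_def)
qed

lemma classical_laplacian_local:
  assumes "open S" "\<And>z. z \<in> S \<Longrightarrow> f z = g z" "z \<in> S"
  shows "classical_laplacian f z = classical_laplacian g z"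
proof -
  have *: "dir_deriv v f w = dir_deriv v g w" if "w \<in> S" for v w
    using dir_deriv_local[OF assms(1,2) that] .
  show ?thesis
    unfolding classical_laplacian_def
    using dir_deriv_local[OF assms(1) * assms(3)] by simp
qed

lemma dir_deriv_const: "dir_deriv v (\<lambda>z. c) = (\<lambda>z. 0)"
  by (rule ext, rule dir_deriv_eq) simp

lemma dir_deriv_outside:
  assumes "z \<notin> closure {z. f z \<noteq> 0}"
  shows "dir_deriv v f z = 0"
proof -
  have "dir_deriv v f z = dir_deriv v (\<lambda>z. 0) z"
    by (rule dir_deriv_local[of "- closure {z. f z \<noteq> 0}"])
      (use assms closure_subset[of "{z. f z \<noteq> 0}"] in auto)
  then show ?thesis by (simp add: dir_deriv_const)
qed

lemma classical_laplacian_outside: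
  assumes "z \<notin> closure {z. f z \<noteq> 0}"
  shows "classical_laplacian f z = 0"
proof -
  have "classical_laplacian f z = classical_laplacian (\<lambda>z. 0) z"
    by (rule classical_laplacian_local[of "- closure {z. f z \<noteq> 0}"])
      (use assms closure_subset[of "{z. f z \<noteq> 0}"] in auto)
  then show ?thesis by (simp add: classical_laplacian_def dir_deriv_const)
qed

lemma smooth_dir_deriv_linear:
  assumes "smooth f"
  shows "dir_deriv v f = (\<lambda>z. Re v * dir_deriv 1 f z + Im v * dir_deriv \<i> f z)"
proof
  fix z
  interpret bounded_linear "\<lambda>v. dir_deriv v f z"
    using smooth_has_derivative[OF assms] by (rule has_derivative_bounded_linear)
  have "v = Re v *\<^sub>R 1 + Im v *\<^sub>R \<i>" by (simp add: complex_eq_iff)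
  then have "dir_deriv v f z = dir_deriv (Re v *\<^sub>R 1 + Im v *\<^sub>R \<i>) f z" by simp
  also have "\<dots> = Re v * dir_deriv 1 f z + Im v * dir_deriv \<i> f z" by (simp only: add scaleR real_scaleR_def)
  finally show "dir_deriv v f z = Re v * dir_deriv 1 f z + Im v * dir_deriv \<i> f z" .
qed

lemma test_functionI:
  assumes "smooth f" "compact K" "K \<subseteq> S" "\<And>z. f z \<noteq> 0 \<Longrightarrow> z \<in> K"
  shows "test_function S f"
proof -
  have "closure {z. f z \<noteq> 0} \<subseteq> K"
    using assms compact_imp_closed by (intro closure_minimal) auto
  moreover from this have "compact (closure {z. f z \<noteq> 0})"
    using compact_Int_closed[OF assms(2) closed_closure] by (metis inf.absorb2)
  ultimately show ?thesis
    using assms unfolding test_function_def by blast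
qed

lemma test_function_smooth: "test_function S f \<Longrightarrow> smooth f"
  by (simp add: test_function_def)

lemma test_function_mono: "test_function S f \<Longrightarrow> S \<subseteq> T \<Longrightarrow> test_function T f"
  by (auto simp: test_function_def)

lemma test_functionE:
  assumes "test_function S f"
  obtains K where "compact K" "K \<subseteq> S" "\<And>z. z \<notin> K \<Longrightarrow> f z = 0" "\<And>z v. z \<notin> K \<Longrightarrow> dir_deriv v f z = 0"
    "\<And>z. z \<notin> K \<Longrightarrow> classical_laplacian f z = 0" "K = closure {z. f z \<noteq> 0}"
proof (rule that[of "closure {z. f z \<noteq> 0}"])
  show "compact (closure {z. f z \<noteq> 0})" "closure {z. f z \<noteq> 0} \<subseteq> S"
    using assms by (auto simp: test_function_def)
  show "f z = 0" if "z \<notin> closure {z. f z \<noteq> 0}" for z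
    using that closure_subset[of "{z. f z \<noteq> 0}"] by blast
  show "dir_deriv v f z = 0" if "z \<notin> closure {z. f z \<noteq> 0}" for z v
    by (rule dir_deriv_outside[OF that])
  show "classical_laplacian f z = 0" if "z \<notin> closure {z. f z \<noteq> 0}" for z
    by (rule classical_laplacian_outside[OF that])
qed (rule refl)

lemma test_function_mult:
  assumes "test_function S f" "smooth g"
  shows "test_function S (\<lambda>z. f z * g z)"
  using assms(1)
proof (rule test_functionE)
  fix K assume K: "compact K" "K \<subseteq> S" "\<And>z. z \<notin> K \<Longrightarrow> f z = 0"
  show ?thesis
    by (rule test_functionI[of _ K])
      (use K assms in \<open>auto intro: smooth_mult compact_imp_closed simp: test_function_def\<close>)
qed

lemma test_function_add:
  assumes "test_function S f" "test_function S g"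
  shows "test_function S (\<lambda>z. f z + g z)"
  using assms(1)
proof (rule test_functionE)
  fix K assume K: "compact K" "K \<subseteq> S" "\<And>z. z \<notin> K \<Longrightarrow> f z = 0"
  from assms(2) show ?thesis
  proof (rule test_functionE)
    fix K' assume K': "compact K'" "K' \<subseteq> S" "\<And>z. z \<notin> K' \<Longrightarrow> g z = 0"
    have "z \<in> K \<union> K'" if "f z + g z \<noteq> 0" for z
      using that K(3)[of z] K'(3)[of z] by (cases "z \<in> K"; cases "z \<in> K'") simp_all
    moreover have "compact (K \<union> K')" "K \<union> K' \<subseteq> S"
      using K K' by (auto intro: compact_Un)
    moreover have "smooth (\<lambda>z. f z + g z)"
      using assms by (intro smooth_add) (auto simp: test_function_def)
    ultimately show ?thesis
      using test_functionI[of "\<lambda>z. f z + g z" "K \<union> K'" S] compact_imp_closed by blast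
  qed
qed

lemma test_function_cmult: "test_function S f \<Longrightarrow> test_function S (\<lambda>z. c * f z)"
  using test_function_mult[OF _ smooth_const, of S f c] by (simp add: mult.commute)

lemma bounded_of_compact_support:
  fixes f :: "complex \<Rightarrow> real"
  assumes "continuous_on UNIV f" "compact K" "\<And>z. z \<notin> K \<Longrightarrow> f z = 0"
  obtains B where "0 < B" "\<And>z. \<bar>f z\<bar> \<le> B"
proof -
  have "continuous_on K f"
    by (rule continuous_on_subset[OF assms(1)]) simp
  then have "compact (f ` K)"
    by (rule compact_continuous_image[OF _ assms(2)])
  then have "bounded (f ` K)"
    by (rule compact_imp_bounded)
  then obtain B where B: "\<And>z. z \<in> K \<Longrightarrow> \<bar>f z\<bar> \<le> B"
    unfolding bounded_iff by fastforce
  have "\<bar>f z\<bar> \<le> \<bar>B\<bar> + 1" for z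
  proof (cases "z \<in> K")
    case True
    then show ?thesis using B[of z] by linarith
  qed (simp add: assms(3))
  then show ?thesis using that[of "\<bar>B\<bar> + 1"] by simp
qed

section \<open>Cutoff functions, and measures determined by test functions\<close>

lemma smooth_flat: "smooth f \<Longrightarrow> smooth (\<lambda>z. flat 0 (f z))"
  by (rule smooth_comp[OF smooth1_intros(1)])

lemma smooth_step_comp: "smooth f \<Longrightarrow> smooth (\<lambda>z. smooth_step (f z))"
  by (rule smooth_comp[OF smooth1_smooth_step])

lemma bump_ball:
  assumes "0 < \<rho>"
  obtains \<phi> where "smooth \<phi>" "\<And>z. 0 \<le> \<phi> z" "\<And>z. 0 < \<phi> z \<longleftrightarrow> z \<in> ball a \<rho>"
proof (rule that[of "\<lambda>z. flat 0 (\<rho>\<^sup>2 - (norm (z - a))\<^sup>2)"])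
  show "smooth (\<lambda>z. flat 0 (\<rho>\<^sup>2 - (norm (z - a))\<^sup>2))"
    by (intro smooth_flat smooth_diff smooth_const smooth_norm_square)
  show "0 < flat 0 (\<rho>\<^sup>2 - (norm (z - a))\<^sup>2) \<longleftrightarrow> z \<in> ball a \<rho>" for z
  proof -
    have "(norm (z - a))\<^sup>2 < \<rho>\<^sup>2 \<longleftrightarrow> norm (z - a) < \<rho>"
      using assms power_mono_iff[of \<rho> "norm (z - a)" 2] by (meson less_eq_real_def norm_ge_zero not_le pos2)
    then show ?thesis
      unfolding flat_pos mem_ball dist_norm norm_minus_commute[of a z] by simp
  qed
qed (rule flat_nonneg)

lemma bump_box:
  obtains \<phi> where "smooth \<phi>" "\<And>z. 0 \<le> \<phi> z" "\<And>z. 0 < \<phi> z \<longleftrightarrow> z \<in> box a b"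
proof -
  define \<phi> where "\<phi> = (\<lambda>z. (flat 0 (Re z - Re a) * flat 0 (Re b - Re z)) *
      (flat 0 (Im z - Im a) * flat 0 (Im b - Im z)))"
  have "smooth \<phi>"
    unfolding \<phi>_def
    by (intro smooth_mult smooth_flat smooth_diff smooth_Re smooth_Im smooth_const)
  moreover have "0 \<le> \<phi> z" for z
    unfolding \<phi>_def by (intro mult_nonneg_nonneg flat_nonneg)
  moreover have "0 < \<phi> z \<longleftrightarrow> z \<in> box a b" for z
  proof -
    have *: "0 < x * y \<longleftrightarrow> 0 < x \<and> 0 < y" if "0 \<le> x" "0 \<le> y" for x y :: real
      using that by (auto simp: zero_less_mult_iff)
    show ?thesis
      unfolding \<phi>_def in_box_complex_iff
      by (simp add: * flat_nonneg flat_pos)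
  qed
  ultimately show ?thesis using that by blast
qed

lemma radial_cutoff:
  assumes "0 \<le> \<rho>1" "\<rho>1 < \<rho>2"
  obtains \<psi> where "smooth \<psi>" "\<And>z. 0 \<le> \<psi> z" "\<And>z. \<psi> z \<le> 1"
    "\<And>z. norm z \<le> \<rho>1 \<Longrightarrow> \<psi> z = 1" "\<And>z. norm z \<ge> \<rho>2 \<Longrightarrow> \<psi> z = 0"
proof (rule that[of "\<lambda>z. smooth_step (inverse (\<rho>2\<^sup>2 - \<rho>1\<^sup>2) * (\<rho>2\<^sup>2 - (norm (z - 0))\<^sup>2))"])
  have pos: "0 < \<rho>2\<^sup>2 - \<rho>1\<^sup>2" using assms by (simp add: power_strict_mono)
  show "smooth (\<lambda>z. smooth_step (inverse (\<rho>2\<^sup>2 - \<rho>1\<^sup>2) * (\<rho>2\<^sup>2 - (norm (z - 0))\<^sup>2)))"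
    by (intro smooth_step_comp smooth_cmult smooth_diff smooth_const smooth_norm_square)
  show "smooth_step (inverse (\<rho>2\<^sup>2 - \<rho>1\<^sup>2) * (\<rho>2\<^sup>2 - (norm (z - 0))\<^sup>2)) = 1" if "norm z \<le> \<rho>1" for z :: complex
  proof (rule smooth_step_eq_1)
    have "(norm z)\<^sup>2 \<le> \<rho>1\<^sup>2" using that by (intro power_mono) auto
    then show "1 \<le> inverse (\<rho>2\<^sup>2 - \<rho>1\<^sup>2) * (\<rho>2\<^sup>2 - (norm (z - 0))\<^sup>2)"
      using pos by (simp add: divide_simps mult.commute flip: divide_inverse)
  qed
  show "smooth_step (inverse (\<rho>2\<^sup>2 - \<rho>1\<^sup>2) * (\<rho>2\<^sup>2 - (norm (z - 0))\<^sup>2)) = 0" if "norm z \<ge> \<rho>2" for z :: complex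
  proof (rule smooth_step_eq_0)
    have "\<rho>2\<^sup>2 \<le> (norm z)\<^sup>2" using that assms by (intro power_mono) auto
    then show "inverse (\<rho>2\<^sup>2 - \<rho>1\<^sup>2) * (\<rho>2\<^sup>2 - (norm (z - 0))\<^sup>2) \<le> 0"
      using pos by (simp add: mult_le_0_iff)
  qed
qed (rule smooth_step_bounds)+

text \<open>
  A finite sum of bumps on balls that cover the compact set is bounded below on it. Divided by
  that bound, the sum is at least 1 there, and the smooth step turns it into exactly 1.
\<close>

lemma smooth_urysohn:
  assumes "compact K" "open U" "K \<subseteq> U"
  obtains \<eta> K' where "smooth \<eta>" "\<And>z. 0 \<le> \<eta> z" "\<And>z. \<eta> z \<le> 1" "\<And>z. z \<in> K \<Longrightarrow> \<eta> z = 1"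
    "compact K'" "K' \<subseteq> U" "\<And>z. z \<notin> K' \<Longrightarrow> \<eta> z = 0"
proof (cases "K = {}")
  case True
  show ?thesis by (rule that[of "\<lambda>z. 0" "{}"]) (use True in \<open>auto intro: smooth_const\<close>)
next
  case False
  have "\<forall>x\<in>K. \<exists>\<rho>>0. cball x \<rho> \<subseteq> U"
    using assms open_contains_cball by (metis subsetD)
  then obtain \<rho> where \<rho>: "\<And>x. x \<in> K \<Longrightarrow> 0 < \<rho> x" "\<And>x. x \<in> K \<Longrightarrow> cball x (\<rho> x) \<subseteq> U"
    by metis
  have "K \<subseteq> (\<Union>x\<in>K. ball x (\<rho> x))" using \<rho>(1) by force
  from compactE_image[OF assms(1) _ this] obtain C where C: "C \<subseteq> K" "finite C" "K \<subseteq> (\<Union>x\<in>C. ball x (\<rho> x))"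
    by auto
  have "\<forall>x\<in>C. \<exists>\<phi>. smooth \<phi> \<and> (\<forall>z. 0 \<le> \<phi> z) \<and> (\<forall>z. 0 < \<phi> z \<longleftrightarrow> z \<in> ball x (\<rho> x))"
  proof
    fix x assume "x \<in> C"
    then have "0 < \<rho> x" using \<rho> C by auto
    from bump_ball[OF this, of x]
    show "\<exists>\<phi>. smooth \<phi> \<and> (\<forall>z. 0 \<le> \<phi> z) \<and> (\<forall>z. 0 < \<phi> z \<longleftrightarrow> z \<in> ball x (\<rho> x))" by metis
  qed
  then obtain \<phi> where \<phi>: "\<And>x. x \<in> C \<Longrightarrow> smooth (\<phi> x)" "\<And>x z. x \<in> C \<Longrightarrow> 0 \<le> \<phi> x z"
    "\<And>x z. x \<in> C \<Longrightarrow> 0 < \<phi> x z \<longleftrightarrow> z \<in> ball x (\<rho> x)" by metis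
  define s where "s = (\<lambda>z. \<Sum>x\<in>C. \<phi> x z)"
  have s: "smooth s" unfolding s_def using \<phi>(1) by (rule smooth_sum)
  have s_pos: "0 < s z" if "z \<in> K" for z
  proof -
    from that C(3) obtain x where x: "x \<in> C" "z \<in> ball x (\<rho> x)" by blast
    with \<phi> have "0 < \<phi> x z" by blast
    then show ?thesis unfolding s_def
      using sum_pos2[OF C(2) x(1), of "\<lambda>x. \<phi> x z"] \<phi>(2) by blast
  qed
  obtain z0 where z0: "z0 \<in> K" "\<And>z. z \<in> K \<Longrightarrow> s z0 \<le> s z"
    using continuous_attains_inf[OF assms(1) False smooth_continuous_on[OF s]] by blast
  define \<eta> where "\<eta> = (\<lambda>z. smooth_step (inverse (s z0) * s z))"
  have zero: "s z = 0" if "z \<notin> (\<Union>x\<in>C. cball x (\<rho> x))" for z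
  proof -
    have "\<phi> x z = 0" if "x \<in> C" for x
      using \<phi>(2,3)[OF that, of z] \<open>z \<notin> _\<close> that ball_subset_cball[of x "\<rho> x"]
      by (metis UN_I less_eq_real_def subsetD)
    then show ?thesis by (simp add: s_def)
  qed
  show ?thesis
  proof (rule that[of \<eta> "\<Union>x\<in>C. cball x (\<rho> x)"])
    show "smooth \<eta>" unfolding \<eta>_def by (intro smooth_step_comp smooth_cmult s)
    show "0 \<le> \<eta> z" "\<eta> z \<le> 1" for z unfolding \<eta>_def by (rule smooth_step_bounds)+
    show "\<eta> z = 1" if "z \<in> K" for z
      unfolding \<eta>_def using s_pos[OF z0(1)] z0(2)[OF that]
      by (intro smooth_step_eq_1) (simp add: field_simps)
    show "\<eta> z = 0" if "z \<notin> (\<Union>x\<in>C. cball x (\<rho> x))" for z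
      unfolding \<eta>_def zero[OF that] by (simp add: smooth_step_eq_0)
    show "compact (\<Union>x\<in>C. cball x (\<rho> x))" using C by (intro compact_UN) auto
    show "(\<Union>x\<in>C. cball x (\<rho> x)) \<subseteq> U" using C \<rho> by blast
  qed
qed

text \<open>
  The test functions \<open>1 - exp (- n \<phi>)\<close> increase to the indicator of the set where \<open>\<phi>\<close> is positive,
  so the mass of that set is a limit of integrals of test functions.
\<close>

lemma emeasure_positivity_set:
  fixes M N :: "complex measure"
  assumes sets: "sets M = sets borel" "sets N = sets borel"
    and K: "compact K" "emeasure M K < \<infinity>" "emeasure N K < \<infinity>" "K \<subseteq> U"
    and eq: "\<And>\<phi>. test_function U \<phi> \<Longrightarrow> (LINT z|M. \<phi> z) = (LINT z|N. \<phi> z)"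
    and \<phi>: "smooth \<phi>" "\<And>z. 0 \<le> \<phi> z" "\<And>z. z \<notin> K \<Longrightarrow> \<phi> z = 0"
  shows "emeasure M {z. 0 < \<phi> z} = emeasure N {z. 0 < \<phi> z}"
proof -
  define g where "g = (\<lambda>n z. 1 - exp (- real n * \<phi> z))"
  have g_smooth: "smooth (g n)" for n
    unfolding g_def
    by (intro smooth_diff smooth_const smooth_comp[OF smooth1_intros(4)] smooth_cmult \<phi>(1))
  have g_test: "test_function U (g n)" for n
    by (rule test_functionI[of _ K])
      (use K \<phi>(3) g_smooth compact_imp_closed in \<open>auto simp: g_def\<close>)
  have meas: "{z. 0 < \<phi> z} \<in> sets borel"
    using smooth_borel_measurable[OF \<phi>(1)] by measurable
  have lim: "(\<lambda>n. LINT z|L. g n z) \<longlonglongrightarrow> measure L {z. 0 < \<phi> z}"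
    and fin: "emeasure L {z. 0 < \<phi> z} < \<infinity>"
    if L: "sets L = sets borel" "emeasure L K < \<infinity>" for L
  proof -
    have "{z. 0 < \<phi> z} \<subseteq> K" using \<phi>(3) by force
    then have "emeasure L {z. 0 < \<phi> z} \<le> emeasure L K"
      by (intro emeasure_mono) (use L borel_compact[OF K(1)] in auto)
    with L show "emeasure L {z. 0 < \<phi> z} < \<infinity>" by (simp add: order_le_less_trans)
    have borel: "f \<in> borel_measurable L \<longleftrightarrow> f \<in> borel_measurable borel" for f :: "complex \<Rightarrow> real"
      by (rule measurable_cong_sets[OF L(1) refl, THEN arg_cong])
    have "(\<lambda>n. LINT z|L. g n z) \<longlonglongrightarrow> (LINT z|L. indicator {z. 0 < \<phi> z} z)"
    proof (rule integral_dominated_convergence[where w = "indicator K"])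
      show "integrable L (indicator K :: complex \<Rightarrow> real)"
        using L borel_compact[OF K(1)] by (intro integrable_real_indicator) auto
      show "AE z in L. (\<lambda>n. g n z) \<longlonglongrightarrow> indicator {z. 0 < \<phi> z} z"
      proof (rule AE_I2)
        fix z
        show "(\<lambda>n. g n z) \<longlonglongrightarrow> indicator {z. 0 < \<phi> z} z"
        proof (cases "0 < \<phi> z")
          case True
          have "(\<lambda>n. 1 - exp (- \<phi> z) ^ n) \<longlonglongrightarrow> 1 - 0"
            using True by (intro tendsto_diff tendsto_const LIMSEQ_power_zero) auto
          moreover have "exp (- \<phi> z) ^ n = exp (- real n * \<phi> z)" for n
            by (simp add: exp_of_nat_mult[symmetric])
          ultimately show ?thesis using True by (simp add: g_def)
        next
          case False
          with \<phi>(2)[of z] show ?thesis by (simp add: g_def)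
        qed
      qed
      show "AE z in L. norm (g n z) \<le> indicator K z" for n
      proof (rule AE_I2)
        fix z
        show "norm (g n z) \<le> indicator K z"
          using \<phi>(2,3)[of z] by (cases "z \<in> K") (auto simp: g_def)
      qed
    qed (use meas smooth_borel_measurable[OF g_smooth] in \<open>auto simp: borel\<close>)
    then show "(\<lambda>n. LINT z|L. g n z) \<longlonglongrightarrow> measure L {z. 0 < \<phi> z}"
      using meas L by (simp add: sets_eq_imp_space_eq[OF L(1)])
  qed
  have "(\<lambda>n. LINT z|M. g n z) \<longlonglongrightarrow> measure N {z. 0 < \<phi> z}"
    unfolding eq[OF g_test] by (rule lim[OF sets(2) K(3)])
  then have "measure M {z. 0 < \<phi> z} = measure N {z. 0 < \<phi> z}"
    by (rule LIMSEQ_unique[OF lim[OF sets(1) K(2)]])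
  then show ?thesis
    using fin[OF sets(1) K(2)] fin[OF sets(2) K(3)]
    by (simp add: emeasure_eq_ennreal_measure)
qed

text \<open>
  A box intersected with a smaller concentric ball is the positivity set of a product of two bumps.
  Boxes form an intersection-stable generator of the Borel sets, and the smaller balls exhaust the
  ball. The Laplacian and the boundary measure are described by their integrals, and their
  uniqueness comes from this lemma.
\<close>

lemma measure_eqI_test_functions:
  fixes M N :: "complex measure"
  assumes sets: "sets M = sets borel" "sets N = sets borel"
    and null: "emeasure M (- ball 0 R) = 0" "emeasure N (- ball 0 R) = 0"
    and fin: "\<And>K. compact K \<Longrightarrow> K \<subseteq> ball 0 R \<Longrightarrow> emeasure M K < \<infinity>"
      "\<And>K. compact K \<Longrightarrow> K \<subseteq> ball 0 R \<Longrightarrow> emeasure N K < \<infinity>"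
    and eq: "\<And>\<phi>. test_function (ball 0 R) \<phi> \<Longrightarrow> (LINT z|M. \<phi> z) = (LINT z|N. \<phi> z)"
    and R: "0 < R"
  shows "M = N"
proof -
  have local: "emeasure M (ball 0 \<rho> \<inter> A) = emeasure N (ball 0 \<rho> \<inter> A)"
    if \<rho>: "0 < \<rho>" "\<rho> < R" and A: "A \<in> sets borel" for \<rho> A
  proof -
    (* Cut down to a smaller ball, the measures are finite, as uniqueness on a generator requires. *)
    define M' where "M' = density M (indicator (ball 0 \<rho>))"
    define N' where "N' = density N (indicator (ball 0 \<rho>))"
    have finK: "emeasure M (cball 0 \<rho>) < \<infinity>" "emeasure N (cball 0 \<rho>) < \<infinity>"
      using \<rho> by (auto intro!: fin[unfolded infinity_ennreal_def])
    have box: "emeasure M (ball 0 \<rho> \<inter> box a b) = emeasure N (ball 0 \<rho> \<inter> box a b)" for a b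
    proof -
      obtain \<phi>1 where \<phi>1: "smooth \<phi>1" "\<And>z. 0 \<le> \<phi>1 z" "\<And>z. 0 < \<phi>1 z \<longleftrightarrow> z \<in> ball 0 \<rho>"
        using bump_ball[OF \<rho>(1), of 0] by blast
      obtain \<phi>2 where \<phi>2: "smooth \<phi>2" "\<And>z. 0 \<le> \<phi>2 z" "\<And>z. 0 < \<phi>2 z \<longleftrightarrow> z \<in> box a b"
        using bump_box[of a b] by blast
      have pos: "{z. 0 < \<phi>1 z * \<phi>2 z} = ball 0 \<rho> \<inter> box a b"
        using \<phi>1(2,3) \<phi>2(2,3) by (auto simp: zero_less_mult_iff not_less[symmetric])
      have "emeasure M {z. 0 < \<phi>1 z * \<phi>2 z} = emeasure N {z. 0 < \<phi>1 z * \<phi>2 z}"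
      proof (rule emeasure_positivity_set[OF sets _ finK _ eq])
        show "smooth (\<lambda>z. \<phi>1 z * \<phi>2 z)" by (intro smooth_mult \<phi>1 \<phi>2)
        show "0 \<le> \<phi>1 z * \<phi>2 z" for z using \<phi>1(2) \<phi>2(2) by (intro mult_nonneg_nonneg)
        show "\<phi>1 z * \<phi>2 z = 0" if "z \<notin> cball 0 \<rho>" for z
        proof -
          have "\<not> 0 < \<phi>1 z" using that \<phi>1(3)[of z] by simp
          with \<phi>1(2)[of z] show ?thesis by simp
        qed
      qed (use \<rho> in auto)
      then show ?thesis by (simp only: pos)
    qed
    have "M' = N'"
    proof (rule measure_eqI_generator_eq[where E = "range (\<lambda>(a, b). box a b :: complex set)" and \<Omega> = UNIV
          and A = "\<lambda>n. box (- (of_nat n + \<i> * of_nat n)) (of_nat n + \<i> * of_nat n)"])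
      show "Int_stable (range (\<lambda>(a, b). box a b :: complex set))"
        by (auto simp: Int_stable_def box_Int_box)
      show "emeasure M' X = emeasure N' X" if "X \<in> range (\<lambda>(a, b). box a b)" for X
        using that box by (auto simp: M'_def N'_def emeasure_restricted sets)
      show "sets M' = sigma_sets UNIV (range (\<lambda>(a, b). box a b))"
        "sets N' = sigma_sets UNIV (range (\<lambda>(a, b). box a b))"
        unfolding M'_def N'_def using sets
        by (simp_all add: borel_eq_box sets_measure_of_conv)
      show "(\<Union>n. box (- (of_nat n + \<i> * of_nat n)) (of_nat n + \<i> * of_nat n)) = (UNIV :: complex set)"
      proof -
        have "\<exists>n. z \<in> box (- (of_nat n + \<i> * of_nat n)) (of_nat n + \<i> * of_nat n)" for z :: complex
        proof -
          obtain n where "norm z < real n" using reals_Archimedean2 by blast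
          then show ?thesis
            using abs_Re_le_cmod[of z] abs_Im_le_cmod[of z]
            by (intro exI[of _ n]) (auto simp: in_box_complex_iff)
        qed
        then show ?thesis by blast
      qed
      show "emeasure M' (box (- (of_nat n + \<i> * of_nat n)) (of_nat n + \<i> * of_nat n)) \<noteq> \<infinity>" for n
      proof -
        have "emeasure M' (box (- (of_nat n + \<i> * of_nat n)) (of_nat n + \<i> * of_nat n)) \<le> emeasure M (cball 0 \<rho>)"
          unfolding M'_def by (subst emeasure_restricted) (auto simp: sets intro!: emeasure_mono)
        with finK(1) show ?thesis by (auto simp: top_unique)
      qed
    qed auto
    then have "emeasure M' A = emeasure N' A" by simp
    then show ?thesis using A by (simp add: M'_def N'_def emeasure_restricted sets)
  qed
  define \<rho> where "\<rho> n = R * (1 - 1 / real (n + 2))" for n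
  have \<rho>: "0 < \<rho> n" "\<rho> n < R" for n
    using mult_pos_pos[OF R, of "1 - 1 / real (n + 2)"] R by (simp_all add: \<rho>_def)
  have \<rho>_mono: "\<rho> m \<le> \<rho> n" if "m \<le> n" for m n
    using R that by (auto simp: \<rho>_def intro!: mult_left_mono divide_left_mono)
  have \<rho>_lim: "\<rho> \<longlonglongrightarrow> R"
  proof -
    have "(\<lambda>n. 1 / real (n + 2)) \<longlonglongrightarrow> 0"
      by (rule LIMSEQ_ignore_initial_segment[OF lim_1_over_n, of 2])
    then have "(\<lambda>n. R * (1 - 1 / real (n + 2))) \<longlonglongrightarrow> R * (1 - 0)"
      by (intro tendsto_intros)
    then show ?thesis by (simp add: \<rho>_def[abs_def])
  qed
  have Un: "(\<Union>n. ball 0 (\<rho> n) \<inter> A) = ball 0 R \<inter> A" for A :: "complex set"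
  proof -
    have "\<exists>n. z \<in> ball 0 (\<rho> n)" if "z \<in> ball 0 R" for z :: complex
    proof -
      have "eventually (\<lambda>n. norm z < \<rho> n) sequentially"
        using that by (intro order_tendstoD(1)[OF \<rho>_lim]) simp
      then show ?thesis by (auto simp: eventually_sequentially)
    qed
    moreover have "ball 0 (\<rho> n) \<subseteq> (ball 0 R :: complex set)" for n
      using \<rho>(2)[of n] by (intro subset_ball) simp
    ultimately show ?thesis by blast
  qed
  have lim: "(\<lambda>n. emeasure L (ball 0 (\<rho> n) \<inter> A)) \<longlonglongrightarrow> emeasure L A"
    if L: "sets L = sets borel" "emeasure L (- ball 0 R) = 0" and A: "A \<in> sets borel" for L and A :: "complex set"
  proof -
    have "(\<lambda>n. emeasure L (ball 0 (\<rho> n) \<inter> A)) \<longlonglongrightarrow> emeasure L (\<Union>n. ball 0 (\<rho> n) \<inter> A)"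
    proof (rule Lim_emeasure_incseq)
      show "incseq (\<lambda>n. ball 0 (\<rho> n) \<inter> A)"
        by (auto simp: incseq_def dest!: \<rho>_mono)
    qed (use A in \<open>auto simp: L(1)\<close>)
    moreover have "emeasure L (A - (- ball 0 R)) = emeasure L A"
      by (rule emeasure_Diff_null_set) (use A in \<open>simp_all add: L null_sets_def\<close>)
    moreover have "A - (- ball 0 R) = ball 0 R \<inter> A" by blast
    ultimately show ?thesis unfolding Un by simp
  qed
  show "M = N"
  proof (rule measure_eqI)
    fix A assume "A \<in> sets M"
    then have A: "A \<in> sets borel" using sets by simp
    have "(\<lambda>n. emeasure M (ball 0 (\<rho> n) \<inter> A)) \<longlonglongrightarrow> emeasure N A"
      unfolding local[OF \<rho> A] by (rule lim[OF sets(2) null(2) A])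
    then show "emeasure M A = emeasure N A"
      by (rule LIMSEQ_unique[OF lim[OF sets(1) null(1) A]])
  qed (simp add: sets)
qed

section \<open>Moments on the circle and the Poisson formula\<close>

lemma uniform_circle_parameter:
  "uniform_measure lborel {0..<2 * pi} = density lborel (\<lambda>t. ennreal (indicator {0..2 * pi} t / (2 * pi)))"
  unfolding uniform_measure_def
proof (rule density_cong)
  have "AE t in lborel. t \<noteq> 2 * pi" by (rule AE_lborel_singleton)
  then show "AE t in lborel. indicator {0..<2 * pi} t / emeasure lborel {0..<2 * pi} =
      ennreal (indicator {0..2 * pi} t / (2 * pi))"
  proof (rule AE_mp, intro AE_I2 impI)
    fix t :: real assume "t \<noteq> 2 * pi"
    then have "indicator {0..<2 * pi} t = (indicator {0..2 * pi} t :: ennreal)"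
      by (auto simp: indicator_def)
    moreover have "(1 :: ennreal) / ennreal (2 * pi) = ennreal (1 / (2 * pi))"
      by (simp add: divide_ennreal flip: ennreal_1)
    ultimately show "indicator {0..<2 * pi} t / emeasure lborel {0..<2 * pi} =
      ennreal (indicator {0..2 * pi} t / (2 * pi))"
      by (auto simp: indicator_def)
  qed
qed auto

lemma measurable_cis [measurable]: "cis \<in> borel_measurable borel"
  by (intro borel_measurable_continuous_onI continuous_intros)

lemma measurable_cnj [measurable]: "cnj \<in> borel_measurable borel"
  by (intro borel_measurable_continuous_onI continuous_intros)

lemma sets_circle_measure [measurable_cong, simp]: "sets circle_measure = sets borel"
  and space_circle_measure [simp]: "space circle_measure = UNIV"
  by (simp_all add: circle_measure_def)

lemma prob_space_circle_measure: "prob_space circle_measure"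
  unfolding circle_measure_def
  by (intro prob_space.prob_space_distr prob_space_uniform_measure) auto

interpretation circle: prob_space circle_measure
  by (rule prob_space_circle_measure)

lemma circle_integral:
  fixes f :: "complex \<Rightarrow> 'a :: {banach, second_countable_topology}"
  assumes [measurable]: "f \<in> borel_measurable borel"
  shows "(LINT \<zeta>|circle_measure. f \<zeta>) =
    (LINT t|lborel. (indicator {0..2 * pi} t / (2 * pi)) *\<^sub>R f (cis t))"
  unfolding circle_measure_def uniform_circle_parameter
  by (subst integral_distr, simp, simp, subst integral_density) auto

lemma AE_circle: "AE \<zeta> in circle_measure. norm \<zeta> = 1"
  unfolding circle_measure_def by (subst AE_distr_iff) auto

lemma circle_integrable_bounded:
  fixes f :: "complex \<Rightarrow> 'a :: {banach, second_countable_topology}"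
  assumes "f \<in> borel_measurable borel" "\<And>\<zeta>. norm \<zeta> = 1 \<Longrightarrow> norm (f \<zeta>) \<le> B"
  shows "integrable circle_measure f"
proof (rule circle.integrable_const_bound)
  show "AE \<zeta> in circle_measure. norm (f \<zeta>) \<le> B"
    using AE_circle by (rule AE_mp) (use assms(2) in auto)
qed (use assms(1) in simp)

lemma circle_integral_cong:
  fixes f :: "complex \<Rightarrow> 'a :: {banach, second_countable_topology}"
  assumes "f \<in> borel_measurable borel" "g \<in> borel_measurable borel"
    "\<And>\<zeta>. norm \<zeta> = 1 \<Longrightarrow> f \<zeta> = g \<zeta>"
  shows "(LINT \<zeta>|circle_measure. f \<zeta>) = (LINT \<zeta>|circle_measure. g \<zeta>)"
proof (rule integral_cong_AE)
  show "AE \<zeta> in circle_measure. f \<zeta> = g \<zeta>"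
    using AE_circle by (rule AE_mp) (use assms(3) in auto)
qed (use assms in simp_all)

text \<open>
  On the circle the integrand is \<open>cis (k t)\<close> with \<open>k = m - n\<close>, which has a \<open>2\<pi>\<close>-periodic primitive
  unless \<open>k = 0\<close>.
\<close>

lemma circle_moment:
  "(LINT \<zeta>|circle_measure. \<zeta> ^ m * cnj \<zeta> ^ n) = (if m = n then 1 else 0)"
proof -
  have [measurable]: "(\<lambda>\<zeta>::complex. \<zeta> ^ m * cnj \<zeta> ^ n) \<in> borel_measurable borel"
    by (intro borel_measurable_continuous_onI continuous_intros)
  define k where "k = real m - real n"
  have cis: "cis t ^ m * cnj (cis t) ^ n = cis (k * t)" for t
    by (simp add: k_def cis_cnj Complex.DeMoivre cis_mult algebra_simps)
  have eq: "(LINT \<zeta>|circle_measure. \<zeta> ^ m * cnj \<zeta> ^ n) =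
      (LINT t|lborel. (indicator {0..2 * pi} t / (2 * pi)) *\<^sub>R cis (k * t))"
    by (subst circle_integral) (simp_all add: cis)
  show ?thesis
  proof (cases "m = n")
    case True
    have "(LINT \<zeta>|circle_measure. \<zeta> ^ m * cnj \<zeta> ^ n) = (LINT \<zeta>|circle_measure. (1::complex))"
    proof (rule circle_integral_cong)
      fix \<zeta> :: complex assume "norm \<zeta> = 1"
      then have "\<zeta> * cnj \<zeta> = 1" by (simp add: complex_norm_square[symmetric])
      then show "\<zeta> ^ m * cnj \<zeta> ^ n = 1" using True by (simp flip: power_mult_distrib)
    qed simp_all
    then show ?thesis using True circle.prob_space by simp
  next
    case False
    then have k: "k \<noteq> 0" by (simp add: k_def)
    define F where "F t = (1 / (2 * pi * \<i> * k)) * cis (k * t)" for t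
    have "(LINT t|lborel. indicator {0..2 * pi} t *\<^sub>R ((1 / (2 * pi)) *\<^sub>R cis (k * t))) = F (2 * pi) - F 0"
    proof (rule integral_FTC_Icc)
      show "(F has_vector_derivative (1 / (2 * pi)) *\<^sub>R cis (k * t)) (at t within {0..2 * pi})" for t
        unfolding F_def cis_conv_exp using k
        by (auto intro!: derivative_eq_intros has_vector_derivative_real_field simp: scaleR_conv_of_real field_simps)
      show "continuous_on {0..2 * pi} (\<lambda>t. (1 / (2 * pi)) *\<^sub>R cis (k * t))"
        unfolding cis_conv_exp by (intro continuous_intros)
    qed simp
    moreover have "cis (k * (2 * pi)) = 1"
    proof -
      have "k * (2 * pi) = 2 * pi * real_of_int (int m - int n)" by (simp add: k_def)
      then show ?thesis by (simp only: cis_multiple_2pi[OF Ints_of_int])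
    qed
    ultimately have zero: "(LINT t|lborel. indicator {0..2 * pi} t *\<^sub>R ((1 / (2 * pi)) *\<^sub>R cis (k * t))) = 0"
      by (simp add: F_def)
    have "(indicator {0..2 * pi} t / (2 * pi)) *\<^sub>R cis (k * t) =
        indicator {0..2 * pi} t *\<^sub>R ((1 / (2 * pi)) *\<^sub>R cis (k * t))" for t
      by simp
    then have "(LINT \<zeta>|circle_measure. \<zeta> ^ m * cnj \<zeta> ^ n) = 0"
      unfolding eq using zero by (simp only:)
    then show ?thesis unfolding if_not_P[OF False] .
  qed
qed

lemma circle_moment_integrable: "integrable circle_measure (\<lambda>\<zeta>. c * (\<zeta> ^ m * cnj \<zeta> ^ n))"
proof (rule circle_integrable_bounded[where B = "norm c"])
  show "(\<lambda>\<zeta>. c * (\<zeta> ^ m * cnj \<zeta> ^ n)) \<in> borel_measurable borel"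
    by (intro borel_measurable_continuous_onI continuous_intros)
qed (simp add: norm_mult norm_power)

lemma circle_real_moments:
  "(LINT \<zeta>|circle_measure. Re \<zeta>) = 0" "(LINT \<zeta>|circle_measure. Im \<zeta>) = 0"
  "(LINT \<zeta>|circle_measure. Re \<zeta> * Re \<zeta>) = 1 / 2" "(LINT \<zeta>|circle_measure. Im \<zeta> * Im \<zeta>) = 1 / 2"
  "(LINT \<zeta>|circle_measure. Re \<zeta> * Im \<zeta>) = 0"
proof -
  show "(LINT \<zeta>|circle_measure. Re \<zeta>) = 0" "(LINT \<zeta>|circle_measure. Im \<zeta>) = 0"
    using integral_Re[OF circle_moment_integrable[of 1 1 0]] integral_Im[OF circle_moment_integrable[of 1 1 0]]
      circle_moment[of 1 0] by simp_all
  have sq: "Re \<zeta> * Re \<zeta> + Im \<zeta> * Im \<zeta> = 1" if "norm \<zeta> = 1" for \<zeta>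
    using cmod_power2[of \<zeta>] that by (simp add: power2_eq_square)
  have "norm (Re \<zeta> * Re \<zeta>) \<le> 1" "norm (Im \<zeta> * Im \<zeta>) \<le> 1" if "norm \<zeta> = 1" for \<zeta>
    using sq[OF that] zero_le_square[of "Re \<zeta>"] zero_le_square[of "Im \<zeta>"]
    by (simp_all only: real_norm_def abs_mult_self)
  then have int: "integrable circle_measure (\<lambda>\<zeta>. Re \<zeta> * Re \<zeta>)" "integrable circle_measure (\<lambda>\<zeta>. Im \<zeta> * Im \<zeta>)"
    by (intro circle_integrable_bounded[where B = 1]; simp)+
  have "(LINT \<zeta>|circle_measure. Re \<zeta> * Re \<zeta> - Im \<zeta> * Im \<zeta>) = 0"
    "(LINT \<zeta>|circle_measure. Re \<zeta> * Im \<zeta> + Im \<zeta> * Re \<zeta>) = 0"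
    using integral_Re[OF circle_moment_integrable[of 1 2 0]] integral_Im[OF circle_moment_integrable[of 1 2 0]]
      circle_moment[of 2 0] by (simp_all add: power2_eq_square)
  moreover have "(LINT \<zeta>|circle_measure. Re \<zeta> * Re \<zeta> + Im \<zeta> * Im \<zeta>) = (LINT \<zeta>|circle_measure. 1)"
    by (rule circle_integral_cong) (simp_all add: sq)
  ultimately show "(LINT \<zeta>|circle_measure. Re \<zeta> * Re \<zeta>) = 1 / 2" "(LINT \<zeta>|circle_measure. Im \<zeta> * Im \<zeta>) = 1 / 2"
    "(LINT \<zeta>|circle_measure. Re \<zeta> * Im \<zeta>) = 0"
    using int circle.prob_space by (simp_all add: mult.commute)
qed

text \<open>
  Both integrands are sums of geometric series that converge uniformly on the circle. Integrating
  term by term leaves at most one nonzero moment.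
\<close>

lemma circle_geometric:
  assumes w: "norm w < 1"
  shows "(LINT \<zeta>|circle_measure. \<zeta> ^ n / (1 - w * cnj \<zeta>)) = w ^ n" (is ?A)
    and "(LINT \<zeta>|circle_measure. \<zeta> ^ Suc n / (1 - w * \<zeta>)) = 0" (is ?B)
proof -
  have *: "(\<lambda>k. w ^ k * (if a + k * b = c + k * d then 1 else 0)) sums (LINT \<zeta>|circle_measure. g \<zeta>)"
    if g: "g \<in> borel_measurable borel"
      "\<And>\<zeta>. norm \<zeta> = 1 \<Longrightarrow> (\<lambda>k. w ^ k * (\<zeta> ^ (a + k * b) * cnj \<zeta> ^ (c + k * d))) sums g \<zeta>"
    for a b c d and g :: "complex \<Rightarrow> complex"
  proof -
    let ?f = "\<lambda>k \<zeta>. w ^ k * (\<zeta> ^ (a + k * b) * cnj \<zeta> ^ (c + k * d))"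
    have norm_f: "norm (?f k \<zeta>) = norm w ^ k" if "norm \<zeta> = 1" for k \<zeta>
      using that by (simp add: norm_mult norm_power)
    have "(\<lambda>k. LINT \<zeta>|circle_measure. ?f k \<zeta>) sums (LINT \<zeta>|circle_measure. (\<Sum>k. ?f k \<zeta>))"
    proof (rule sums_integral)
      show "integrable circle_measure (?f k)" for k by (rule circle_moment_integrable)
      show "AE \<zeta> in circle_measure. summable (\<lambda>k. norm (?f k \<zeta>))"
        using AE_circle by (rule AE_mp) (use w in \<open>auto simp: norm_f intro!: summable_geometric\<close>)
      have "(LINT \<zeta>|circle_measure. norm (?f k \<zeta>)) = norm w ^ k" for k
      proof -
        have "(LINT \<zeta>|circle_measure. norm (?f k \<zeta>)) = (LINT \<zeta>|circle_measure. norm w ^ k)"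
        proof (rule circle_integral_cong)
          show "(\<lambda>\<zeta>. norm (?f k \<zeta>)) \<in> borel_measurable borel"
            by (intro borel_measurable_continuous_onI continuous_intros)
        qed (simp_all add: norm_f)
        then show ?thesis using circle.prob_space by simp
      qed
      then show "summable (\<lambda>k. LINT \<zeta>|circle_measure. norm (?f k \<zeta>))"
        using w by (simp add: summable_geometric)
    qed
    moreover have "(LINT \<zeta>|circle_measure. (\<Sum>k. ?f k \<zeta>)) = (LINT \<zeta>|circle_measure. g \<zeta>)"
    proof (rule circle_integral_cong)
      show "(\<lambda>\<zeta>. \<Sum>k. ?f k \<zeta>) \<in> borel_measurable borel"
        by (intro borel_measurable_suminf borel_measurable_continuous_onI continuous_intros)
    qed (use g sums_unique in \<open>auto simp: sums_iff\<close>)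
    moreover have "(LINT \<zeta>|circle_measure. ?f k \<zeta>) = w ^ k * (if a + k * b = c + k * d then 1 else 0)" for k
      by (simp add: circle_moment)
    ultimately show ?thesis by (simp only:)
  qed
  have geo: "(\<lambda>k. x * (w * y) ^ k) sums (x / (1 - w * y))" if "norm y = 1" for x y
    using sums_mult[OF geometric_sums[of "w * y"], of x] w that by (simp add: norm_mult)
  have meas: "(\<lambda>\<zeta>::complex. f \<zeta> / (1 - w * cnj \<zeta>)) \<in> borel_measurable borel"
    "(\<lambda>\<zeta>::complex. f \<zeta> / (1 - w * \<zeta>)) \<in> borel_measurable borel"
    if "continuous_on UNIV f" for f
  proof -
    have [measurable]: "f \<in> borel_measurable borel" by (rule borel_measurable_continuous_onI[OF that])
    show "(\<lambda>\<zeta>::complex. f \<zeta> / (1 - w * cnj \<zeta>)) \<in> borel_measurable borel"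
      "(\<lambda>\<zeta>::complex. f \<zeta> / (1 - w * \<zeta>)) \<in> borel_measurable borel"
      by measurable
  qed
  have "(\<lambda>k. w ^ k * (if n + k * 0 = 0 + k * 1 then 1 else 0)) sums
      (LINT \<zeta>|circle_measure. \<zeta> ^ n / (1 - w * cnj \<zeta>))"
  proof (rule *)
    show "(\<lambda>k. w ^ k * (\<zeta> ^ (n + k * 0) * cnj \<zeta> ^ (0 + k * 1))) sums (\<zeta> ^ n / (1 - w * cnj \<zeta>))"
      if "norm \<zeta> = 1" for \<zeta>
      using geo[of "cnj \<zeta>" "\<zeta> ^ n"] that by (simp add: power_mult_distrib mult_ac)
  qed (intro meas continuous_intros)
  moreover have "(\<lambda>k. w ^ k * (if n + k * 0 = 0 + k * 1 then 1 else 0)) = (\<lambda>k. if k = n then w ^ n else 0)"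
    by auto
  ultimately have "(\<lambda>k. if k = n then w ^ n else 0) sums (LINT \<zeta>|circle_measure. \<zeta> ^ n / (1 - w * cnj \<zeta>))"
    by simp
  then show ?A by (rule sums_unique2[OF sums_single[of n "\<lambda>_. w ^ n"], symmetric])
  have "(\<lambda>k. w ^ k * (if Suc n + k * 1 = 0 + k * 0 then 1 else 0)) sums
      (LINT \<zeta>|circle_measure. \<zeta> ^ Suc n / (1 - w * \<zeta>))"
  proof (rule *)
    show "(\<lambda>k. w ^ k * (\<zeta> ^ (Suc n + k * 1) * cnj \<zeta> ^ (0 + k * 0))) sums (\<zeta> ^ Suc n / (1 - w * \<zeta>))"
      if "norm \<zeta> = 1" for \<zeta>
      using geo[of "\<zeta>" "\<zeta> ^ Suc n"] that by (simp add: power_mult_distrib power_add mult_ac)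
  qed (intro meas continuous_intros)
  then show ?B by (simp add: sums_iff)
qed

text \<open>
  The Poisson kernel splits into an antianalytic and an analytic geometric series in \<open>\<zeta>\<close>, to which
  the preceding lemma applies.
\<close>

lemma poisson_kernel_decomposition:
  assumes "norm z < 1" "norm \<zeta> = 1"
  shows "complex_of_real (poisson_kernel z \<zeta>) = 1 / (1 - z * cnj \<zeta>) + cnj z * \<zeta> / (1 - cnj z * \<zeta>)"
proof -
  define a where "a = z * cnj \<zeta>"
  have norm_a: "norm a = norm z" using assms by (simp add: a_def norm_mult)
  have norm_1a: "norm (1 - a) = norm (\<zeta> - z)"
  proof -
    have "\<zeta> * (1 - a) = \<zeta> - z"
      using complex_norm_square[of \<zeta>] assms by (simp add: a_def algebra_simps)
    then have "norm \<zeta> * norm (1 - a) = norm (\<zeta> - z)" by (metis norm_mult)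
    then show ?thesis using assms by simp
  qed
  have ne: "1 - a \<noteq> 0" "1 - cnj a \<noteq> 0"
    using norm_a assms(1) by (metis complex_mod_cnj eq_iff_diff_eq_0 norm_one order_less_irrefl)+
  have "1 / (1 - a) + cnj a / (1 - cnj a) = (1 - a * cnj a) / ((1 - a) * (1 - cnj a))"
    using ne by (simp add: field_simps)
  also have "\<dots> = complex_of_real ((1 - (norm a)\<^sup>2) / (norm (1 - a))\<^sup>2)"
    by (simp only: of_real_divide of_real_diff complex_norm_square complex_cnj_diff of_real_1 complex_cnj_one)
  finally have "1 / (1 - a) + cnj a / (1 - cnj a) = complex_of_real ((1 - (norm a)\<^sup>2) / (norm (1 - a))\<^sup>2)" .
  then show ?thesis
    unfolding poisson_kernel_def norm_a norm_1a by (simp add: a_def)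
qed

lemma poisson_kernel_nonneg: "norm z \<le> 1 \<Longrightarrow> 0 \<le> poisson_kernel z \<zeta>"
  unfolding poisson_kernel_def by (intro divide_nonneg_nonneg) (auto simp: power_le_one)

lemma poisson_kernel_measurable [measurable]:
  "(\<lambda>(z, \<zeta>). poisson_kernel z \<zeta>) \<in> borel_measurable (borel \<Otimes>\<^sub>M borel)"
  unfolding poisson_kernel_def by measurable

lemma poisson_kernel_measurable2 [measurable]:
  "poisson_kernel z \<in> borel_measurable borel" "(\<lambda>z. poisson_kernel z \<zeta>) \<in> borel_measurable borel"
  unfolding poisson_kernel_def by measurable

lemma poisson_kernel_bounds:
  assumes "norm z < 1" "norm \<zeta> = 1"
  shows "poisson_kernel z \<zeta> \<le> 2 / (1 - norm z)" "(1 - norm z) / 2 \<le> poisson_kernel z \<zeta>"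
proof -
  have lower: "1 - norm z \<le> norm (\<zeta> - z)" using norm_triangle_ineq2[of \<zeta> z] assms by simp
  have upper: "norm (\<zeta> - z) \<le> 1 + norm z" using norm_triangle_ineq4[of \<zeta> z] assms by simp
  have num: "1 - (norm z)\<^sup>2 = (1 - norm z) * (1 + norm z)" by (simp add: power2_eq_square algebra_simps)
  have "poisson_kernel z \<zeta> \<le> ((1 - norm z) * (1 + norm z)) / (1 - norm z)\<^sup>2"
    unfolding poisson_kernel_def num using assms lower
    by (intro divide_left_mono power_mono mult_pos_pos zero_less_power mult_nonneg_nonneg) auto
  also have "\<dots> = (1 + norm z) / (1 - norm z)" using assms by (simp add: power2_eq_square)
  also have "\<dots> \<le> 2 / (1 - norm z)" using assms by (intro divide_right_mono) auto
  finally show "poisson_kernel z \<zeta> \<le> 2 / (1 - norm z)" .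
  have "(1 - norm z) / 2 \<le> (1 - norm z) / (1 + norm z)" using assms by (intro divide_left_mono) (auto simp: add_pos_nonneg)
  also have "\<dots> = ((1 - norm z) * (1 + norm z)) / (1 + norm z)\<^sup>2" using assms
    by (simp add: power2_eq_square add_nonneg_eq_0_iff)
  also have "\<dots> \<le> poisson_kernel z \<zeta>"
    unfolding poisson_kernel_def num using assms lower upper
    by (intro divide_left_mono power_mono mult_pos_pos zero_less_power mult_nonneg_nonneg) auto
  finally show "(1 - norm z) / 2 \<le> poisson_kernel z \<zeta>" .
qed

lemma poisson_formula_power:
  assumes z: "norm z < 1"
  shows "(LINT \<zeta>|circle_measure. poisson_kernel z \<zeta> * Re (c * \<zeta> ^ n)) = Re (c * z ^ n)"
proof -
  let ?f = "\<lambda>\<zeta>. \<zeta> ^ n / (1 - z * cnj \<zeta>)" and ?g = "\<lambda>\<zeta>. \<zeta> ^ Suc n / (1 - cnj z * \<zeta>)"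
  have meas: "?f \<in> borel_measurable borel" "?g \<in> borel_measurable borel"
    by measurable
  have lower: "1 - norm z \<le> norm (1 - w)" if "norm w = norm z" for w :: complex
    using norm_triangle_ineq2[of 1 w] that by simp
  have int: "integrable circle_measure ?f" "integrable circle_measure ?g"
  proof -
    have bounds: "norm (?f \<zeta>) \<le> 1 / (1 - norm z)" "norm (?g \<zeta>) \<le> 1 / (1 - norm z)" if "norm \<zeta> = 1" for \<zeta>
      using lower[of "z * cnj \<zeta>"] lower[of "cnj z * \<zeta>"] z that
      by (auto simp: norm_divide norm_power norm_mult intro!: divide_left_mono mult_pos_pos)
    show "integrable circle_measure ?f" "integrable circle_measure ?g"
      by (rule circle_integrable_bounded[OF meas(1) bounds(1)], assumption)
        (rule circle_integrable_bounded[OF meas(2) bounds(2)], assumption)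
  qed
  have "(LINT \<zeta>|circle_measure. poisson_kernel z \<zeta> * Re (c * \<zeta> ^ n)) =
      (LINT \<zeta>|circle_measure. Re (c * (?f \<zeta> + cnj z * ?g \<zeta>)))"
  proof (rule circle_integral_cong)
    show "(\<lambda>\<zeta>. poisson_kernel z \<zeta> * Re (c * \<zeta> ^ n)) \<in> borel_measurable borel"
      by measurable
    show "(\<lambda>\<zeta>. Re (c * (?f \<zeta> + cnj z * ?g \<zeta>))) \<in> borel_measurable borel"
      using meas by measurable
    fix \<zeta> :: complex assume "norm \<zeta> = 1"
    then have "c * (?f \<zeta> + cnj z * ?g \<zeta>) = complex_of_real (poisson_kernel z \<zeta>) * (c * \<zeta> ^ n)"
      unfolding poisson_kernel_decomposition[OF z \<open>norm \<zeta> = 1\<close>] by (simp add: algebra_simps)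
    moreover have "Re (complex_of_real p * w) = p * Re w" for p w by simp
    ultimately show "poisson_kernel z \<zeta> * Re (c * \<zeta> ^ n) = Re (c * (?f \<zeta> + cnj z * ?g \<zeta>))"
      by (simp only:)
  qed
  also have "\<dots> = Re (LINT \<zeta>|circle_measure. c * (?f \<zeta> + cnj z * ?g \<zeta>))"
    by (intro integral_Re Bochner_Integration.integrable_mult_right Bochner_Integration.integrable_add int)
  also have "(LINT \<zeta>|circle_measure. c * (?f \<zeta> + cnj z * ?g \<zeta>)) =
      c * ((LINT \<zeta>|circle_measure. ?f \<zeta>) + cnj z * (LINT \<zeta>|circle_measure. ?g \<zeta>))"
    unfolding integral_mult_right_zero
    by (subst Bochner_Integration.integral_add)
      (simp_all only: int Bochner_Integration.integrable_mult_right integral_mult_right_zero)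
  also have "\<dots> = c * z ^ n"
    using circle_geometric[of z n] circle_geometric[of "cnj z" n] z by simp
  finally show ?thesis .
qed

lemma poisson_integral_1:
  assumes "norm z < 1"
  shows "(LINT \<zeta>|circle_measure. poisson_kernel z \<zeta>) = 1"
  using poisson_formula_power[OF assms, of 1 0] by simp

section \<open>The Laplacian as a limit of circle averages\<close>

definition circle_avg :: "(complex \<Rightarrow> real) \<Rightarrow> complex \<Rightarrow> real \<Rightarrow> real"
  where "circle_avg v z h = (LINT \<zeta>|circle_measure. v (z + of_real h * \<zeta>))"

lemma circle_avg_measurable [measurable]:
  assumes [measurable]: "v \<in> borel_measurable borel"
  shows "(\<lambda>z. circle_avg v z h) \<in> borel_measurable borel"
  unfolding circle_avg_def by measurable

lemma circle_avg_bound: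
  assumes [measurable]: "v \<in> borel_measurable borel" and "\<And>z. \<bar>v z\<bar> \<le> B"
  shows "\<bar>circle_avg v z h\<bar> \<le> B"
proof -
  have "integrable circle_measure (\<lambda>\<zeta>. v (z + of_real h * \<zeta>))"
    by (rule circle_integrable_bounded[where B = B]) (use assms(2) in auto)
  then have "\<bar>circle_avg v z h\<bar> \<le> (LINT \<zeta>|circle_measure. B)"
    unfolding circle_avg_def using assms(2)
    by (intro order_trans[OF integral_abs_bound] integral_mono) auto
  then show ?thesis using circle.prob_space by simp
qed

lemma smooth_line_derivative:
  assumes "smooth f"
  shows "((\<lambda>t. f (z + of_real t * w)) has_real_derivative dir_deriv w f (z + of_real t * w)) (at t)"
proof -
  let ?D = "\<lambda>v. dir_deriv v f (z + of_real t * w)"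
  have D: "(f has_derivative ?D) (at (z + of_real t * w))"
    by (rule smooth_has_derivative[OF assms])
  have "((\<lambda>t. z + of_real t * w) has_derivative (\<lambda>s. of_real s * w)) (at t)"
    by (auto intro!: derivative_eq_intros)
  from has_derivative_compose[OF this D]
  have "((\<lambda>t. f (z + of_real t * w)) has_derivative (\<lambda>s. ?D (of_real s * w))) (at t)" .
  moreover have "?D (of_real s * w) = ?D w * s" for s
    using linear_scale[OF bounded_linear.linear[OF has_derivative_bounded_linear[OF D]], of s w]
    by (simp add: scaleR_conv_of_real mult.commute)
  ultimately show ?thesis by (simp add: has_field_derivative_def mult_commute_abs)
qed

lemma second_dir_deriv:
  assumes "smooth f"
  shows "dir_deriv w (dir_deriv w f) z =
    Re w * Re w * dir_deriv 1 (dir_deriv 1 f) z +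
    Re w * Im w * (dir_deriv 1 (dir_deriv \<i> f) z + dir_deriv \<i> (dir_deriv 1 f) z) +
    Im w * Im w * dir_deriv \<i> (dir_deriv \<i> f) z"
proof -
  note s = smooth_dir_deriv[OF assms]
  have "dir_deriv w (dir_deriv w f) z =
      dir_deriv w (\<lambda>z. Re w * dir_deriv 1 f z + Im w * dir_deriv \<i> f z) z"
    by (simp only: smooth_dir_deriv_linear[OF assms, of w])
  also have "\<dots> = Re w * dir_deriv w (dir_deriv 1 f) z + Im w * dir_deriv w (dir_deriv \<i> f) z"
    by (simp only: dir_deriv_add dir_deriv_cmult s smooth_cmult)
  also have "dir_deriv w (dir_deriv 1 f) z = Re w * dir_deriv 1 (dir_deriv 1 f) z + Im w * dir_deriv \<i> (dir_deriv 1 f) z"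
    by (subst smooth_dir_deriv_linear[OF s]) simp
  also have "dir_deriv w (dir_deriv \<i> f) z = Re w * dir_deriv 1 (dir_deriv \<i> f) z + Im w * dir_deriv \<i> (dir_deriv \<i> f) z"
    by (subst smooth_dir_deriv_linear[OF s]) simp
  finally show ?thesis by (simp add: algebra_simps)
qed

lemma taylor_second_order:
  assumes "smooth f" "0 < h"
  obtains \<tau> where "0 < \<tau>" "\<tau> < h"
    "f (z + of_real h * w) = f z + h * dir_deriv w f z + h\<^sup>2 / 2 * dir_deriv w (dir_deriv w f) (z + of_real \<tau> * w)"
proof -
  define g where "g = (\<lambda>(m::nat) t. (if m = 0 then f (z + of_real t * w) else
      if m = 1 then dir_deriv w f (z + of_real t * w) else dir_deriv w (dir_deriv w f) (z + of_real t * w)))"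
  have "\<exists>t. 0 < t \<and> t < h \<and> g 0 h = (\<Sum>m<2. g m 0 / fact m * h ^ m) + g 2 t / fact 2 * h ^ 2"
  proof (rule Maclaurin[OF assms(2)])
    show "\<forall>m t. m < 2 \<and> 0 \<le> t \<and> t \<le> h \<longrightarrow> (g m has_real_derivative g (Suc m) t) (at t)"
      using smooth_line_derivative[OF assms(1), of z w] smooth_line_derivative[OF smooth_dir_deriv[OF assms(1)], of w z w]
      by (auto simp: g_def less_2_cases_iff)
  qed auto
  then obtain t where t: "0 < t" "t < h"
    "g 0 h = (\<Sum>m<2. g m 0 / fact m * h ^ m) + g 2 t / fact 2 * h ^ 2" by blast
  then have "f (z + of_real h * w) = f z + h * dir_deriv w f z + h\<^sup>2 / 2 * dir_deriv w (dir_deriv w f) (z + of_real t * w)"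
    by (simp add: g_def numeral_2_eq_2 algebra_simps)
  with t show ?thesis using that by blast
qed

lemma lborel_integral_shift:
  fixes f :: "complex \<Rightarrow> real"
  assumes [measurable]: "f \<in> borel_measurable borel"
  shows "(LINT z|lborel. f (c + z)) = (LINT z|lborel. f z)"
proof -
  have "(LINT z|lborel. f z) = (LINT z|distr lborel borel ((+) c). f z)"
    by (simp add: lborel_distr_plus)
  then show ?thesis by (simp add: integral_distr)
qed

lemma integrable_compact_support:
  fixes f :: "complex \<Rightarrow> real"
  assumes "f \<in> borel_measurable borel" "compact K" "\<And>z. z \<notin> K \<Longrightarrow> f z = 0" "\<And>z. \<bar>f z\<bar> \<le> B"
  shows "integrable lborel f"
proof (rule Bochner_Integration.integrable_bound)
  have "emeasure lborel K < \<infinity>" using assms(2) by (rule emeasure_compact_finite)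
  then show "integrable lborel (\<lambda>z. B * indicator K z)"
    using borel_compact[OF assms(2)] by (intro integrable_mult_right integrable_real_indicator) auto
  show "AE z in lborel. norm (f z) \<le> norm (B * indicator K z)"
  proof (rule AE_I2)
    fix z
    have "\<bar>f z\<bar> \<le> \<bar>B\<bar>" using assms(4)[of z] by linarith
    then show "norm (f z) \<le> norm (B * indicator K z)"
      using assms(3)[of z] by (cases "z \<in> K") auto
  qed
qed (use assms(1) in simp)

text \<open>
  Fubini and translation invariance of Lebesgue measure move the averaging from \<open>v\<close> to the test
  function.
\<close>

lemma circle_avg_pairing:
  assumes v[measurable]: "v \<in> borel_measurable borel" and B: "\<And>z. \<bar>v z\<bar> \<le> B"
    and \<psi>: "test_function UNIV \<psi>"
  shows "(LINT z|lborel. \<psi> z * circle_avg v z h) =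
    (LINT \<zeta>|circle_measure. (LINT z|lborel. v z * \<psi> (z - of_real h * \<zeta>)))"
proof -
  from \<psi> obtain K where K: "compact K" "\<And>z. z \<notin> K \<Longrightarrow> \<psi> z = 0" by (rule test_functionE) blast
  have [measurable]: "\<psi> \<in> borel_measurable borel"
    using \<psi> by (intro smooth_borel_measurable test_function_smooth)
  obtain C where C: "0 < C" "\<And>z. \<bar>\<psi> z\<bar> \<le> C"
    using bounded_of_compact_support[OF smooth_continuous_on[OF test_function_smooth[OF \<psi>]] K] by blast
  have [measurable]: "K \<in> sets borel" by (rule borel_compact[OF K(1)])
  have finK: "emeasure lborel K < \<infinity>" using K(1) by (rule emeasure_compact_finite)
  interpret P: pair_sigma_finite lborel circle_measure
    by unfold_locales
  have int: "integrable (lborel \<Otimes>\<^sub>M circle_measure) (\<lambda>(z, \<zeta>). \<psi> z * v (z + of_real h * \<zeta>))"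
  proof (rule Bochner_Integration.integrable_bound)
    have "emeasure (lborel \<Otimes>\<^sub>M circle_measure) (K \<times> UNIV) < \<infinity>"
      using finK circle.emeasure_space_1 by (subst circle.emeasure_pair_measure_Times) auto
    then show "integrable (lborel \<Otimes>\<^sub>M circle_measure) (\<lambda>x. C * B * indicator (K \<times> UNIV) x)"
      by (intro integrable_mult_right integrable_real_indicator) auto
    show "AE x in lborel \<Otimes>\<^sub>M circle_measure.
        norm (case x of (z, \<zeta>) \<Rightarrow> \<psi> z * v (z + of_real h * \<zeta>)) \<le> norm (C * B * indicator (K \<times> UNIV) x)"
    proof (rule AE_I2, clarify)
      fix z \<zeta> :: complex
      have "\<bar>\<psi> z * v (z + of_real h * \<zeta>)\<bar> \<le> C * B"
        unfolding abs_mult using C B by (intro mult_mono) auto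
      moreover have "0 \<le> B" using B[of 0] by simp
      ultimately show "norm (\<psi> z * v (z + of_real h * \<zeta>)) \<le> norm (C * B * indicator (K \<times> UNIV) (z, \<zeta>))"
        using K(2)[of z] C(1) by (cases "z \<in> K") (auto simp: abs_mult)
    qed
  qed measurable
  have "(LINT z|lborel. \<psi> z * circle_avg v z h) =
      (LINT z|lborel. (LINT \<zeta>|circle_measure. \<psi> z * v (z + of_real h * \<zeta>)))"
    by (simp add: circle_avg_def)
  also have "\<dots> = (LINT \<zeta>|circle_measure. (LINT z|lborel. \<psi> z * v (z + of_real h * \<zeta>)))"
    using P.Fubini_integral[OF int] by simp
  also have "\<dots> = (LINT \<zeta>|circle_measure. (LINT z|lborel. v z * \<psi> (z - of_real h * \<zeta>)))"
  proof (rule Bochner_Integration.integral_cong[OF refl])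
    fix \<zeta> :: complex
    have "(LINT z|lborel. (\<lambda>z. v z * \<psi> (z - of_real h * \<zeta>)) (of_real h * \<zeta> + z)) =
        (LINT z|lborel. v z * \<psi> (z - of_real h * \<zeta>))"
      by (rule lborel_integral_shift) measurable
    then show "(LINT z|lborel. \<psi> z * v (z + of_real h * \<zeta>)) = (LINT z|lborel. v z * \<psi> (z - of_real h * \<zeta>))"
      by (simp add: ac_simps)
  qed
  finally show ?thesis .
qed

text \<open>
  This identity takes the place of Green's formula. After the averaging has been moved to \<open>\<psi>\<close>, the
  Taylor formula applies to \<open>\<psi>\<close>: over the circle the first-order terms and the mixed second-order
  terms average to 0, while the squares of the two coordinates average to 1/2. Since \<open>h\<^sup>2 / 2\<close> is the
  Taylor coefficient, the result is a quarter of the Laplacian. Both passages to the limit, in the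
  plane and on the circle, are dominated because \<open>\<psi>\<close> has compact support.
\<close>

lemma laplacian_limit:
  assumes v[measurable]: "v \<in> borel_measurable borel" and B: "\<And>z. \<bar>v z\<bar> \<le> B"
    and \<psi>: "test_function UNIV \<psi>"
    and h: "\<And>n. 0 < h n" "\<And>n. h n \<le> 1" "h \<longlonglongrightarrow> 0"
  shows "(\<lambda>n. (LINT z|lborel. \<psi> z * (circle_avg v z (h n) - v z)) / (h n)\<^sup>2)
    \<longlonglongrightarrow> (LINT z|lborel. v z * classical_laplacian \<psi> z) / 4"
proof -
  from \<psi> obtain K where K: "compact K" "\<And>z. z \<notin> K \<Longrightarrow> \<psi> z = 0" "\<And>z w. z \<notin> K \<Longrightarrow> dir_deriv w \<psi> z = 0"
    by (rule test_functionE) blast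
  note sm = test_function_smooth[OF \<psi>]
  obtain R where R: "0 < R" "K \<subseteq> cball 0 R"
    using compact_imp_bounded[OF K(1)] unfolding bounded_pos subset_iff mem_cball_0 by blast
  define K' :: "complex set" where "K' = cball 0 (R + 1)"
  have K': "compact K'" "K \<subseteq> K'" using R by (auto simp: K'_def)
  have [measurable]: "K' \<in> sets borel" by (simp add: K'_def)
  have finK': "emeasure lborel K' < \<infinity>" using K'(1) by (rule emeasure_compact_finite)
  define D where "D a = dir_deriv a \<psi>" for a
  define DD where "DD a b = dir_deriv a (dir_deriv b \<psi>)" for a b
  have smD: "smooth (D a)" "smooth (DD a b)" for a b
    unfolding D_def DD_def by (intro smooth_dir_deriv sm)+
  have [measurable]: "\<psi> \<in> borel_measurable borel" "D a \<in> borel_measurable borel" "DD a b \<in> borel_measurable borel" for a b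
    by (intro smooth_borel_measurable sm smD)+
  have D_lin: "D w z = Re w * D 1 z + Im w * D \<i> z" for w z
    unfolding D_def by (subst smooth_dir_deriv_linear[OF sm]) simp
  have DD_quad: "DD w w z = Re w * Re w * DD 1 1 z + Re w * Im w * (DD 1 \<i> z + DD \<i> 1 z) + Im w * Im w * DD \<i> \<i> z" for w z
    unfolding DD_def by (rule second_dir_deriv[OF sm])
  have D_out: "D w z = 0" if "z \<notin> K" for w z using that by (simp add: D_def K)
  have DD_out: "DD a b z = 0" if "z \<notin> K" for a b z
  proof -
    have "closure {z. dir_deriv b \<psi> z \<noteq> 0} \<subseteq> K"
      using K compact_imp_closed[OF K(1)] by (intro closure_minimal) auto
    then show ?thesis unfolding DD_def using that by (intro dir_deriv_outside) auto
  qed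
  have "\<exists>C>0. \<forall>z. \<bar>DD a b z\<bar> \<le> C" for a b
    using bounded_of_compact_support[OF smooth_continuous_on[OF smD(2)] K(1) DD_out, of a b] by metis
  then obtain CC where CC: "\<And>a b. 0 < CC a b" "\<And>a b z. \<bar>DD a b z\<bar> \<le> CC a b" by metis
  define C where "C = CC 1 1 + (CC 1 \<i> + CC \<i> 1) + CC \<i> \<i>"
  have C_bound: "\<bar>DD w w z\<bar> \<le> C" if "norm w = 1" for w z
  proof -
    have le: "\<bar>Re w\<bar> \<le> 1" "\<bar>Im w\<bar> \<le> 1" using abs_Re_le_cmod[of w] abs_Im_le_cmod[of w] that by auto
    have m: "\<bar>a * b * x\<bar> \<le> c" if "\<bar>a\<bar> \<le> 1" "\<bar>b\<bar> \<le> 1" "\<bar>x\<bar> \<le> c" for a b x c :: real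
    proof -
      have "\<bar>a\<bar> * \<bar>b\<bar> * \<bar>x\<bar> \<le> 1 * 1 * \<bar>x\<bar>" using that by (intro mult_mono) auto
      with that show ?thesis by (simp add: abs_mult)
    qed
    have "\<bar>DD 1 \<i> z + DD \<i> 1 z\<bar> \<le> CC 1 \<i> + CC \<i> 1" using CC(2)[of 1 \<i> z] CC(2)[of \<i> 1 z] by linarith
    from m[OF le(1) le(1) CC(2)[of 1 1 z]] m[OF le(1) le(2) this] m[OF le(2) le(2) CC(2)[of \<i> \<i> z]]
    show ?thesis unfolding DD_quad[of w] C_def by linarith
  qed
  have C_nonneg: "0 \<le> C" unfolding C_def using CC(1) by (simp add: add_nonneg_nonneg less_imp_le)
  have B_nonneg: "0 \<le> B" using B[of 0] by simp
  (* The second difference quotient in the direction -zeta, with the linear term removed. *)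
  define q where "q n \<zeta> z = (\<psi> (z - of_real (h n) * \<zeta>) - \<psi> z + h n * D \<zeta> z) / (h n)\<^sup>2" for n \<zeta> z
  have q_taylor: "\<exists>\<tau>. 0 < \<tau> \<and> \<tau> < h n \<and> q n \<zeta> z = DD \<zeta> \<zeta> (z - of_real \<tau> * \<zeta>) / 2" for n \<zeta> z
  proof -
    obtain \<tau> where \<tau>: "0 < \<tau>" "\<tau> < h n"
      "\<psi> (z + of_real (h n) * (-\<zeta>)) = \<psi> z + h n * dir_deriv (-\<zeta>) \<psi> z +
        (h n)\<^sup>2 / 2 * dir_deriv (-\<zeta>) (dir_deriv (-\<zeta>) \<psi>) (z + of_real \<tau> * (-\<zeta>))"
      by (rule taylor_second_order[OF sm h(1)[of n]])
    have "dir_deriv (-\<zeta>) \<psi> z = - D \<zeta> z" using D_lin[of "-\<zeta>" z] D_lin[of \<zeta> z] by (simp add: D_def)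
    moreover have "dir_deriv (-\<zeta>) (dir_deriv (-\<zeta>) \<psi>) y = DD \<zeta> \<zeta> y" for y
      using DD_quad[of "-\<zeta>" y] DD_quad[of \<zeta> y] by (simp add: DD_def)
    ultimately have "\<psi> (z - of_real (h n) * \<zeta>) - \<psi> z + h n * D \<zeta> z = (h n)\<^sup>2 / 2 * DD \<zeta> \<zeta> (z - of_real \<tau> * \<zeta>)"
      using \<tau>(3) by simp
    then have "q n \<zeta> z = DD \<zeta> \<zeta> (z - of_real \<tau> * \<zeta>) / 2"
      unfolding q_def using h(1)[of n] by simp
    with \<tau> show ?thesis by blast
  qed
  have q_bound: "\<bar>q n \<zeta> z\<bar> \<le> C / 2 * indicator K' z" if "norm \<zeta> = 1" for n \<zeta> z
  proof (cases "z \<in> K'")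
    case True
    obtain \<tau> where "q n \<zeta> z = DD \<zeta> \<zeta> (z - of_real \<tau> * \<zeta>) / 2" using q_taylor[of n \<zeta> z] by blast
    moreover have "\<bar>DD \<zeta> \<zeta> (z - of_real \<tau> * \<zeta>)\<bar> \<le> C" by (rule C_bound[OF that])
    ultimately have "\<bar>q n \<zeta> z\<bar> \<le> C / 2" by simp
    with True show ?thesis by simp
  next
    case False
    then have "z \<notin> K" using K' by auto
    moreover have "z - of_real (h n) * \<zeta> \<notin> K"
    proof
      assume "z - of_real (h n) * \<zeta> \<in> K"
      then have "norm (z - of_real (h n) * \<zeta>) \<le> R" using R by auto
      moreover have "norm z \<le> norm (z - of_real (h n) * \<zeta>) + norm (of_real (h n) * \<zeta>)"
        using norm_triangle_ineq[of "z - of_real (h n) * \<zeta>" "of_real (h n) * \<zeta>"] by simp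
      moreover have "norm (of_real (h n) * \<zeta>) \<le> 1" using that h(1,2)[of n] by (simp add: norm_mult)
      ultimately show False using False by (simp add: K'_def)
    qed
    ultimately show ?thesis using False by (simp add: q_def K D_out)
  qed
  have q_lim: "(\<lambda>n. q n \<zeta> z) \<longlonglongrightarrow> DD \<zeta> \<zeta> z / 2" for \<zeta> z
  proof -
    obtain \<tau> where \<tau>: "\<And>n. 0 < \<tau> n" "\<And>n. \<tau> n < h n" "\<And>n. q n \<zeta> z = DD \<zeta> \<zeta> (z - of_real (\<tau> n) * \<zeta>) / 2"
      using q_taylor[of _ \<zeta> z] by metis
    have "\<tau> \<longlonglongrightarrow> 0"
      by (rule tendsto_sandwich[OF _ _ tendsto_const h(3)]) (use \<tau> in \<open>auto intro!: always_eventually less_imp_le\<close>)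
    then have lim: "(\<lambda>n. z - of_real (\<tau> n) * \<zeta>) \<longlonglongrightarrow> z - of_real 0 * \<zeta>" by (intro tendsto_intros)
    have cont: "isCont (DD \<zeta> \<zeta>) (z - of_real 0 * \<zeta>)"
      using smooth_continuous_on[OF smD(2), of UNIV \<zeta> \<zeta>] by (simp add: continuous_on_eq_continuous_at)
    have "(\<lambda>n. DD \<zeta> \<zeta> (z - of_real (\<tau> n) * \<zeta>) / 2) \<longlonglongrightarrow> DD \<zeta> \<zeta> (z - of_real 0 * \<zeta>) / 2"
      by (rule tendsto_divide[OF isCont_tendsto_compose[OF cont lim] tendsto_const]) simp
    then show ?thesis unfolding \<tau>(3) by simp
  qed
  have q_meas [measurable]: "(\<lambda>(\<zeta>, z). q n \<zeta> z) \<in> borel_measurable (borel \<Otimes>\<^sub>M borel)" for n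
  proof -
    have "q n \<zeta> z = (\<psi> (z - of_real (h n) * \<zeta>) - \<psi> z + h n * (Re \<zeta> * D 1 z + Im \<zeta> * D \<i> z)) / (h n)\<^sup>2" for \<zeta> z
      unfolding q_def D_lin[of \<zeta>] ..
    then show ?thesis by (simp only:) measurable
  qed
  have q_meas2 [measurable]: "(\<lambda>z. q n \<zeta> z) \<in> borel_measurable borel" for n \<zeta>
    unfolding q_def by measurable
  have int_w: "integrable lborel (\<lambda>z. B * (C / 2 * indicator K' z))"
    using finK' by (intro integrable_mult_right integrable_real_indicator) auto
  define I where "I n \<zeta> = (LINT z|lborel. v z * q n \<zeta> z)" for n \<zeta>
  have vq_bound: "\<bar>v z * q n \<zeta> z\<bar> \<le> B * (C / 2 * indicator K' z)" if "norm \<zeta> = 1" for n \<zeta> z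
    unfolding abs_mult using B q_bound[OF that] B_nonneg by (intro mult_mono) auto
  have I_lim: "(\<lambda>n. I n \<zeta>) \<longlonglongrightarrow> (LINT z|lborel. v z * (DD \<zeta> \<zeta> z / 2))" if "norm \<zeta> = 1" for \<zeta>
    unfolding I_def
  proof (rule integral_dominated_convergence[OF _ _ int_w])
    show "AE z in lborel. (\<lambda>n. v z * q n \<zeta> z) \<longlonglongrightarrow> v z * (DD \<zeta> \<zeta> z / 2)"
      by (intro AE_I2 tendsto_intros q_lim)
    show "AE z in lborel. norm (v z * q n \<zeta> z) \<le> B * (C / 2 * indicator K' z)" for n
      using vq_bound[OF that] by (intro AE_I2) simp
  qed measurable
  define W where "W = (LINT z|lborel. B * (C / 2 * indicator K' z))"
  have I_bound: "norm (I n \<zeta>) \<le> W" if "norm \<zeta> = 1" for n \<zeta>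
  proof -
    have bound: "norm (v z * q n \<zeta> z) \<le> B * (C / 2 * indicator K' z)" for z
      using vq_bound[OF that, of z n] by simp
    have int: "integrable lborel (\<lambda>z. v z * q n \<zeta> z)"
    proof (rule Bochner_Integration.integrable_bound[OF int_w])
      show "AE z in lborel. norm (v z * q n \<zeta> z) \<le> norm (B * (C / 2 * indicator K' z))"
        by (intro AE_I2 order_trans[OF bound]) simp
    qed measurable
    have "norm (I n \<zeta>) \<le> (LINT z|lborel. norm (v z * q n \<zeta> z))"
      unfolding I_def by (rule integral_norm_bound)
    also have "\<dots> \<le> W"
      unfolding W_def by (intro integral_mono integrable_norm int int_w bound)
    finally show ?thesis .
  qed
  have I_meas [measurable]: "I n \<in> borel_measurable borel" for n
    unfolding I_def by measurable
  have int_vD: "integrable lborel (\<lambda>z. v z * D a z)" and int_vDD: "integrable lborel (\<lambda>z. v z * DD a b z)" for a b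
  proof -
    obtain CD where CD: "0 < CD" "\<And>z. \<bar>D a z\<bar> \<le> CD"
      using bounded_of_compact_support[OF smooth_continuous_on[OF smD(1)] K(1) D_out, of a] by metis
    show "integrable lborel (\<lambda>z. v z * D a z)"
    proof (rule integrable_compact_support[OF _ K(1)])
      show "\<bar>v z * D a z\<bar> \<le> B * CD" for z
        unfolding abs_mult using B CD B_nonneg by (intro mult_mono) auto
    qed (auto simp: D_out)
    show "integrable lborel (\<lambda>z. v z * DD a b z)"
    proof (rule integrable_compact_support[OF _ K(1)])
      show "\<bar>v z * DD a b z\<bar> \<le> B * CC a b" for z
        unfolding abs_mult using B CC B_nonneg by (intro mult_mono) auto
    qed (auto simp: DD_out)
  qed
  have J: "(LINT z|lborel. v z * (DD \<zeta> \<zeta> z / 2)) =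
      (Re \<zeta> * Re \<zeta> * (LINT z|lborel. v z * DD 1 1 z) +
       Re \<zeta> * Im \<zeta> * (LINT z|lborel. v z * DD 1 \<i> z + v z * DD \<i> 1 z) +
       Im \<zeta> * Im \<zeta> * (LINT z|lborel. v z * DD \<i> \<i> z)) / 2" for \<zeta>
  proof -
    have "v z * (DD \<zeta> \<zeta> z / 2) = (Re \<zeta> * Re \<zeta> * (v z * DD 1 1 z) +
       Re \<zeta> * Im \<zeta> * (v z * DD 1 \<i> z + v z * DD \<i> 1 z) + Im \<zeta> * Im \<zeta> * (v z * DD \<i> \<i> z)) / 2" for z
      unfolding DD_quad[of \<zeta>] by (simp add: algebra_simps)
    then show ?thesis using int_vDD by simp
  qed
  have int_mom: "integrable circle_measure (\<lambda>\<zeta>. Re \<zeta> * Re \<zeta>)" "integrable circle_measure (\<lambda>\<zeta>. Im \<zeta> * Im \<zeta>)"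
    "integrable circle_measure (\<lambda>\<zeta>. Re \<zeta> * Im \<zeta>)" "integrable circle_measure Re" "integrable circle_measure Im"
  proof -
    have le: "\<bar>Re \<zeta>\<bar> \<le> 1" "\<bar>Im \<zeta>\<bar> \<le> 1" if "norm \<zeta> = 1" for \<zeta>
      using abs_Re_le_cmod[of \<zeta>] abs_Im_le_cmod[of \<zeta>] that by auto
    have m: "norm (a * b) \<le> 1" if "\<bar>a\<bar> \<le> 1" "\<bar>b\<bar> \<le> 1" for a b :: real
      unfolding real_norm_def abs_mult by (rule mult_le_one[OF that(1) abs_ge_zero that(2)])
    show "integrable circle_measure (\<lambda>\<zeta>. Re \<zeta> * Re \<zeta>)"
      by (rule circle_integrable_bounded[where B = 1], measurable, rule m; rule le)
    show "integrable circle_measure (\<lambda>\<zeta>. Im \<zeta> * Im \<zeta>)"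
      by (rule circle_integrable_bounded[where B = 1], measurable, rule m; rule le)
    show "integrable circle_measure (\<lambda>\<zeta>. Re \<zeta> * Im \<zeta>)"
      by (rule circle_integrable_bounded[where B = 1], measurable, rule m; rule le)
    show "integrable circle_measure Re" "integrable circle_measure Im"
      by (rule circle_integrable_bounded[where B = 1]; simp add: le)+
  qed
  have lim: "(\<lambda>n. LINT \<zeta>|circle_measure. I n \<zeta>) \<longlonglongrightarrow>
      (LINT \<zeta>|circle_measure. (LINT z|lborel. v z * (DD \<zeta> \<zeta> z / 2)))"
  proof (rule integral_dominated_convergence[where w = "\<lambda>_. W"])
    show "AE \<zeta> in circle_measure. (\<lambda>n. I n \<zeta>) \<longlonglongrightarrow> (LINT z|lborel. v z * (DD \<zeta> \<zeta> z / 2))"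
      using AE_circle by (rule AE_mp) (intro AE_I2 impI I_lim)
    show "AE \<zeta> in circle_measure. norm (I n \<zeta>) \<le> W" for n
      using AE_circle by (rule AE_mp) (intro AE_I2 impI I_bound)
    show "(\<lambda>\<zeta>. LINT z|lborel. v z * (DD \<zeta> \<zeta> z / 2)) \<in> borel_measurable circle_measure"
      unfolding J by measurable
  qed auto
  have val: "(LINT \<zeta>|circle_measure. (LINT z|lborel. v z * (DD \<zeta> \<zeta> z / 2))) =
      (LINT z|lborel. v z * classical_laplacian \<psi> z) / 4"
  proof -
    have "(LINT z|lborel. v z * classical_laplacian \<psi> z) =
        (LINT z|lborel. v z * DD 1 1 z) + (LINT z|lborel. v z * DD \<i> \<i> z)"
      using int_vDD by (simp add: classical_laplacian_def DD_def distrib_left)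
    then show ?thesis
      unfolding J using int_mom by (simp add: circle_real_moments)
  qed
  have "(LINT \<zeta>|circle_measure. I n \<zeta>) = (LINT z|lborel. \<psi> z * (circle_avg v z (h n) - v z)) / (h n)\<^sup>2" for n
  proof -
    obtain C\<psi> where C\<psi>: "0 < C\<psi>" "\<And>z. \<bar>\<psi> z\<bar> \<le> C\<psi>"
      using bounded_of_compact_support[OF smooth_continuous_on[OF sm] K(1,2)] by metis
    have int1: "integrable lborel (\<lambda>z. v z * \<psi> z)"
    proof (rule integrable_compact_support[OF _ K(1)])
      show "\<bar>v z * \<psi> z\<bar> \<le> B * C\<psi>" for z
        unfolding abs_mult using B C\<psi> B_nonneg by (intro mult_mono) auto
    qed (auto simp: K)
    have int2: "integrable lborel (\<lambda>z. v z * \<psi> (z - of_real (h n) * \<zeta>))" for \<zeta>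
    proof (rule integrable_compact_support)
      show "compact ((\<lambda>z. z + of_real (h n) * \<zeta>) ` K)"
        by (intro compact_continuous_image K continuous_intros)
      show "v z * \<psi> (z - of_real (h n) * \<zeta>) = 0" if "z \<notin> (\<lambda>z. z + of_real (h n) * \<zeta>) ` K" for z
      proof -
        have "z - of_real (h n) * \<zeta> \<notin> K" using that by (auto simp: image_iff)
        then show ?thesis by (simp add: K)
      qed
      show "\<bar>v z * \<psi> (z - of_real (h n) * \<zeta>)\<bar> \<le> B * C\<psi>" for z
        unfolding abs_mult using B C\<psi> B_nonneg by (intro mult_mono) auto
    qed measurable
    have int3: "integrable lborel (\<lambda>z. \<psi> z * circle_avg v z (h n))"
    proof (rule integrable_compact_support[OF _ K(1)])
      show "\<bar>\<psi> z * circle_avg v z (h n)\<bar> \<le> C\<psi> * B" for z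
        unfolding abs_mult using circle_avg_bound[OF v B] C\<psi> by (intro mult_mono) auto
    qed (auto simp: K)
    have I_eq: "I n \<zeta> = ((LINT z|lborel. v z * \<psi> (z - of_real (h n) * \<zeta>)) - (LINT z|lborel. v z * \<psi> z) +
        h n * (Re \<zeta> * (LINT z|lborel. v z * D 1 z) + Im \<zeta> * (LINT z|lborel. v z * D \<i> z))) / (h n)\<^sup>2" for \<zeta>
    proof -
      have "v z * q n \<zeta> z = (v z * \<psi> (z - of_real (h n) * \<zeta>) - v z * \<psi> z +
          h n * (Re \<zeta> * (v z * D 1 z) + Im \<zeta> * (v z * D \<i> z))) / (h n)\<^sup>2" for z
        unfolding q_def D_lin[of \<zeta>] using h(1)[of n] by (simp add: field_simps)
      then show ?thesis unfolding I_def using int1 int2 int_vD by simp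
    qed
    have int4: "integrable circle_measure (\<lambda>\<zeta>. LINT z|lborel. v z * \<psi> (z - of_real (h n) * \<zeta>))"
    proof -
      have "(LINT z|lborel. v z * \<psi> (z - of_real (h n) * \<zeta>)) = (h n)\<^sup>2 * I n \<zeta> + (LINT z|lborel. v z * \<psi> z) -
          h n * (Re \<zeta> * (LINT z|lborel. v z * D 1 z) + Im \<zeta> * (LINT z|lborel. v z * D \<i> z))" for \<zeta>
        unfolding I_eq using h(1)[of n] by simp
      moreover have "integrable circle_measure (I n)"
        by (rule circle_integrable_bounded[OF I_meas I_bound])
      ultimately show ?thesis using int_mom by simp
    qed
    have "(LINT \<zeta>|circle_measure. I n \<zeta>) =
        ((LINT \<zeta>|circle_measure. (LINT z|lborel. v z * \<psi> (z - of_real (h n) * \<zeta>))) - (LINT z|lborel. v z * \<psi> z)) / (h n)\<^sup>2"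
      unfolding I_eq using int4 int_mom circle.prob_space by (simp add: circle_real_moments)
    also have "\<dots> = ((LINT z|lborel. \<psi> z * circle_avg v z (h n)) - (LINT z|lborel. \<psi> z * v z)) / (h n)\<^sup>2"
      by (simp only: circle_avg_pairing[OF v B \<psi>] mult.commute[of "\<psi> _" "v _"])
    also have "\<dots> = (LINT z|lborel. \<psi> z * (circle_avg v z (h n) - v z)) / (h n)\<^sup>2"
      using int1 int3 by (simp add: right_diff_distrib mult.commute)
    finally show ?thesis .
  qed
  then show ?thesis using lim unfolding val by (simp only:)
qed

text \<open>
  Constants equal their circle averages.
\<close>

lemma integral_classical_laplacian:
  assumes "test_function UNIV \<psi>"
  shows "(LINT z|lborel. classical_laplacian \<psi> z) = 0"
proof -
  have "(\<lambda>n. (LINT z|lborel. \<psi> z * (circle_avg (\<lambda>_. 1) z (inverse (Suc n)) - 1)) / (inverse (Suc n))\<^sup>2)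
    \<longlonglongrightarrow> (LINT z|lborel. 1 * classical_laplacian \<psi> z) / 4"
    by (rule laplacian_limit[where B = 1, OF _ _ assms _ _ LIMSEQ_inverse_real_of_nat]) (auto simp: inverse_le_1_iff)
  then show ?thesis
    using circle.prob_space by (simp add: circle_avg_def LIMSEQ_const_iff)
qed

text \<open>
  A sub-mean-value inequality on small circles becomes positivity of the distributional Laplacian.
  The gain \<open>\<kappa> h\<^sup>2\<close> quantifies it: \<open>\<kappa> |z|\<^sup>2\<close> gains exactly this amount and has Laplacian \<open>4 \<kappa>\<close>.
\<close>

lemma laplacian_lower_bound:
  assumes v[measurable]: "v \<in> borel_measurable borel" and B: "\<And>z. \<bar>v z\<bar> \<le> B"
    and \<psi>: "test_function UNIV \<psi>" "\<And>z. 0 \<le> \<psi> z"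
    and h0: "0 < h0"
    and sub: "\<And>z h. \<psi> z \<noteq> 0 \<Longrightarrow> 0 < h \<Longrightarrow> h < h0 \<Longrightarrow> v z + \<kappa> * h\<^sup>2 \<le> circle_avg v z h"
  shows "4 * \<kappa> * (LINT z|lborel. \<psi> z) \<le> (LINT z|lborel. v z * classical_laplacian \<psi> z)"
proof -
  define h where "h n = min 1 (h0 / 2) * inverse (real (Suc n))" for n
  have h: "0 < h n" "h n \<le> 1" "h n < h0" for n
  proof -
    have b: "0 < inverse (real (Suc n))" "inverse (real (Suc n)) \<le> 1" by (auto simp: inverse_le_1_iff)
    have a: "0 < min 1 (h0 / 2)" "min 1 (h0 / 2) \<le> 1" "min 1 (h0 / 2) < h0" using h0 by auto
    have "h n \<le> min 1 (h0 / 2)"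
      using mult_left_mono[OF b(2), of "min 1 (h0 / 2)"] a(1) by (simp add: h_def)
    then show "h n \<le> 1" "h n < h0" using a(2,3) by linarith+
    show "0 < h n" unfolding h_def using a(1) b(1) by (rule mult_pos_pos)
  qed
  have h_lim: "h \<longlonglongrightarrow> 0"
    unfolding h_def using tendsto_mult_right[OF LIMSEQ_inverse_real_of_nat, of "min 1 (h0 / 2)"]
    by (simp add: mult.commute)
  note sm = test_function_smooth[OF \<psi>(1)]
  have [measurable]: "\<psi> \<in> borel_measurable borel" by (rule smooth_borel_measurable[OF sm])
  from \<psi>(1) obtain K where K: "compact K" "\<And>z. z \<notin> K \<Longrightarrow> \<psi> z = 0" by (rule test_functionE) blast
  obtain C where C: "0 < C" "\<And>z. \<bar>\<psi> z\<bar> \<le> C"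
    using bounded_of_compact_support[OF smooth_continuous_on[OF sm] K] by metis
  have int_\<psi>: "integrable lborel \<psi>" by (rule integrable_compact_support[OF _ K C(2)]) measurable
  have "\<kappa> * (LINT z|lborel. \<psi> z) \<le> (LINT z|lborel. \<psi> z * (circle_avg v z (h n) - v z)) / (h n)\<^sup>2" for n
  proof -
    have "integrable lborel (\<lambda>z. \<psi> z * (circle_avg v z (h n) - v z))"
    proof (rule integrable_compact_support[OF _ K(1)])
      show "\<bar>\<psi> z * (circle_avg v z (h n) - v z)\<bar> \<le> C * (B + B)" for z
      proof -
        have "\<bar>circle_avg v z (h n) - v z\<bar> \<le> B + B"
          using circle_avg_bound[OF v B, of z "h n"] B[of z] by linarith
        then show ?thesis unfolding abs_mult using C by (intro mult_mono) auto
      qed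
    qed (auto simp: K)
    then have "(LINT z|lborel. \<kappa> * (h n)\<^sup>2 * \<psi> z) \<le> (LINT z|lborel. \<psi> z * (circle_avg v z (h n) - v z))"
    proof (rule integral_mono[rotated])
      show "\<kappa> * (h n)\<^sup>2 * \<psi> z \<le> \<psi> z * (circle_avg v z (h n) - v z)" for z
      proof (cases "\<psi> z = 0")
        case False
        from sub[OF this h(1,3)] have "\<kappa> * (h n)\<^sup>2 \<le> circle_avg v z (h n) - v z" by (simp add: algebra_simps)
        from mult_right_mono[OF this \<psi>(2)[of z]] show ?thesis by (simp add: mult_ac)
      qed simp
    qed (use int_\<psi> in auto)
    then show ?thesis using h(1)[of n] by (simp add: pos_le_divide_eq mult_ac)
  qed
  then have "\<kappa> * (LINT z|lborel. \<psi> z) \<le> (LINT z|lborel. v z * classical_laplacian \<psi> z) / 4"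
    by (intro LIMSEQ_le_const[OF laplacian_limit[OF v B \<psi>(1) h(1,2) h_lim]]) auto
  then show ?thesis by simp
qed

section \<open>A square-filling curve\<close>

text \<open>
  Schoenberg's form of a space-filling curve. The wave has period 2, vanishes on $[0, 1/3]$ and
  equals 1 on $[2/3, 1]$. If all ternary digits of \<open>t\<close> are 0 or 2, then \<open>3\<^sup>m t\<close> is an even integer
  plus a number in one of these two intervals, and the wave reads off half of the next digit.
\<close>

definition digit_wave :: "real \<Rightarrow> real"
  where "digit_wave s = max 0 (min 1 (1 / 2 - cos (pi * s)))"

text \<open>
  The binary number whose digits are the readings at the exponents congruent to \<open>b\<close> modulo 2: even
  exponents serve the first coordinate of the curve and odd exponents the second.
\<close>

definition digit_sum :: "nat \<Rightarrow> real \<Rightarrow> real"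
  where "digit_sum b t = (\<Sum>n. digit_wave (3 ^ (2 * n + b) * t) / 2 ^ Suc n)"

definition square_curve :: "real \<Rightarrow> complex"
  where "square_curve t = Complex (2 * digit_sum 0 t - 1) (2 * digit_sum 1 t - 1)"

definition square :: "complex set"
  where "square = cbox (Complex (-1) (-1)) (Complex 1 1)"

lemma in_square: "z \<in> square \<longleftrightarrow> \<bar>Re z\<bar> \<le> 1 \<and> \<bar>Im z\<bar> \<le> 1"
  by (auto simp: square_def in_cbox_complex_iff)

lemma digit_wave_bounds: "0 \<le> digit_wave s" "digit_wave s \<le> 1"
  by (auto simp: digit_wave_def)

lemma digit_wave_periodic: "digit_wave (2 * real N + s) = digit_wave s"
proof -
  have "cos (pi * (2 * real N + s)) = cos (2 * real N * pi + pi * s)" by (simp add: algebra_simps)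
  also have "\<dots> = cos (pi * s)" unfolding cos_add by simp
  finally show ?thesis by (simp add: digit_wave_def)
qed

lemma digit_wave_0:
  assumes "0 \<le> s" "s \<le> 1 / 3"
  shows "digit_wave s = 0"
proof -
  have "cos (pi / 3) \<le> cos (pi * s)"
    using assms pi_gt_zero by (intro cos_monotone_0_pi_le) auto
  then show ?thesis by (simp add: digit_wave_def cos_60)
qed

lemma digit_wave_1:
  assumes "2 / 3 \<le> s" "s \<le> 1"
  shows "digit_wave s = 1"
proof -
  have "cos (pi * s) \<le> cos (pi - pi / 3)"
    using assms pi_gt_zero by (intro cos_monotone_0_pi_le) (auto simp: field_simps)
  also have "\<dots> = - cos (pi / 3)" by (rule cos_pi_minus)
  finally show ?thesis by (simp add: digit_wave_def cos_60)
qed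

lemma half_powers: "(\<lambda>n. 1 / 2 ^ Suc n :: real) sums 1"
  using power_half_series by (simp add: power_divide)

lemma digit_sum_term: "norm (digit_wave s / 2 ^ Suc n) \<le> 1 / 2 ^ Suc n"
  using digit_wave_bounds[of s] by (simp add: divide_right_mono)

lemma digit_sum_summable: "summable (\<lambda>n. digit_wave (f n) / 2 ^ Suc n)"
  by (rule summable_comparison_test'[OF sums_summable[OF half_powers] digit_sum_term])

lemma digit_sum_bounds: "0 \<le> digit_sum b t" "digit_sum b t \<le> 1"
proof -
  show "0 \<le> digit_sum b t"
    unfolding digit_sum_def using digit_wave_bounds by (intro suminf_nonneg digit_sum_summable) simp
  have "digit_sum b t \<le> (\<Sum>n. 1 / 2 ^ Suc n)"
    unfolding digit_sum_def
    using digit_wave_bounds by (intro suminf_le digit_sum_summable sums_summable[OF half_powers] divide_right_mono) auto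
  also have "\<dots> = 1" using half_powers by (rule sums_unique[symmetric])
  finally show "digit_sum b t \<le> 1" .
qed

lemma digit_sum_continuous: "continuous_on UNIV (digit_sum b)"
proof -
  have "uniform_limit UNIV (\<lambda>n t. \<Sum>i<n. digit_wave (3 ^ (2 * i + b) * t) / 2 ^ Suc i) (digit_sum b) sequentially"
    unfolding digit_sum_def[abs_def]
    by (rule Weierstrass_m_test[OF digit_sum_term sums_summable[OF half_powers]])
  then show ?thesis
    by (rule uniform_limit_theorem[rotated])
      (auto simp: digit_wave_def intro!: always_eventually continuous_intros)
qed

lemma square_curve_continuous: "continuous_on UNIV square_curve"
  unfolding square_curve_def[abs_def] Complex_eq by (intro continuous_intros digit_sum_continuous)

lemma square_curve_in_square: "square_curve t \<in> square"
  using digit_sum_bounds[of 0 t] digit_sum_bounds[of 1 t] by (simp add: in_square square_curve_def abs_le_iff)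

text \<open>
  The remainders that arise when the binary digits of \<open>x\<close> are extracted one after the other.
\<close>

primrec doubling_orbit :: "real \<Rightarrow> nat \<Rightarrow> real"
  where "doubling_orbit x 0 = x"
  | "doubling_orbit x (Suc n) =
      2 * doubling_orbit x n - (if doubling_orbit x n \<ge> 1 / 2 then 1 else 0)"

lemma binary_expansion:
  fixes x :: real
  assumes x: "0 \<le> x" "x \<le> 1"
  shows "\<exists>a :: nat \<Rightarrow> real. (\<forall>n. a n = 0 \<or> a n = 1) \<and> (\<lambda>n. a n / 2 ^ Suc n) sums x"
proof -
  define a where "a n = (if doubling_orbit x n \<ge> 1 / 2 then 1 else 0 :: real)" for n
  have bounds: "0 \<le> doubling_orbit x n \<and> doubling_orbit x n \<le> 1" for n
    by (induction n) (use x in auto)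
  have partial: "(\<Sum>k<n. a k / 2 ^ Suc k) = x - doubling_orbit x n / 2 ^ n" for n
    by (induction n) (auto simp: a_def field_simps)
  have "(\<lambda>n. doubling_orbit x n / 2 ^ n) \<longlonglongrightarrow> 0"
  proof (rule tendsto_sandwich[OF _ _ tendsto_const])
    show "(\<lambda>n. (1 / 2 :: real) ^ n) \<longlonglongrightarrow> 0" by (rule LIMSEQ_power_zero) simp
    show "\<forall>\<^sub>F n in sequentially. doubling_orbit x n / 2 ^ n \<le> (1 / 2) ^ n"
      using bounds by (auto intro!: always_eventually simp: power_divide divide_right_mono)
  qed (use bounds in \<open>auto intro!: always_eventually\<close>)
  then have "(\<lambda>n. x - doubling_orbit x n / 2 ^ n) \<longlonglongrightarrow> x - 0" by (intro tendsto_intros)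
  then have "(\<lambda>n. a n / 2 ^ Suc n) sums x" unfolding sums_def partial by simp
  moreover have "\<forall>n. a n = 0 \<or> a n = 1" by (simp add: a_def)
  ultimately show ?thesis by blast
qed

text \<open>
  The \<open>m\<close>-th tail \<open>r m\<close> of the ternary expansion satisfies \<open>3 r m = 2 d m + r (m + 1)\<close>, so it lies in
  the lower or in the upper third of the unit interval according to the digit \<open>d m\<close>.
\<close>

lemma ternary_digits:
  assumes d: "\<And>n. d n = 0 \<or> d n = (1 :: nat)"
  obtains t where "0 \<le> t" "t \<le> 1" "\<And>m. digit_wave (3 ^ m * t) = real (d m)"
proof -
  define r where "r m = (\<Sum>j. 2 * real (d (m + j)) / 3 ^ Suc j)" for m
  have geo: "(\<lambda>j. 2 / 3 ^ Suc j :: real) sums 1"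
  proof -
    have "(\<lambda>j. (2 / 3) * (1 / 3 :: real) ^ j) sums ((2 / 3) * (1 / (1 - 1 / 3)))"
      by (intro sums_mult geometric_sums) simp
    then show ?thesis by (simp add: power_divide)
  qed
  have term_le: "2 * real (d k) / 3 ^ Suc j \<le> 2 / 3 ^ Suc j" for k j
    using d[of k] by auto
  have summable: "summable (\<lambda>j. 2 * real (d (m + j)) / 3 ^ Suc j)" for m
  proof (rule summable_comparison_test'[OF sums_summable[OF geo]])
    show "norm (2 * real (d (m + j)) / 3 ^ Suc j) \<le> 2 / 3 ^ Suc j" for j using term_le[of "m + j" j] by simp
  qed
  have r_bounds: "0 \<le> r m" "r m \<le> 1" for m
  proof -
    show "0 \<le> r m" unfolding r_def by (intro suminf_nonneg summable) simp
    have "r m \<le> (\<Sum>j. 2 / 3 ^ Suc j)"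
      unfolding r_def by (intro suminf_le summable sums_summable[OF geo] term_le)
    then show "r m \<le> 1" using sums_unique[OF geo] by simp
  qed
  have r_Suc: "3 * r m = 2 * real (d m) + r (Suc m)" for m
  proof -
    have "r m = (\<Sum>j. 2 * real (d (m + Suc j)) / 3 ^ Suc (Suc j)) + 2 * real (d (m + 0)) / 3 ^ Suc 0"
      unfolding r_def by (rule suminf_split_head[OF summable, THEN eq_diff_eq[THEN iffD1], symmetric])
    also have "(\<Sum>j. 2 * real (d (m + Suc j)) / 3 ^ Suc (Suc j)) = (\<Sum>j. (2 * real (d (Suc m + j)) / 3 ^ Suc j) / 3)"
      by simp
    also have "\<dots> = r (Suc m) / 3" unfolding r_def by (rule suminf_divide[OF summable])
    finally show ?thesis by simp
  qed
  have expand: "\<exists>N. 3 ^ m * r 0 = 2 * real N + r m" for m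
  proof (induction m)
    case 0
    show ?case by (intro exI[of _ 0]) simp
  next
    case (Suc m)
    then obtain N where "3 ^ m * r 0 = 2 * real N + r m" by blast
    then have "3 ^ Suc m * r 0 = 2 * real (3 * N + d m) + r (Suc m)" using r_Suc[of m] by simp
    then show ?case by blast
  qed
  have "digit_wave (3 ^ m * r 0) = real (d m)" for m
  proof -
    obtain N where N: "3 ^ m * r 0 = 2 * real N + r m" using expand by blast
    have "digit_wave (r m) = real (d m)"
    proof (cases "d m = 0")
      case True
      then show ?thesis
        using r_Suc[of m] r_bounds[of m] r_bounds[of "Suc m"] by (simp add: digit_wave_0)
    next
      case False
      then have "d m = 1" using d[of m] by simp
      then show ?thesis
        using r_Suc[of m] r_bounds[of m] r_bounds[of "Suc m"] by (simp add: digit_wave_1)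
    qed
    then show ?thesis unfolding N digit_wave_periodic .
  qed
  then show ?thesis by (rule that[OF r_bounds])
qed

lemma square_curve_surj:
  assumes "z \<in> square"
  obtains t where "0 \<le> t" "t \<le> 1" "square_curve t = z"
proof -
  have range: "0 \<le> (Re z + 1) / 2" "(Re z + 1) / 2 \<le> 1" "0 \<le> (Im z + 1) / 2" "(Im z + 1) / 2 \<le> 1"
    using assms by (auto simp: in_square abs_le_iff)
  obtain a :: "nat \<Rightarrow> real" where a: "\<forall>n. a n = 0 \<or> a n = 1" "(\<lambda>n. a n / 2 ^ Suc n) sums ((Re z + 1) / 2)"
    using binary_expansion[OF range(1,2)] by blast
  obtain b :: "nat \<Rightarrow> real" where b: "\<forall>n. b n = 0 \<or> b n = 1" "(\<lambda>n. b n / 2 ^ Suc n) sums ((Im z + 1) / 2)"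
    using binary_expansion[OF range(3,4)] by blast
  define d where "d k = (if even k then (if a (k div 2) = 0 then 0 else 1) else (if b (k div 2) = 0 then 0 else 1) :: nat)" for k
  obtain t where t01: "0 \<le> t" "t \<le> 1" and t: "\<And>m. digit_wave (3 ^ m * t) = real (d m)"
    by (rule ternary_digits[of d]) (auto simp: d_def)
  have "real (d (2 * n + 0)) = a n" "real (d (2 * n + 1)) = b n" for n
    using a(1)[rule_format, of n] b(1)[rule_format, of n] by (auto simp: d_def)
  then have "digit_sum 0 t = (Re z + 1) / 2" "digit_sum 1 t = (Im z + 1) / 2"
    unfolding digit_sum_def t using sums_unique[OF a(2)] sums_unique[OF b(2)] by (simp_all only:)
  then have "square_curve t = z" by (simp add: square_curve_def complex_eq_iff)
  with t01 show ?thesis by (rule that)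
qed

section \<open>Positive functionals on smooth functions\<close>

text \<open>
  Differences of translates of the smooth step: nonnegative because the step increases, and a
  partition of unity because their sum telescopes. The shift by \<open>n + 1\<close> lets natural numbers index
  the translates that meet $[-1, 1]$.
\<close>

definition grid_bump1 :: "nat \<Rightarrow> nat \<Rightarrow> real \<Rightarrow> real"
  where "grid_bump1 n j x = smooth_step (real n * x + (real (n + 1) - real j))
    - smooth_step (real n * x + (real (n + 1) - real (Suc j)))"

definition grid_bump :: "nat \<Rightarrow> nat \<times> nat \<Rightarrow> complex \<Rightarrow> real"
  where "grid_bump n i z = grid_bump1 n (fst i) (Re z) * grid_bump1 n (snd i) (Im z)"

definition grid :: "nat \<Rightarrow> (nat \<times> nat) set"
  where "grid n = {..<2 * (n + 1)} \<times> {..<2 * (n + 1)}"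

lemma finite_grid: "finite (grid n)" by (simp add: grid_def)

lemma grid_bump1_nonneg: "0 \<le> grid_bump1 n j x"
  unfolding grid_bump1_def by (simp add: smooth_step_mono)

lemma grid_bump_nonneg: "0 \<le> grid_bump n i z"
  unfolding grid_bump_def by (intro mult_nonneg_nonneg grid_bump1_nonneg)

lemma grid_bump1_sum:
  assumes "\<bar>x\<bar> \<le> 1"
  shows "(\<Sum>j<2 * (n + 1). grid_bump1 n j x) = 1"
proof -
  have le: "\<bar>real n * x\<bar> \<le> real n" using assms by (simp add: abs_mult mult_left_le)
  have "(\<Sum>j<2 * (n + 1). grid_bump1 n j x) = smooth_step (real n * x + (real (n + 1) - real 0))
      - smooth_step (real n * x + (real (n + 1) - real (2 * (n + 1))))"
    unfolding grid_bump1_def by (rule sum_lessThan_telescope')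
  also have "smooth_step (real n * x + (real (n + 1) - real 0)) = 1"
    using le by (intro smooth_step_eq_1) (simp add: abs_le_iff)
  also have "smooth_step (real n * x + (real (n + 1) - real (2 * (n + 1)))) = 0"
    using le by (intro smooth_step_eq_0) (simp add: abs_le_iff)
  finally show ?thesis by simp
qed

lemma grid_bump_sum:
  assumes "z \<in> square"
  shows "(\<Sum>i\<in>grid n. grid_bump n i z) = 1"
proof -
  have "(\<Sum>i\<in>grid n. grid_bump n i z) =
      (\<Sum>j<2 * (n + 1). grid_bump1 n j (Re z)) * (\<Sum>k<2 * (n + 1). grid_bump1 n k (Im z))"
    unfolding grid_def grid_bump_def sum_product sum.cartesian_product by (simp add: case_prod_beta)
  moreover have "\<bar>Re z\<bar> \<le> 1" "\<bar>Im z\<bar> \<le> 1" using assms by (simp_all add: in_square)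
  ultimately show ?thesis by (simp only: grid_bump1_sum mult_1)
qed

lemma grid_bump1_support:
  assumes "grid_bump1 n j x \<noteq> 0"
  shows "0 < real n * x + (real (n + 1) - real j)" "real n * x + (real (n + 1) - real j) < 2"
proof -
  show "0 < real n * x + (real (n + 1) - real j)"
  proof (rule ccontr)
    assume "\<not> ?thesis"
    then show False using assms by (simp add: grid_bump1_def smooth_step_eq_0)
  qed
  show "real n * x + (real (n + 1) - real j) < 2"
  proof (rule ccontr)
    assume "\<not> ?thesis"
    then show False using assms by (simp add: grid_bump1_def smooth_step_eq_1)
  qed
qed

lemma grid_bump_support:
  assumes "0 < n" "grid_bump n i z \<noteq> 0" "grid_bump n i w \<noteq> 0"
  shows "dist z w \<le> 4 / real n"
proof -
  have *: "\<bar>x - y\<bar> \<le> 2 / real n" if "grid_bump1 n j x \<noteq> 0" "grid_bump1 n j y \<noteq> 0" for j x y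
  proof -
    have "\<bar>real n * (x - y)\<bar> \<le> 2"
      using grid_bump1_support[OF that(1)] grid_bump1_support[OF that(2)] by (simp add: algebra_simps abs_le_iff)
    then have "\<bar>x - y\<bar> * real n \<le> 2" by (simp add: abs_mult mult.commute)
    then show ?thesis using assms(1) by (simp add: pos_le_divide_eq)
  qed
  have "dist z w \<le> \<bar>Re (z - w)\<bar> + \<bar>Im (z - w)\<bar>" unfolding dist_norm by (rule cmod_le)
  also have "\<dots> \<le> 2 / real n + 2 / real n"
    using assms(2,3) unfolding grid_bump_def minus_complex.sel by (intro add_mono *) auto
  finally show ?thesis by simp
qed

lemma smooth_grid_bump: "smooth (grid_bump n i)"
  unfolding grid_bump_def[abs_def] grid_bump1_def
  by (intro smooth_mult smooth_diff smooth_step_comp smooth_add smooth_cmult smooth_Re smooth_Im smooth_const)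

text \<open>
  A Riesz representation theorem by weak compactness on the line. A fine partition of unity replaces
  \<open>L\<close> by a discrete measure, with the weight \<open>L (grid_bump n i)\<close> at a point near the support of
  the bump; positivity bounds the error by the oscillation of the function at the scale of the
  grid. Lifting the points along the square-filling curve gives measures on the unit interval,
  where Helly's selection theorem provides a limit, and the image of the limit under the curve
  represents \<open>L\<close>.
\<close>

lemma riesz_representation_square:
  fixes L :: "(complex \<Rightarrow> real) \<Rightarrow> real"
  assumes add: "\<And>f g. smooth f \<Longrightarrow> smooth g \<Longrightarrow> L (\<lambda>z. f z + g z) = L f + L g"
    and scale: "\<And>c f. smooth f \<Longrightarrow> L (\<lambda>z. c * f z) = c * L f"
    and pos: "\<And>f. smooth f \<Longrightarrow> (\<And>z. z \<in> square \<Longrightarrow> 0 \<le> f z) \<Longrightarrow> 0 \<le> L f"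
  obtains \<mu> where "sets \<mu> = sets borel" "finite_measure \<mu>" "\<And>f. smooth f \<Longrightarrow> (LINT z|\<mu>. f z) = L f"
    "emeasure \<mu> (- square) = 0"
proof -
  have diff: "L (\<lambda>z. g z - f z) = L g - L f" if "smooth f" "smooth g" for f g
    using add[OF that(2) smooth_cmult[OF that(1), of "-1"]] scale[OF that(1), of "-1"] by simp
  have mono: "L f \<le> L g" if "smooth f" "smooth g" "\<And>z. z \<in> square \<Longrightarrow> f z \<le> g z" for f g
    using pos[OF smooth_diff[OF that(2,1)]] diff[OF that(1,2)] that(3) by simp
  have zero: "L (\<lambda>z. 0) = 0" using scale[OF smooth_const, of 0 0] by simp
  have sum: "L (\<lambda>z. \<Sum>i\<in>I. f i z) = (\<Sum>i\<in>I. L (f i))" if "finite I" "\<And>i. smooth (f i)"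
    for I and f :: "nat \<times> nat \<Rightarrow> complex \<Rightarrow> real"
    using that(1) by (induction rule: finite_induct) (simp_all add: zero add that(2) smooth_sum)
  have compact: "compact square" by (simp add: square_def compact_cbox)
  have bounded: "\<exists>B. \<forall>z\<in>square. \<bar>f z\<bar> \<le> B" if "smooth f" for f
    using compact_imp_bounded[OF compact_continuous_image[OF smooth_continuous_on[OF that] compact]]
    by (auto simp: bounded_iff)
  define c where "c = L (\<lambda>z. 1)"
  have c_nonneg: "0 \<le> c" unfolding c_def by (rule pos[OF smooth_const]) simp
  have bound: "\<bar>L f\<bar> \<le> B * c" if "smooth f" "\<And>z. z \<in> square \<Longrightarrow> \<bar>f z\<bar> \<le> B" for f B
  proof -
    have B: "L (\<lambda>z. b * 1) = b * c" for b unfolding c_def by (rule scale[OF smooth_const])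
    have "L f \<le> L (\<lambda>z. B * 1)" "L (\<lambda>z. (-B) * 1) \<le> L f"
      using that by (auto intro!: mono smooth_const simp: abs_le_iff) (smt (verit) that(2))+
    then show ?thesis unfolding B by (simp add: abs_le_iff)
  qed
  show thesis
  proof (cases "c = 0")
    case True
    (* If L 1 = 0, positivity forces L = 0, and the zero measure represents it. *)
    show thesis
    proof (rule that[of "density lborel (\<lambda>_. ennreal 0)"])
      show "finite_measure (density lborel (\<lambda>_. ennreal 0))"
        by (rule finite_measureI) (simp add: emeasure_density)
      fix f assume f: "smooth f"
      obtain B where "\<And>z. z \<in> square \<Longrightarrow> \<bar>f z\<bar> \<le> B" using bounded[OF f] by blast
      from bound[OF f this] have "L f = 0" using True by simp
      then show "(LINT z|density lborel (\<lambda>_. ennreal 0). f z) = L f"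
        using smooth_borel_measurable[OF f] by (subst integral_density) auto
    next
      show "emeasure (density lborel (\<lambda>_. ennreal 0)) (- square) = 0"
        by (subst emeasure_density) (auto simp: square_def)
    qed simp
  next
    case False
    with c_nonneg have c_pos: "0 < c" by simp
    have "\<exists>t. (0 \<le> t \<and> t \<le> 1) \<and> (\<forall>z\<in>square. grid_bump (Suc n) i z \<noteq> 0 \<longrightarrow> dist z (square_curve t) \<le> 4 / real (Suc n))" for n i
    proof (cases "\<exists>w\<in>square. grid_bump (Suc n) i w \<noteq> 0")
      case True
      then obtain w where w: "w \<in> square" "grid_bump (Suc n) i w \<noteq> 0" by blast
      obtain t where "0 \<le> t" "t \<le> 1" "square_curve t = w" by (rule square_curve_surj[OF w(1)])
      with w(2) show ?thesis using grid_bump_support[of "Suc n" i _ w] by (intro exI[of _ t]) auto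
    qed (auto intro!: exI[of _ 0])
    then obtain \<tau> where \<tau>01: "\<And>n i. 0 \<le> \<tau> n i \<and> \<tau> n i \<le> 1" and \<tau>: "\<And>n i z. z \<in> square \<Longrightarrow> grid_bump (Suc n) i z \<noteq> 0 \<Longrightarrow>
        dist z (square_curve (\<tau> n i)) \<le> 4 / real (Suc n)" by metis
    (* Normalized weights: Helly selection concerns probability distributions. *)
    define w where "w n i = L (grid_bump (Suc n) i) / c" for n i
    have w_nonneg: "0 \<le> w n i" for n i
      unfolding w_def using c_pos by (intro divide_nonneg_nonneg pos smooth_grid_bump grid_bump_nonneg) auto
    have eq_on: "L f = L g" if "smooth f" "smooth g" "\<And>z. z \<in> square \<Longrightarrow> f z = g z" for f g
      using mono[OF that(1,2)] mono[OF that(2,1)] that(3) by (simp add: antisym)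
    have w_sum: "(\<Sum>i\<in>grid (Suc n). w n i) = 1" for n
    proof -
      have "(\<Sum>i\<in>grid (Suc n). L (grid_bump (Suc n) i)) = L (\<lambda>z. \<Sum>i\<in>grid (Suc n). grid_bump (Suc n) i z)"
        by (rule sum[OF finite_grid smooth_grid_bump, symmetric])
      also have "\<dots> = c" unfolding c_def
        by (rule eq_on) (simp_all add: grid_bump_sum smooth_sum smooth_grid_bump smooth_const)
      finally show ?thesis using c_pos by (simp add: w_def flip: sum_divide_distrib)
    qed
    define M where "M n = distr (point_measure (grid (Suc n)) (w n)) borel (\<tau> n)" for n
    have M_prob: "prob_space (point_measure (grid (Suc n)) (w n))" for n
    proof -
      have "prob_space (point_measure (grid (Suc n)) (\<lambda>i. ennreal (w n i)))"
      proof (rule prob_space_point_measure[OF finite_grid])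
        show "(\<Sum>s\<in>grid (Suc n). ennreal (w n s)) = 1"
          using w_sum[of n] w_nonneg by (simp add: sum_ennreal)
      qed simp
      then show ?thesis .
    qed
    have M_dist: "real_distribution (M n)" for n
      unfolding M_def real_distribution_def real_distribution_axioms_def
      by (auto intro!: prob_space.prob_space_distr[OF M_prob])
    have M_int: "(LINT t|M n. F t) = (\<Sum>i\<in>grid (Suc n). w n i * F (\<tau> n i))"
      if [measurable]: "F \<in> borel_measurable borel" for F :: "real \<Rightarrow> real" and n
      unfolding M_def
      by (subst integral_distr) (simp_all add: lebesgue_integral_point_measure_finite finite_grid w_nonneg)
    have "measure (M n) {-1<..1} = 1" for n
    proof -
      have "\<tau> n i \<in> {-1<..1}" for i using \<tau>01[of n i] by simp
      then have "\<tau> n -` {-1<..1} = UNIV" by blast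
      then show ?thesis
        using prob_space.prob_space[OF M_prob, of n] unfolding M_def
        by (subst measure_distr) simp_all
    qed
    then have "tight M"
      unfolding tight_def using M_dist by (intro conjI allI impI exI[of _ "-1 :: real"] exI[of _ "1 :: real"]) simp_all
    then obtain r M' where r: "strict_mono (r :: nat \<Rightarrow> nat)" "real_distribution M'" "weak_conv_m (M \<circ> id \<circ> r) M'"
      using tight_imp_convergent_subsubsequence[of M id] strict_mono_id by blast
    interpret M': real_distribution M' by (rule r(2))
    have rep: "(LINT t|M'. f (square_curve t)) = L f / c" if f: "smooth f" for f
    proof -
      have contF: "continuous_on UNIV (\<lambda>t. f (square_curve t))"
        by (rule continuous_on_compose2[OF smooth_continuous_on[OF f, of UNIV] square_curve_continuous]) simp
      obtain B where B: "\<And>z. z \<in> square \<Longrightarrow> \<bar>f z\<bar> \<le> B" using bounded[OF f] by blast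
      have "(\<lambda>n. LINT t|(M \<circ> id \<circ> r) n. f (square_curve t)) \<longlonglongrightarrow> (LINT t|M'. f (square_curve t))"
      proof (rule weak_conv_imp_integral_bdd_continuous_conv[OF _ r(2,3)])
        show "isCont (\<lambda>t. f (square_curve t)) x" for x
          using contF by (simp add: continuous_on_eq_continuous_at)
        show "norm (f (square_curve t)) \<le> B" for t using B[OF square_curve_in_square] by simp
      qed (simp add: M_dist)
      moreover have "(\<lambda>n. LINT t|M n. f (square_curve t)) \<longlonglongrightarrow> L f / c"
      proof (rule LIMSEQ_I)
        fix e :: real assume e: "0 < e"
        have "uniformly_continuous_on square f"
          by (rule compact_uniformly_continuous[OF smooth_continuous_on[OF f] compact])
        then obtain \<delta> where \<delta>: "0 < \<delta>" "\<And>z w. z \<in> square \<Longrightarrow> w \<in> square \<Longrightarrow> dist z w < \<delta> \<Longrightarrow> dist (f z) (f w) < e / 2"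
          unfolding uniformly_continuous_on_def using e by (metis half_gt_zero dist_commute)
        obtain n0 :: nat where n0: "4 / \<delta> < real n0" using reals_Archimedean2 by blast
        have "norm ((LINT t|M n. f (square_curve t)) - L f / c) < e" if n: "n0 \<le> n" for n
        proof -
          have small: "4 / real (Suc n) < \<delta>"
          proof -
            have "4 / \<delta> < real (Suc n)" using n0 n by simp
            then show ?thesis using \<delta>(1) by (simp add: field_simps)
          qed
          let ?b = "grid_bump (Suc n)"
          have "L f = L (\<lambda>z. \<Sum>i\<in>grid (Suc n). ?b i z * f z)"
            by (rule eq_on) (simp_all add: f smooth_sum smooth_mult smooth_grid_bump grid_bump_sum flip: sum_distrib_right)
          also have "\<dots> = (\<Sum>i\<in>grid (Suc n). L (\<lambda>z. ?b i z * f z))"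
            by (rule sum[OF finite_grid]) (intro smooth_mult smooth_grid_bump f)
          finally have Lf: "L f = (\<Sum>i\<in>grid (Suc n). L (\<lambda>z. ?b i z * f z))" .
          have sample: "\<bar>w n i * f (square_curve (\<tau> n i)) - L (\<lambda>z. ?b i z * f z) / c\<bar> \<le> e / 2 * w n i" for i
          proof -
            let ?y = "f (square_curve (\<tau> n i))"
            have near: "?b i z * (?y - e / 2) \<le> ?b i z * f z \<and> ?b i z * f z \<le> ?b i z * (?y + e / 2)" if "z \<in> square" for z
            proof (cases "?b i z = 0")
              case False
              from \<tau>[OF that this] small have "dist z (square_curve (\<tau> n i)) < \<delta>" by simp
              from \<delta>(2)[OF that square_curve_in_square this] have "\<bar>f z - ?y\<bar> < e / 2" by (simp add: dist_real_def)
              then have "?y - e / 2 \<le> f z" "f z \<le> ?y + e / 2" by linarith+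
              then show ?thesis using grid_bump_nonneg[of "Suc n" i z] by (simp add: mult_left_mono)
            qed simp
            have "L (\<lambda>z. (?y - e / 2) * ?b i z) \<le> L (\<lambda>z. ?b i z * f z)"
              "L (\<lambda>z. ?b i z * f z) \<le> L (\<lambda>z. (?y + e / 2) * ?b i z)"
              using near by (auto intro!: mono smooth_mult smooth_const smooth_grid_bump f simp: mult.commute)
            then have "(?y - e / 2) * L (?b i) / c \<le> L (\<lambda>z. ?b i z * f z) / c"
              "L (\<lambda>z. ?b i z * f z) / c \<le> (?y + e / 2) * L (?b i) / c"
              unfolding scale[OF smooth_grid_bump] using c_pos by (auto intro!: divide_right_mono)
            then show ?thesis unfolding w_def by (simp add: algebra_simps abs_le_iff add_divide_distrib diff_divide_distrib)
          qed
          have "(LINT t|M n. f (square_curve t)) - L f / c =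
              (\<Sum>i\<in>grid (Suc n). w n i * f (square_curve (\<tau> n i)) - L (\<lambda>z. ?b i z * f z) / c)"
            unfolding Lf sum_subtractf sum_divide_distrib
            by (subst M_int) (simp_all add: borel_measurable_continuous_onI[OF contF])
          then have "\<bar>(LINT t|M n. f (square_curve t)) - L f / c\<bar> \<le> (\<Sum>i\<in>grid (Suc n). e / 2 * w n i)"
            using sample by (auto intro!: order_trans[OF sum_abs] sum_mono)
          also have "\<dots> = e / 2" by (simp only: w_sum sum_distrib_left[symmetric] mult_1_right)
          finally show ?thesis using e by simp
        qed
        then show "\<exists>no. \<forall>n\<ge>no. norm ((LINT t|M n. f (square_curve t)) - L f / c) < e" by blast
      qed
      then have "(\<lambda>n. LINT t|(M \<circ> id \<circ> r) n. f (square_curve t)) \<longlonglongrightarrow> L f / c"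
        using LIMSEQ_subseq_LIMSEQ[OF _ r(1)] by (simp add: comp_def)
      ultimately show ?thesis by (rule LIMSEQ_unique)
    qed
    have [measurable]: "square_curve \<in> borel_measurable borel"
      by (rule borel_measurable_continuous_onI[OF square_curve_continuous])
    define \<mu> where "\<mu> = density (distr M' borel square_curve) (\<lambda>_. ennreal c)"
    show thesis
    proof (rule that[of \<mu>])
      show "sets \<mu> = sets borel" by (simp add: \<mu>_def)
      have em: "emeasure \<mu> A = ennreal c * emeasure M' (square_curve -` A)" if "A \<in> sets borel" for A
        unfolding \<mu>_def using that
        by (simp add: emeasure_density nn_integral_cmult emeasure_distr sets_eq_imp_space_eq[OF M'.events_eq_borel])
      show "finite_measure \<mu>"
        using M'.emeasure_space_1
        by (intro finite_measureI) (simp add: em \<mu>_def[THEN arg_cong[where f = space]] ennreal_mult_eq_top_iff sets_eq_imp_space_eq[OF M'.events_eq_borel])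
      have "square_curve -` (- square) = {}" using square_curve_in_square by auto
      then show "emeasure \<mu> (- square) = 0"
        by (subst em) (auto simp: square_def)
      fix f assume f: "smooth f"
      note [measurable] = smooth_borel_measurable[OF f]
      have "(LINT z|\<mu>. f z) = c * (LINT t|M'. f (square_curve t))"
        unfolding \<mu>_def using c_nonneg by (simp add: integral_density integral_distr)
      then show "(LINT z|\<mu>. f z) = L f" using rep[OF f] c_pos by simp
    qed
  qed
qed

section \<open>Sums of measures and uniqueness of the Laplacian\<close>

text \<open>
  The Laplacian of a truncation is assembled as a level measure plus a restriction of the Laplacian
  of \<open>u\<close>.
\<close>
definition plus_measure :: "'a measure \<Rightarrow> 'a measure \<Rightarrow> 'a measure"
  where "plus_measure M N = measure_of (space M) (sets M) (\<lambda>A. emeasure M A + emeasure N A)"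

lemma sets_plus_measure [simp]: "sets (plus_measure M N) = sets M"
  and space_plus_measure [simp]: "space (plus_measure M N) = space M"
  by (simp_all add: plus_measure_def)

lemma emeasure_plus_measure:
  assumes "sets M = sets N" "A \<in> sets M"
  shows "emeasure (plus_measure M N) A = emeasure M A + emeasure N A"
  unfolding plus_measure_def
proof (rule emeasure_measure_of_sigma)
  show "sigma_algebra (space M) (sets M)" ..
  show "positive (sets M) (\<lambda>A. emeasure M A + emeasure N A)" by (simp add: positive_def)
  show "countably_additive (sets M) (\<lambda>A. emeasure M A + emeasure N A)"
    using assms(1) by (auto simp: countably_additive_def suminf_add[symmetric] suminf_emeasure)
qed fact

lemma nn_integral_plus_measure:
  assumes sets: "sets M = sets N" and f: "f \<in> borel_measurable M"
  shows "(\<integral>\<^sup>+x. f x \<partial>plus_measure M N) = (\<integral>\<^sup>+x. f x \<partial>M) + (\<integral>\<^sup>+x. f x \<partial>N)"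
proof -
  have [measurable_cong]: "sets N = sets M" "sets (plus_measure M N) = sets M" using sets by simp_all
  note [simp] = sets_eq_imp_space_eq[OF sets]
  show ?thesis
    using f
  proof (induction rule: borel_measurable_induct)
    case (cong f g)
    then have "(\<integral>\<^sup>+x. g x \<partial>L) = (\<integral>\<^sup>+x. f x \<partial>L)" if "space L = space M" for L
      using that by (intro nn_integral_cong) auto
    with cong(4) show ?case by simp
  next
    case (set A)
    note A = this
    have "A \<in> sets N" "A \<in> sets (plus_measure M N)" using A by (simp_all only: sets_plus_measure sets)
    then show ?case
      using A by (simp only: nn_integral_indicator emeasure_plus_measure[OF sets A])
  next
    case (mult u c)
    then have [measurable]: "u \<in> borel_measurable M" by simp
    have "u \<in> borel_measurable N" "u \<in> borel_measurable (plus_measure M N)" by measurable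
    with mult show ?case by (simp add: nn_integral_cmult distrib_left)
  next
    case (add u v)
    then have [measurable]: "u \<in> borel_measurable M" "v \<in> borel_measurable M" by simp_all
    have "u \<in> borel_measurable N" "u \<in> borel_measurable (plus_measure M N)"
      "v \<in> borel_measurable N" "v \<in> borel_measurable (plus_measure M N)" by measurable
    with add show ?case by (simp add: nn_integral_add ac_simps)
  next
    case (seq U)
    then have [measurable]: "U i \<in> borel_measurable M" for i by simp
    have m: "U i \<in> borel_measurable N" "U i \<in> borel_measurable (plus_measure M N)" for i by measurable
    have eq: "(\<integral>\<^sup>+x. (SUP i. U i) x \<partial>L) = (SUP i. \<integral>\<^sup>+x. U i x \<partial>L)" if "\<And>i. U i \<in> borel_measurable L" for L
      unfolding SUP_apply using seq(3) that by (rule nn_integral_monotone_convergence_SUP)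
    have inc: "incseq (\<lambda>i. \<integral>\<^sup>+x. U i x \<partial>L)" for L
      using seq(3) by (auto simp: incseq_def le_fun_def intro!: nn_integral_mono)
    have "(SUP i. (\<integral>\<^sup>+x. U i x \<partial>M) + (\<integral>\<^sup>+x. U i x \<partial>N)) = (SUP i. \<integral>\<^sup>+x. U i x \<partial>M) + (SUP i. \<integral>\<^sup>+x. U i x \<partial>N)"
      by (intro ennreal_SUP_add inc)
    then show ?case
      by (simp only: eq[OF seq(1)] eq[OF m(1)] eq[OF m(2)] seq.IH)
  qed
qed

lemma integral_plus_measure:
  fixes f :: "'a \<Rightarrow> real"
  assumes sets: "sets M = sets N" and f: "integrable M f" "integrable N f"
  shows "(LINT x|plus_measure M N. f x) = (LINT x|M. f x) + (LINT x|N. f x)"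
proof -
  have [measurable]: "f \<in> borel_measurable M" using f(1) by simp
  have "f \<in> borel_measurable (plus_measure M N)"
    using \<open>f \<in> borel_measurable M\<close> by (simp add: measurable_def)
  have fin: "(\<integral>\<^sup>+x. ennreal (f x) \<partial>L) \<noteq> \<infinity>" "(\<integral>\<^sup>+x. ennreal (- f x) \<partial>L) \<noteq> \<infinity>" if "integrable L f" for L
    using that by (simp_all add: real_integrable_def)
  have int: "integrable (plus_measure M N) f"
    using fin[OF f(1)] fin[OF f(2)] \<open>f \<in> borel_measurable (plus_measure M N)\<close>
    by (simp add: real_integrable_def nn_integral_plus_measure[OF sets])
  show ?thesis
    using fin[OF f(1)] fin[OF f(2)]
    by (simp add: real_lebesgue_integral_def[OF int] real_lebesgue_integral_def[OF f(1)] real_lebesgue_integral_def[OF f(2)]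
        nn_integral_plus_measure[OF sets] enn2real_plus less_top)
qed

lemma laplacian_eqI:
  assumes "has_laplacian u \<nu>"
  shows "laplacian u = \<nu>"
  unfolding laplacian_def
proof (rule the_equality)
  show "has_laplacian u \<nu>" by fact
  fix \<nu>' assume "has_laplacian u \<nu>'"
  with assms show "\<nu>' = \<nu>"
    by (intro measure_eqI_test_functions[of _ _ 1]) (auto simp: has_laplacian_def)
qed

lemma null_set_positivity:
  assumes "integrable M f" "\<And>z. 0 \<le> f z" "(LINT z|M. f z) = (0 :: real)" "{z \<in> space M. 0 < f z} \<in> sets M"
  shows "emeasure M {z \<in> space M. 0 < f z} = 0"
proof -
  have "AE z in M. f z = 0"
    using integral_nonneg_eq_0_iff_AE[OF assms(1)] assms(2,3) by simp
  then have "AE z in M. \<not> 0 < f z" by (rule AE_mp) simp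
  then show ?thesis using AE_iff_measurable[OF assms(4), of "\<lambda>z. \<not> 0 < f z"] by simp
qed

lemma compact_subset_disc:
  fixes K :: "complex set"
  assumes "compact K" "K \<subseteq> ball 0 1"
  obtains \<rho> where "0 < \<rho>" "\<rho> < 1" "K \<subseteq> cball 0 \<rho>"
proof (cases "K = {}")
  case True
  then show ?thesis using that[of "1/2"] by simp
next
  case False
  obtain x where x: "x \<in> K" "\<And>z. z \<in> K \<Longrightarrow> norm z \<le> norm x"
    using continuous_attains_sup[OF assms(1) False, of norm] continuous_on_norm_id by blast
  have "norm z \<le> max (norm x) (1/2)" if "z \<in> K" for z using x(2)[OF that] by simp
  then have "K \<subseteq> cball 0 (max (norm x) (1/2))" unfolding subset_iff mem_cball_0 by blast
  moreover have "norm x < 1" using x(1) assms(2) by auto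
  ultimately show ?thesis using that[of "max (norm x) (1/2)"] by simp
qed

section \<open>Truncations of an exhaustion function\<close>

text \<open>
  Here \<open>\<nu>\<close> is the Laplacian of \<open>u\<close>. Naming it separately keeps the definite description behind
  \<^const>\<open>laplacian\<close> out of the arguments.
\<close>

locale exhaustion =
  fixes u :: "complex \<Rightarrow> ereal" and \<nu> :: "complex measure"
  assumes u_E: "u \<in> \<E>" and has_lap: "has_laplacian u \<nu>" and finite_mass: "emeasure \<nu> \<D> < \<infinity>"
begin

lemma u_continuous: "continuous_on \<D> u"
  and u_subharmonic: "subharmonic_on \<D> u"
  and u_neg: "z \<in> \<D> \<Longrightarrow> u z < 0"
  and u_boundary: "(u \<longlongrightarrow> 0) (filtercomap norm (at_left 1))"
  using u_E by (simp_all add: class_E_def)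

lemma sets_\<nu> [measurable_cong, simp]: "sets \<nu> = sets borel"
  and null_\<nu>: "emeasure \<nu> (- \<D>) = 0"
  and test_\<nu>: "test_function \<D> \<phi> \<Longrightarrow> (LINT z|\<nu>. \<phi> z) =
        (LINT z:\<D>|lborel. real_of_ereal (u z) * classical_laplacian \<phi> z) / (2 * pi)"
  using has_lap by (simp_all add: has_laplacian_def)

lemma space_\<nu> [simp]: "space \<nu> = UNIV"
  using sets_eq_imp_space_eq[OF sets_\<nu>] by simp

lemma laplacian_u: "laplacian u = \<nu>"
  by (rule laplacian_eqI[OF has_lap])

lemma finite_\<nu>: "finite_measure \<nu>"
proof (rule finite_measureI)
  have "emeasure \<nu> (\<D> \<union> - \<D>) \<le> emeasure \<nu> \<D> + emeasure \<nu> (- \<D>)"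
    by (rule emeasure_subadditive) auto
  then show "emeasure \<nu> (space \<nu>) \<noteq> \<infinity>"
    using finite_mass null_\<nu> by (auto simp: top_unique)
qed

sublocale \<nu>: finite_measure \<nu> by (rule finite_\<nu>)

lemma AE_\<nu>: "AE z in \<nu>. z \<in> \<D>"
  using null_\<nu> by (intro AE_I'[of "- \<D>"]) (auto simp: null_sets_def)

lemma integrable_\<nu>_smooth:
  assumes "smooth f" "A \<in> sets borel"
  shows "integrable \<nu> (\<lambda>z. f z * indicator A z)"
proof -
  obtain B where B: "\<And>z. z \<in> cball 0 1 \<Longrightarrow> norm (f z) \<le> B"
    using compact_imp_bounded[OF compact_continuous_image[OF smooth_continuous_on[OF assms(1)] compact_cball[of 0 1]]]
    unfolding bounded_iff by blast
  show ?thesis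
  proof (rule \<nu>.integrable_const_bound)
    show "AE z in \<nu>. norm (f z * indicator A z) \<le> B"
      using AE_\<nu>
    proof (rule AE_mp, intro AE_I2 impI)
      fix z assume "z \<in> \<D>"
      then have "norm (f z) \<le> B" by (intro B) auto
      moreover from this have "0 \<le> B" by (rule order_trans[OF norm_ge_zero])
      ultimately show "norm (f z * indicator A z) \<le> B" by (auto simp: indicator_def)
    qed
    show "(\<lambda>z. f z * indicator A z) \<in> borel_measurable \<nu>"
      using assms smooth_borel_measurable[OF assms(1)] by measurable
  qed
qed

text \<open>
  The truncation as a real function on the plane. Its value 0 outside the disc is never seen by
  a test function on the disc; it makes the function bounded and measurable on the whole plane.
\<close>

definition trunc :: "real \<Rightarrow> complex \<Rightarrow> real"
  where "trunc r z = (if z \<in> \<D> then real_of_ereal (max (u z) (ereal r)) else 0)"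

lemma ereal_trunc: "z \<in> \<D> \<Longrightarrow> ereal (trunc r z) = max (u z) (ereal r)"
  using u_neg[of z] by (cases "u z") (auto simp: trunc_def max_def)

lemma trunc_bounds:
  assumes "r \<le> 0"
  shows "\<bar>trunc r z\<bar> \<le> \<bar>r\<bar>" "trunc r z \<le> 0"
proof -
  have "r \<le> trunc r z \<and> trunc r z \<le> 0"
  proof (cases "z \<in> \<D>")
    case True
    have "ereal r \<le> ereal (trunc r z)" "ereal (trunc r z) \<le> 0"
      unfolding ereal_trunc[OF True] using u_neg[OF True] assms by (auto simp: zero_ereal_def less_imp_le)
    then show ?thesis by (simp add: zero_ereal_def)
  qed (use assms in \<open>simp add: trunc_def\<close>)
  then show "\<bar>trunc r z\<bar> \<le> \<bar>r\<bar>" "trunc r z \<le> 0" by auto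
qed

lemma trunc_eq_u: "z \<in> \<D> \<Longrightarrow> ereal r < u z \<Longrightarrow> trunc r z = real_of_ereal (u z)"
  by (simp add: trunc_def max_absorb1 less_imp_le)

lemma trunc_eq_r: "z \<in> \<D> \<Longrightarrow> u z \<le> ereal r \<Longrightarrow> trunc r z = r"
  by (simp add: trunc_def max_absorb2)

lemma trunc_diff:
  assumes "s \<le> r"
  shows "\<bar>trunc s z - trunc r z\<bar> \<le> r - s"
proof (cases "z \<in> \<D>")
  case True
  then show ?thesis
    using assms u_neg[OF True] by (cases "u z") (auto simp: trunc_def max_def)
qed (use assms in \<open>simp add: trunc_def\<close>)

lemma trunc_measurable [measurable]: "trunc r \<in> borel_measurable borel"
proof -
  have "continuous_on \<D> (\<lambda>z. max (u z) (ereal r))"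
    by (intro continuous_on_max u_continuous continuous_on_const)
  then have "continuous_on \<D> (real_of_ereal \<circ> (\<lambda>z. max (u z) (ereal r)))"
  proof (rule continuous_on_iff_real[THEN iffD1, rotated])
    show "\<bar>max (u z) (ereal r)\<bar> \<noteq> \<infinity>" if "z \<in> \<D>" for z
      unfolding ereal_trunc[OF that, symmetric] by simp
  qed
  then show ?thesis
    unfolding trunc_def[abs_def] comp_def
    by (intro borel_measurable_continuous_on_if continuous_on_const) auto
qed

lemma open_superlevel: "open {z \<in> \<D>. ereal s < u z}"
  using continuous_openin_preimage_gen[OF u_continuous, of "{ereal s<..}"]
  by (simp add: openin_open_eq Int_def vimage_def)

lemma open_sublevel: "open (sublevel u r)"
  using continuous_openin_preimage_gen[OF u_continuous, of "{..<ereal r}"]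
  by (simp add: openin_open_eq Int_def vimage_def sublevel_def)


lemma trunc_submean:
  assumes "0 < h" "cball z h \<subseteq> \<D>" "r \<le> 0"
  shows "trunc r z \<le> circle_avg (trunc r) z h"
proof -
  have in_D: "z + of_real h * \<zeta> \<in> \<D>" if "norm \<zeta> = 1" for \<zeta>
  proof -
    have "z + of_real h * \<zeta> \<in> cball z h" using assms(1) that by (simp add: dist_norm norm_mult)
    with assms(2) show ?thesis by blast
  qed
  have z: "z \<in> \<D>" using assms by (auto simp: subset_iff)
  define W where "W = (\<integral>\<^sup>+\<zeta>\<in>\<T>. e2ennreal (- u (z + of_real h * \<zeta>)) \<partial>circle_measure)"
  have "(\<integral>\<^sup>+\<zeta>\<in>\<T>. e2ennreal (u (z + of_real h * \<zeta>)) \<partial>circle_measure) = (\<integral>\<^sup>+\<zeta>. 0 \<partial>circle_measure)"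
    using in_D u_neg by (intro nn_integral_cong) (auto simp: indicator_def e2ennreal_neg less_imp_le)
  then have mean: "circle_mean u z h = - enn2ereal W"
    by (simp add: circle_mean_def W_def zero_ennreal.rep_eq)
  have int: "integrable circle_measure (\<lambda>\<zeta>. - trunc r (z + of_real h * \<zeta>))"
    by (rule circle_integrable_bounded[where B = "\<bar>r\<bar>"]) (use trunc_bounds(1)[OF assms(3)] in auto)
  have "ennreal (- circle_avg (trunc r) z h) = ennreal (LINT \<zeta>|circle_measure. - trunc r (z + of_real h * \<zeta>))"
    by (simp add: circle_avg_def)
  also have "\<dots> = (\<integral>\<^sup>+\<zeta>. ennreal (- trunc r (z + of_real h * \<zeta>)) \<partial>circle_measure)"
    using int trunc_bounds(2)[OF assms(3)] by (intro nn_integral_eq_integral[symmetric]) auto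
  also have "\<dots> \<le> W"
    unfolding W_def
  proof (rule nn_integral_mono_AE)
    show "AE \<zeta> in circle_measure. ennreal (- trunc r (z + of_real h * \<zeta>))
        \<le> e2ennreal (- u (z + of_real h * \<zeta>)) * indicator \<T> \<zeta>"
      using AE_circle
    proof (rule AE_mp, intro AE_I2 impI)
      fix \<zeta> :: complex assume \<zeta>: "norm \<zeta> = 1"
      have "u (z + of_real h * \<zeta>) \<le> ereal (trunc r (z + of_real h * \<zeta>))"
        unfolding ereal_trunc[OF in_D[OF \<zeta>]] by simp
      then have "ereal (- trunc r (z + of_real h * \<zeta>)) \<le> - u (z + of_real h * \<zeta>)"
        by (simp add: ereal_uminus_le_reorder flip: uminus_ereal.simps(1))
      from e2ennreal_mono[OF this] show "ennreal (- trunc r (z + of_real h * \<zeta>))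
          \<le> e2ennreal (- u (z + of_real h * \<zeta>)) * indicator \<T> \<zeta>"
        using \<zeta> by simp
    qed
  qed
  finally have le_W: "ennreal (- circle_avg (trunc r) z h) \<le> W" .
  have "u z \<le> - enn2ereal W"
    using u_subharmonic assms(1,2) mean unfolding subharmonic_on_def by metis
  also have "\<dots> \<le> - enn2ereal (ennreal (- circle_avg (trunc r) z h))"
    using le_W by (simp add: less_eq_ennreal.rep_eq)
  also have "\<dots> \<le> ereal (circle_avg (trunc r) z h)"
    by (cases "0 \<le> - circle_avg (trunc r) z h") (simp_all add: enn2ereal_ennreal ennreal_neg zero_ennreal.rep_eq)
  finally have 1: "u z \<le> ereal (circle_avg (trunc r) z h)" .
  have "(LINT \<zeta>|circle_measure. r) \<le> circle_avg (trunc r) z h"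
    unfolding circle_avg_def
  proof (rule integral_mono)
    show "integrable circle_measure (\<lambda>\<zeta>. trunc r (z + of_real h * \<zeta>))" using int by simp
    show "r \<le> trunc r (z + of_real h * \<zeta>)" for \<zeta>
      using trunc_bounds[OF assms(3), of "z + of_real h * \<zeta>"] assms(3) by linarith
  qed simp
  then have "r \<le> circle_avg (trunc r) z h" using circle.prob_space by simp
  with 1 have "ereal (trunc r z) \<le> ereal (circle_avg (trunc r) z h)"
    unfolding ereal_trunc[OF z] by simp
  then show ?thesis by simp
qed

lemma test_function_D_bounded:
  assumes "test_function \<D> \<phi>"
  obtains \<rho> where "0 \<le> \<rho>" "\<rho> < 1" "\<And>z. \<phi> z \<noteq> 0 \<Longrightarrow> norm z \<le> \<rho>"
proof -
  obtain K where K: "compact K" "K \<subseteq> \<D>" "\<And>z. z \<notin> K \<Longrightarrow> \<phi> z = 0"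
    using assms by (rule test_functionE) blast
  obtain \<rho> where \<rho>: "0 < \<rho>" "\<rho> < 1" "K \<subseteq> cball 0 \<rho>"
    using compact_subset_disc[OF K(1,2)] by blast
  have "norm z \<le> \<rho>" if "\<phi> z \<noteq> 0" for z
  proof -
    have "z \<in> K" using that K(3) by blast
    then show ?thesis using \<rho>(3) by auto
  qed
  then show ?thesis using that[of \<rho>] \<rho>(1,2) by simp
qed

lemma trunc_laplacian_integrable:
  assumes "test_function \<D> \<phi>" "r \<le> 0"
  shows "integrable lborel (\<lambda>z. trunc r z * classical_laplacian \<phi> z)"
    and "integrable lborel (classical_laplacian \<phi>)"
proof -
  obtain K where K: "compact K" "K \<subseteq> \<D>" "\<And>z. z \<notin> K \<Longrightarrow> classical_laplacian \<phi> z = 0"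
    using assms(1) by (rule test_functionE) blast
  note sm = smooth_classical_laplacian[OF test_function_smooth[OF assms(1)]]
  obtain B where B: "0 < B" "\<And>z. \<bar>classical_laplacian \<phi> z\<bar> \<le> B"
    using bounded_of_compact_support[OF smooth_continuous_on[OF sm] K(1,3)] by blast
  note [measurable] = smooth_borel_measurable[OF sm]
  show "integrable lborel (classical_laplacian \<phi>)"
    by (rule integrable_compact_support[OF _ K(1,3) B(2)]) measurable
  show "integrable lborel (\<lambda>z. trunc r z * classical_laplacian \<phi> z)"
  proof (rule integrable_compact_support[OF _ K(1)])
    show "\<bar>trunc r z * classical_laplacian \<phi> z\<bar> \<le> \<bar>r\<bar> * B" for z
      unfolding abs_mult using trunc_bounds(1)[OF assms(2)] B(2) by (intro mult_mono) auto
  qed (simp_all add: K)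
qed

text \<open>
  \<open>2\<pi>\<close> times the distribution \<open>\<Delta>u\<^sub>r\<close>.
\<close>

definition pairing :: "real \<Rightarrow> (complex \<Rightarrow> real) \<Rightarrow> real"
  where "pairing r \<phi> = (LINT z|lborel. trunc r z * classical_laplacian \<phi> z)"

lemma pairing_add:
  assumes "test_function \<D> \<phi>" "test_function \<D> \<psi>" "r \<le> 0"
  shows "pairing r (\<lambda>z. \<phi> z + \<psi> z) = pairing r \<phi> + pairing r \<psi>"
  unfolding pairing_def classical_laplacian_add[OF test_function_smooth[OF assms(1)] test_function_smooth[OF assms(2)]]
    distrib_left
  by (rule Bochner_Integration.integral_add) (intro trunc_laplacian_integrable assms)+

lemma pairing_cmult:
  assumes "test_function \<D> \<phi>"
  shows "pairing r (\<lambda>z. c * \<phi> z) = c * pairing r \<phi>"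
  unfolding pairing_def classical_laplacian_cmult[OF test_function_smooth[OF assms(1)]]
  by (simp add: mult.left_commute)

lemma pairing_nonneg:
  assumes "test_function \<D> \<phi>" "\<And>z. 0 \<le> \<phi> z" "r \<le> 0"
  shows "0 \<le> pairing r \<phi>"
proof -
  obtain \<rho> where \<rho>: "0 \<le> \<rho>" "\<rho> < 1" "\<And>z. \<phi> z \<noteq> 0 \<Longrightarrow> norm z \<le> \<rho>"
    by (rule test_function_D_bounded[OF assms(1)]) blast
  have "4 * 0 * (LINT z|lborel. \<phi> z) \<le> (LINT z|lborel. trunc r z * classical_laplacian \<phi> z)"
  proof (rule laplacian_lower_bound[where B = "\<bar>r\<bar>" and ?h0.0 = "1 - \<rho>"])
    show "test_function UNIV \<phi>" using assms(1) by (rule test_function_mono) simp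
    show "trunc r z + 0 * h\<^sup>2 \<le> circle_avg (trunc r) z h" if "\<phi> z \<noteq> 0" "0 < h" "h < 1 - \<rho>" for z h
    proof -
      have "cball z h \<subseteq> \<D>"
      proof
        fix w assume "w \<in> cball z h"
        then have "norm w \<le> norm z + h" using norm_triangle_ineq[of z "w - z"] by (simp add: dist_norm norm_minus_commute)
        then show "w \<in> \<D>" using \<rho>(3)[OF that(1)] that(3) by simp
      qed
      from trunc_submean[OF that(2) this assms(3)] show ?thesis by simp
    qed
  qed (use assms \<rho> trunc_bounds(1)[OF assms(3)] in auto)
  then show ?thesis by (simp add: pairing_def)
qed

text \<open>
  Where \<open>u > r\<close> the truncation coincides with \<open>u\<close>; elsewhere the values of the truncation are
  multiplied by 0 if the Laplacian of the test function vanishes there.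
\<close>

lemma pairing_eq_\<nu>:
  assumes "test_function \<D> \<phi>" "\<And>z. z \<in> \<D> \<Longrightarrow> classical_laplacian \<phi> z \<noteq> 0 \<Longrightarrow> ereal r < u z"
  shows "pairing r \<phi> = 2 * pi * (LINT z|\<nu>. \<phi> z)"
proof -
  have "(LINT z:\<D>|lborel. real_of_ereal (u z) * classical_laplacian \<phi> z) = pairing r \<phi>"
    unfolding pairing_def set_lebesgue_integral_def
  proof (rule Bochner_Integration.integral_cong[OF refl])
    fix z
    show "indicator \<D> z *\<^sub>R (real_of_ereal (u z) * classical_laplacian \<phi> z) = trunc r z * classical_laplacian \<phi> z"
    proof (cases "z \<in> \<D> \<and> classical_laplacian \<phi> z \<noteq> 0")
      case True
      then show ?thesis using assms(2) by (simp add: trunc_eq_u)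
    qed (auto simp: trunc_def)
  qed
  then show ?thesis using test_\<nu>[OF assms(1)] by simp
qed

lemma pairing_eq_\<nu>_support:
  assumes "test_function {z \<in> \<D>. ereal r < u z} \<phi>"
  shows "pairing r \<phi> = 2 * pi * (LINT z|\<nu>. \<phi> z)"
proof (rule pairing_eq_\<nu>)
  show "test_function \<D> \<phi>" using assms by (rule test_function_mono) auto
  obtain K where K: "K \<subseteq> {z \<in> \<D>. ereal r < u z}" "\<And>z. z \<notin> K \<Longrightarrow> classical_laplacian \<phi> z = 0"
    using assms by (rule test_functionE) blast
  then show "ereal r < u z" if "classical_laplacian \<phi> z \<noteq> 0" for z using that by blast
qed

abbreviation outer :: "real \<Rightarrow> complex set"
  where "outer r \<equiv> \<D> - sublevel u r"

lemma outer_borel [measurable]: "outer r \<in> sets borel"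
  using open_sublevel[of r] by auto

lemma in_outer: "z \<in> outer r \<longleftrightarrow> z \<in> \<D> \<and> ereal r \<le> u z"
  by (auto simp: sublevel_def)

text \<open>
  A cutoff \<open>\<eta>\<close> splits the test function. On the support of \<open>\<eta>\<close> the truncation at \<open>s\<close> is \<open>u\<close> itself
  and contributes \<open>\<nu>\<close>; the rest contributes a nonnegative amount. The strict inequality \<open>s < r\<close>
  leaves room for \<open>\<eta>\<close> to be 1 on the part of the support where \<open>u \<ge> r\<close>.
\<close>

lemma kato_strict:
  assumes \<phi>: "test_function \<D> \<phi>" "\<And>z. 0 \<le> \<phi> z" and "s < r" "r \<le> 0"
  shows "2 * pi * (LINT z|\<nu>. \<phi> z * indicator (outer r) z) \<le> pairing s \<phi>"
proof -
  obtain K where K: "compact K" "K \<subseteq> \<D>" "\<And>z. z \<notin> K \<Longrightarrow> \<phi> z = 0"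
    using \<phi>(1) by (rule test_functionE) blast
  define K0 where "K0 = {z \<in> K. ereal r \<le> u z}"
  have "closedin (top_of_set K) K0"
    using continuous_closedin_preimage[OF continuous_on_subset[OF u_continuous K(2)], of "{ereal r..}"]
    by (simp add: K0_def Int_def vimage_def)
  then have K0: "compact K0" by (rule closedin_compact[OF K(1)])
  have K0_sub: "K0 \<subseteq> {z \<in> \<D>. ereal s < u z}"
    using K(2) assms(3) by (auto simp: K0_def intro: less_le_trans[of "ereal s" "ereal r"])
  obtain \<eta> K' where \<eta>: "smooth \<eta>" "\<And>z. 0 \<le> \<eta> z" "\<And>z. \<eta> z \<le> 1" "\<And>z. z \<in> K0 \<Longrightarrow> \<eta> z = 1"
    and K': "compact K'" "K' \<subseteq> {z \<in> \<D>. ereal s < u z}" "\<And>z. z \<notin> K' \<Longrightarrow> \<eta> z = 0"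
    by (rule smooth_urysohn[OF K0 open_superlevel K0_sub]) blast
  note sm = test_function_smooth[OF \<phi>(1)]
  have t1: "test_function {z \<in> \<D>. ereal s < u z} (\<lambda>z. \<phi> z * \<eta> z)"
    by (rule test_functionI[of _ K'])
      (use K' compact_imp_closed in \<open>auto intro!: smooth_mult sm \<eta>\<close>)
  have t1': "test_function \<D> (\<lambda>z. \<phi> z * \<eta> z)" using t1 by (rule test_function_mono) auto
  have t2: "test_function \<D> (\<lambda>z. \<phi> z * (1 - \<eta> z))"
    by (intro test_function_mult \<phi>(1) smooth_diff smooth_const \<eta>)
  have "2 * pi * (LINT z|\<nu>. \<phi> z * indicator (outer r) z) \<le> 2 * pi * (LINT z|\<nu>. \<phi> z * \<eta> z * indicator UNIV z)"
  proof (intro mult_left_mono integral_mono integrable_\<nu>_smooth smooth_mult sm \<eta>(1))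
    fix z
    show "\<phi> z * indicator (outer r) z \<le> \<phi> z * \<eta> z * indicator UNIV z"
    proof (cases "z \<in> outer r \<and> z \<in> K")
      case True
      then have "z \<in> K0" unfolding K0_def in_outer by blast
      then show ?thesis using \<eta>(4) True by simp
    next
      case False
      then have "\<phi> z * indicator (outer r) z = 0" using K(3)[of z] by auto
      then show ?thesis
        using mult_nonneg_nonneg[OF \<phi>(2)[of z] \<eta>(2)[of z]] by (simp only: indicator_UNIV mult_1_right)
    qed
  qed auto
  also have "\<dots> = pairing s (\<lambda>z. \<phi> z * \<eta> z)"
    using pairing_eq_\<nu>_support[OF t1] by simp
  also have "\<dots> \<le> pairing s (\<lambda>z. \<phi> z * \<eta> z) + pairing s (\<lambda>z. \<phi> z * (1 - \<eta> z))"
    using pairing_nonneg[OF t2] \<phi>(2) \<eta>(3) assms(3,4) by simp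
  also have "\<dots> = pairing s (\<lambda>z. \<phi> z * \<eta> z + \<phi> z * (1 - \<eta> z))"
    using assms(3,4) by (intro pairing_add[symmetric] t1' t2) auto
  also have "(\<lambda>z. \<phi> z * \<eta> z + \<phi> z * (1 - \<eta> z)) = \<phi>" by (auto simp: algebra_simps)
  finally show ?thesis .
qed

text \<open>
  Kato's inequality \<open>\<Delta> max(u, r) \<ge> 1\<^bsub>{u \<ge> r}\<^esub> \<Delta>u\<close>, including the level set \<open>{u = r}\<close>, which may carry mass
  of \<open>\<Delta>u\<close>. It follows from the strict form because truncations depend uniformly on the level.
\<close>

lemma kato:
  assumes \<phi>: "test_function \<D> \<phi>" "\<And>z. 0 \<le> \<phi> z" and "r \<le> 0"
  shows "2 * pi * (LINT z|\<nu>. \<phi> z * indicator (outer r) z) \<le> pairing r \<phi>"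
proof (rule field_le_epsilon)
  fix e :: real assume e: "0 < e"
  define A where "A = (LINT z|lborel. \<bar>classical_laplacian \<phi> z\<bar>)"
  have A: "0 \<le> A" by (simp add: A_def)
  define d where "d = e / (A + 1)"
  have d: "0 < d" "d * A \<le> e" using e A by (auto simp: d_def field_simps)
  note int = trunc_laplacian_integrable[OF \<phi>(1)]
  have "pairing (r - d) \<phi> - pairing r \<phi> =
      (LINT z|lborel. (trunc (r - d) z - trunc r z) * classical_laplacian \<phi> z)"
    unfolding pairing_def left_diff_distrib
    using assms(3) d by (intro Bochner_Integration.integral_diff[symmetric] int) auto
  also have "\<dots> \<le> (LINT z|lborel. d * \<bar>classical_laplacian \<phi> z\<bar>)"
  proof (rule integral_mono)
    show "integrable lborel (\<lambda>z. (trunc (r - d) z - trunc r z) * classical_laplacian \<phi> z)"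
      unfolding left_diff_distrib using assms(3) d by (intro Bochner_Integration.integrable_diff int) auto
    show "integrable lborel (\<lambda>z. d * \<bar>classical_laplacian \<phi> z\<bar>)"
      using int(2)[OF assms(3)] by (intro Bochner_Integration.integrable_mult_right integrable_abs)
    show "(trunc (r - d) z - trunc r z) * classical_laplacian \<phi> z \<le> d * \<bar>classical_laplacian \<phi> z\<bar>" for z
    proof -
      have "\<bar>(trunc (r - d) z - trunc r z) * classical_laplacian \<phi> z\<bar> \<le> d * \<bar>classical_laplacian \<phi> z\<bar>"
        unfolding abs_mult using trunc_diff[of "r - d" r z] d by (intro mult_right_mono) auto
      then show ?thesis by linarith
    qed
  qed
  also have "\<dots> = d * A" by (simp add: A_def)
  finally have "pairing (r - d) \<phi> \<le> pairing r \<phi> + e" using d(2) by linarith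
  moreover have "2 * pi * (LINT z|\<nu>. \<phi> z * indicator (outer r) z) \<le> pairing (r - d) \<phi>"
    using d assms by (intro kato_strict) auto
  ultimately show "2 * pi * (LINT z|\<nu>. \<phi> z * indicator (outer r) z) \<le> pairing r \<phi> + e" by linarith
qed

lemma boundary_layer:
  assumes "r < 0"
  obtains \<rho> where "0 < \<rho>" "\<rho> < 1" "\<And>z. z \<in> \<D> \<Longrightarrow> \<rho> \<le> norm z \<Longrightarrow> ereal r < u z"
proof -
  have "eventually (\<lambda>z. ereal r < u z) (filtercomap norm (at_left 1))"
    using order_tendstoD(1)[OF u_boundary, of "ereal r"] assms by (simp add: zero_ereal_def)
  then obtain P where P: "eventually P (at_left (1 :: real))" "\<And>z :: complex. P (norm z) \<Longrightarrow> ereal r < u z"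
    unfolding eventually_filtercomap by blast
  then obtain b where b: "b < 1" "\<And>y. b < y \<Longrightarrow> y < 1 \<Longrightarrow> P y"
    unfolding eventually_at_left_field by blast
  show ?thesis
    by (rule that[of "(1 + max b 0) / 2"]) (use b P(2) in \<open>auto simp: max_def field_simps split: if_splits\<close>)
qed

end

section \<open>Level measures\<close>

context exhaustion
begin

lemma sublevel_borel [measurable]: "sublevel u r \<in> sets borel"
  by (rule borel_open[OF open_sublevel])

text \<open>
  The level measure \<open>\<mu>\<^bsub>u,r\<^esub>\<close> as a functional on test functions. Kato's inequality says that it is
  positive, and it vanishes on test functions supported in \<open>{u > r}\<close> or in \<open>{u < r}\<close>.
\<close>

definition excess :: "real \<Rightarrow> (complex \<Rightarrow> real) \<Rightarrow> real"
  where "excess r \<phi> = pairing r \<phi> / (2 * pi) - (LINT z|\<nu>. \<phi> z * indicator (outer r) z)"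

lemma excess_add:
  assumes "test_function \<D> \<phi>" "test_function \<D> \<psi>" "r \<le> 0"
  shows "excess r (\<lambda>z. \<phi> z + \<psi> z) = excess r \<phi> + excess r \<psi>"
proof -
  have "(LINT z|\<nu>. (\<phi> z + \<psi> z) * indicator (outer r) z) =
      (LINT z|\<nu>. \<phi> z * indicator (outer r) z) + (LINT z|\<nu>. \<psi> z * indicator (outer r) z)"
    unfolding distrib_right
    by (intro Bochner_Integration.integral_add integrable_\<nu>_smooth outer_borel test_function_smooth[OF assms(1)]
        test_function_smooth[OF assms(2)])
  then show ?thesis
    by (simp add: excess_def pairing_add[OF assms] add_divide_distrib)
qed

lemma excess_cmult:
  assumes "test_function \<D> \<phi>"
  shows "excess r (\<lambda>z. c * \<phi> z) = c * excess r \<phi>"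
  by (simp add: excess_def pairing_cmult[OF assms] mult.assoc right_diff_distrib)

lemma excess_nonneg:
  assumes "test_function \<D> \<phi>" "\<And>z. 0 \<le> \<phi> z" "r \<le> 0"
  shows "0 \<le> excess r \<phi>"
  using kato[OF assms] by (simp add: excess_def field_simps)

lemma excess_above:
  assumes "test_function {z \<in> \<D>. ereal r < u z} \<phi>"
  shows "excess r \<phi> = 0"
proof -
  obtain K where K: "K \<subseteq> {z \<in> \<D>. ereal r < u z}" "\<And>z. z \<notin> K \<Longrightarrow> \<phi> z = 0"
    using assms by (rule test_functionE) blast
  have "\<phi> z * indicator (outer r) z = \<phi> z" for z
  proof (cases "z \<in> K")
    case True
    then have "z \<in> outer r" unfolding in_outer using K(1) by auto
    then show ?thesis by simp
  qed (simp add: K(2))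
  then have "(LINT z|\<nu>. \<phi> z * indicator (outer r) z) = (LINT z|\<nu>. \<phi> z)" by (simp only:)
  then show ?thesis by (simp add: excess_def pairing_eq_\<nu>_support[OF assms])
qed

lemma excess_below:
  assumes "test_function \<D> \<phi>" "\<And>z. \<phi> z \<noteq> 0 \<Longrightarrow> z \<in> C" "closed C" "C \<subseteq> sublevel u r"
  shows "excess r \<phi> = 0"
proof -
  have "closure {z. \<phi> z \<noteq> 0} \<subseteq> C" using assms(2,3) by (intro closure_minimal) auto
  then have sub: "z \<in> sublevel u r" if "classical_laplacian \<phi> z \<noteq> 0" for z
    using classical_laplacian_outside[of z \<phi>] that assms(4) by blast
  have "trunc r z * classical_laplacian \<phi> z = r * classical_laplacian \<phi> z" for z
  proof (cases "classical_laplacian \<phi> z = 0")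
    case False
    from sub[OF this] have "trunc r z = r" by (intro trunc_eq_r) (auto simp: sublevel_def)
    then show ?thesis by simp
  qed simp
  then have "pairing r \<phi> = r * (LINT z|lborel. classical_laplacian \<phi> z)"
    by (simp only: pairing_def integral_mult_right_zero)
  also have "\<dots> = 0"
    using integral_classical_laplacian[OF test_function_mono[OF assms(1)]] by simp
  finally have "pairing r \<phi> = 0" .
  moreover have "(LINT z|\<nu>. \<phi> z * indicator (outer r) z) = 0"
  proof -
    have "\<phi> z * indicator (outer r) z = 0" for z
      using assms(2)[of z] assms(4) by (cases "\<phi> z = 0") auto
    then show ?thesis by (simp only: Bochner_Integration.integral_zero)
  qed
  ultimately show ?thesis by (simp add: excess_def)
qed

lemma integral_density_outer:
  assumes "smooth f"
  shows "(LINT z|density \<nu> (indicator (outer r)). f z) = (LINT z|\<nu>. f z * indicator (outer r) z)"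
proof -
  have "density \<nu> (indicator (outer r)) = density \<nu> (\<lambda>z. ennreal (indicator (outer r) z))"
    by (intro density_cong) (auto simp: indicator_def)
  moreover have "f \<in> borel_measurable \<nu>" using smooth_borel_measurable[OF assms] by simp
  ultimately show ?thesis by (simp add: integral_density mult.commute)
qed

lemma has_laplacian_truncation:
  assumes r: "r \<le> 0" and \<mu>: "sets \<mu> = sets borel" "finite_measure \<mu>" "emeasure \<mu> (- \<D>) = 0"
    and pair: "\<And>\<phi>. test_function \<D> \<phi> \<Longrightarrow> (LINT z|\<mu>. \<phi> z) = excess r \<phi>"
  shows "has_laplacian (truncation u r) (plus_measure \<mu> (density \<nu> (indicator (outer r))))"
proof -
  let ?N = "density \<nu> (indicator (outer r))"
  interpret \<mu>: finite_measure \<mu> by fact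
  have sets: "sets \<mu> = sets ?N" by (simp add: \<mu>)
  have space: "space \<mu> = UNIV" using sets_eq_imp_space_eq[OF \<mu>(1)] by simp
  have N_le: "emeasure ?N A \<le> emeasure \<nu> A" if "A \<in> sets borel" for A
    using that by (subst emeasure_restricted) (auto intro!: emeasure_mono)
  have fin: "emeasure (plus_measure \<mu> ?N) A < \<infinity>" if "A \<in> sets borel" for A
  proof -
    have "emeasure ?N A < \<infinity>"
      using N_le[OF that] \<nu>.emeasure_finite[of A] by (auto simp: less_top[symmetric] top_unique)
    moreover have "emeasure \<mu> A < \<infinity>" using \<mu>.emeasure_finite[of A] by (simp add: less_top[symmetric])
    ultimately show ?thesis using that by (simp add: emeasure_plus_measure[OF sets] \<mu>)
  qed
  have real_trunc: "truncation u r z = ereal (trunc r z)" if "z \<in> \<D>" for z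
    using ereal_trunc[OF that] by (simp add: truncation_def)
  show ?thesis
    unfolding has_laplacian_def locally_integrable_on_def
  proof (intro conjI allI impI)
    show "truncation u r \<in> borel_measurable (restrict_space borel \<D>)"
    proof -
      have "(\<lambda>z. ereal (trunc r z)) \<in> borel_measurable (restrict_space borel \<D>)"
        by (intro measurable_restrict_space1) measurable
      then show ?thesis
        by (rule measurable_cong[THEN iffD1, rotated]) (simp add: space_restrict_space real_trunc)
    qed
    show "(\<integral>\<^sup>+z\<in>K. e2ennreal \<bar>truncation u r z\<bar> \<partial>lborel) < \<infinity>" if K: "compact K" "K \<subseteq> \<D>" for K
    proof -
      have "(\<integral>\<^sup>+z\<in>K. e2ennreal \<bar>truncation u r z\<bar> \<partial>lborel) \<le> (\<integral>\<^sup>+z. ennreal \<bar>r\<bar> * indicator K z \<partial>lborel)"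
      proof (intro nn_integral_mono)
        fix z
        show "e2ennreal \<bar>truncation u r z\<bar> * indicator K z \<le> ennreal \<bar>r\<bar> * indicator K z"
        proof (cases "z \<in> K")
          case True
          then have "z \<in> \<D>" using K by blast
          then show ?thesis using True trunc_bounds(1)[OF r, of z] by (simp add: real_trunc ennreal_leI)
        qed simp
      qed
      also have "\<dots> = ennreal \<bar>r\<bar> * emeasure lborel K"
        using borel_compact[OF K(1)] by (simp add: nn_integral_cmult)
      also have "\<dots> < \<infinity>"
        using emeasure_compact_finite[OF K(1)] by (simp add: ennreal_mult_less_top)
      finally show ?thesis .
    qed
    show "sets (plus_measure \<mu> ?N) = sets borel" by (simp add: \<mu>)
    have "emeasure ?N (- \<D>) = 0" using N_le[of "- \<D>"] null_\<nu> by simp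
    then show "emeasure (plus_measure \<mu> ?N) (- \<D>) = 0"
      by (subst emeasure_plus_measure[OF sets]) (simp_all add: \<mu>)
    show "emeasure (plus_measure \<mu> ?N) K < \<infinity>" if "compact K" for K
      by (rule fin[OF borel_compact[OF that]])
    fix \<phi> assume \<phi>: "test_function \<D> \<phi>"
    note sm = test_function_smooth[OF \<phi>]
    obtain K where K: "compact K" "\<And>z. z \<notin> K \<Longrightarrow> \<phi> z = 0" using \<phi> by (rule test_functionE) blast
    obtain B where B: "\<And>z. \<bar>\<phi> z\<bar> \<le> B" using bounded_of_compact_support[OF smooth_continuous_on[OF sm] K] by blast
    have meas: "\<phi> \<in> borel_measurable L" if "sets L = sets borel" for L
      using smooth_borel_measurable[OF sm] that by (simp cong: measurable_cong_sets)
    have "finite_measure ?N"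
      by (rule finite_measureI) (use N_le[of UNIV] \<nu>.emeasure_finite[of UNIV] in \<open>auto simp: top_unique\<close>)
    then have int_N: "integrable ?N \<phi>"
    proof (rule finite_measure.integrable_const_bound)
      show "AE z in ?N. norm (\<phi> z) \<le> B" using B by (intro AE_I2) simp
      show "\<phi> \<in> borel_measurable ?N" by (rule meas) simp
    qed
    have int_\<mu>: "integrable \<mu> \<phi>"
    proof (rule \<mu>.integrable_const_bound)
      show "AE z in \<mu>. norm (\<phi> z) \<le> B" using B by (intro AE_I2) simp
      show "\<phi> \<in> borel_measurable \<mu>" by (rule meas[OF \<mu>(1)])
    qed
    have "(LINT z|plus_measure \<mu> ?N. \<phi> z) = excess r \<phi> + (LINT z|\<nu>. \<phi> z * indicator (outer r) z)"
      by (simp add: integral_plus_measure[OF sets int_\<mu> int_N] pair[OF \<phi>] integral_density_outer[OF sm])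
    also have "\<dots> = pairing r \<phi> / (2 * pi)" by (simp add: excess_def)
    also have "pairing r \<phi> = (LINT z:\<D>|lborel. real_of_ereal (truncation u r z) * classical_laplacian \<phi> z)"
      unfolding pairing_def set_lebesgue_integral_def
    proof (rule Bochner_Integration.integral_cong[OF refl])
      fix z
      show "trunc r z * classical_laplacian \<phi> z =
          indicator \<D> z *\<^sub>R (real_of_ereal (truncation u r z) * classical_laplacian \<phi> z)"
        by (cases "z \<in> \<D>") (simp add: real_trunc, simp add: trunc_def)
    qed
    finally show "(LINT z|plus_measure \<mu> ?N. \<phi> z) =
        (LINT z:\<D>|lborel. real_of_ereal (truncation u r z) * classical_laplacian \<phi> z) / (2 * pi)" .
  qed
qed

text \<open>
  If a measure \<open>\<mu>\<close> represents the excess functional, then \<open>\<mu> + 1\<^bsub>{u \<ge> r}\<^esub> \<nu>\<close> is the Laplacian of the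
  truncation, and subtracting the second summand gives back \<open>\<mu>\<close>, since all masses are finite.
\<close>

lemma level_measure_eqI:
  assumes r: "r \<le> 0" and \<mu>: "sets \<mu> = sets borel" "finite_measure \<mu>" "emeasure \<mu> (- \<D>) = 0"
    and pair: "\<And>\<phi>. test_function \<D> \<phi> \<Longrightarrow> (LINT z|\<mu>. \<phi> z) = excess r \<phi>"
  shows "level_measure u r = \<mu>"
proof -
  let ?N = "density \<nu> (indicator (outer r))"
  interpret \<mu>: finite_measure \<mu> by fact
  have sets: "sets \<mu> = sets ?N" by (simp add: \<mu>)
  have finN: "emeasure ?N A < \<infinity>" if "A \<in> sets borel" for A
  proof -
    have "emeasure ?N A \<le> emeasure \<nu> A"
      using that by (subst emeasure_restricted) (auto intro!: emeasure_mono)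
    also have "\<dots> < \<infinity>" using \<nu>.emeasure_finite[of A] by (simp add: less_top[symmetric])
    finally show ?thesis .
  qed
  have em: "emeasure (plus_measure \<mu> ?N) A = emeasure \<mu> A + emeasure ?N A" if "A \<in> sets borel" for A
    using that by (intro emeasure_plus_measure[OF sets]) (simp add: \<mu>)
  have fin: "finite_measure (plus_measure \<mu> ?N)" "finite_measure ?N"
    using finN[of UNIV] \<mu>.emeasure_finite[of UNIV] em[of UNIV] sets_eq_imp_space_eq[OF \<mu>(1)]
    by (auto intro!: finite_measureI simp: less_top)
  have lap: "laplacian (truncation u r) = plus_measure \<mu> ?N"
    by (intro laplacian_eqI has_laplacian_truncation assms)
  have "level_measure u r = diff_measure (plus_measure \<mu> ?N) ?N"
    unfolding level_measure_def laplacian_u lap ..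
  also have "\<dots> = \<mu>"
  proof (rule measure_eqI)
    fix A assume "A \<in> sets (diff_measure (plus_measure \<mu> ?N) ?N)"
    then have A: "A \<in> sets borel" by (simp add: \<mu>)
    have "emeasure (diff_measure (plus_measure \<mu> ?N) ?N) A = emeasure (plus_measure \<mu> ?N) A - emeasure ?N A"
      by (rule emeasure_diff_measure[OF fin]) (use A in \<open>auto simp: \<mu> em\<close>)
    also have "\<dots> = emeasure \<mu> A"
      using finN[OF A] by (simp add: em[OF A] less_top)
    finally show "emeasure (diff_measure (plus_measure \<mu> ?N) ?N) A = emeasure \<mu> A" .
  qed simp
  finally show ?thesis .
qed

text \<open>
  The excess functional lives on the compact set \<open>{u = r}\<close>, so multiplying by a cutoff \<open>\<psi>\<close> that is 1
  near it extends the functional to all smooth functions, and the Riesz theorem yields the measure.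
  The last two claims drive the limit \<open>r \<rightarrow> 0\<close>: there is no mass on a disc where \<open>u < r\<close>, and a
  harmonic \<open>h\<close> is integrated to \<open>\<integral>\<^bsub>{u < r}\<^esub> h d\<nu>\<close>. For the second one, the Laplacian of \<open>\<psi> h\<close> vanishes
  where \<open>\<psi> = 1\<close>, in particular wherever \<open>u\<close> and its truncation differ; hence both pair with it to
  the same number.
\<close>

lemma level_measure_properties:
  assumes r: "r < 0"
  shows "sets (level_measure u r) = sets borel"
    and "finite_measure (level_measure u r)"
    and "emeasure (level_measure u r) (- \<D>) = 0"
    and "\<And>\<sigma>. 0 < \<sigma> \<Longrightarrow> cball 0 \<sigma> \<subseteq> sublevel u r \<Longrightarrow> emeasure (level_measure u r) (ball 0 \<sigma>) = 0"
    and "\<And>h. smooth h \<Longrightarrow> (\<And>z. classical_laplacian h z = 0) \<Longrightarrow>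
      (LINT z|level_measure u r. h z) = (LINT z|\<nu>. h z * indicator (sublevel u r) z)"
proof -
  have r': "r \<le> 0" using r by simp
  obtain \<rho> where \<rho>: "0 < \<rho>" "\<rho> < 1" "\<And>z. z \<in> \<D> \<Longrightarrow> \<rho> \<le> norm z \<Longrightarrow> ereal r < u z"
    by (rule boundary_layer[OF r]) blast
  (* Two radii between rho and 1: the cutoff is 1 up to the first and 0 from the second on. *)
  define \<rho>1 \<rho>2 where "\<rho>1 = (2 * \<rho> + 1) / 3" and "\<rho>2 = (\<rho> + 2) / 3"
  have \<rho>12: "\<rho> < \<rho>1" "\<rho>1 < \<rho>2" "\<rho>2 < 1" "0 \<le> \<rho>1" using \<rho> by (auto simp: \<rho>1_def \<rho>2_def)
  have sub_\<rho>: "norm z < \<rho>" if "z \<in> sublevel u r" for z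
    using \<rho>(3)[of z] that by (force simp: sublevel_def)
  obtain \<psi> where \<psi>: "smooth \<psi>" "\<And>z. 0 \<le> \<psi> z" "\<And>z. \<psi> z \<le> 1"
      "\<And>z. norm z \<le> \<rho>1 \<Longrightarrow> \<psi> z = 1" "\<And>z. norm z \<ge> \<rho>2 \<Longrightarrow> \<psi> z = 0"
    using radial_cutoff[OF \<rho>12(4,2)] by blast
  have \<psi>f: "test_function \<D> (\<lambda>z. \<psi> z * f z)" if "smooth f" for f
  proof (rule test_functionI[of _ "cball 0 \<rho>2"])
    show "z \<in> cball 0 \<rho>2" if "\<psi> z * f z \<noteq> 0" for z
      using that \<psi>(5)[of z] by (cases "\<rho>2 \<le> norm z") auto
  qed (use \<rho>12 in \<open>auto intro!: smooth_mult \<psi> that\<close>)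
  define L where "L f = excess r (\<lambda>z. \<psi> z * f z)" for f
  have D_square: "\<D> \<subseteq> square"
  proof
    fix z :: complex assume "z \<in> \<D>"
    then show "z \<in> square" using abs_Re_le_cmod[of z] abs_Im_le_cmod[of z] by (simp add: in_square)
  qed
  obtain \<mu> where \<mu>: "sets \<mu> = sets borel" "finite_measure \<mu>" "\<And>f. smooth f \<Longrightarrow> (LINT z|\<mu>. f z) = L f"
    "emeasure \<mu> (- square) = 0"
  proof (rule riesz_representation_square[of L])
    show "L (\<lambda>z. f z + g z) = L f + L g" if "smooth f" "smooth g" for f g
      unfolding L_def distrib_left by (rule excess_add[OF \<psi>f[OF that(1)] \<psi>f[OF that(2)] r'])
    show "L (\<lambda>z. c * f z) = c * L f" if "smooth f" for c f
      unfolding L_def mult.left_commute[of _ c] by (rule excess_cmult[OF \<psi>f[OF that]])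
    show "0 \<le> L f" if f: "smooth f" "\<And>z. z \<in> square \<Longrightarrow> 0 \<le> f z" for f
      unfolding L_def
    proof (rule excess_nonneg[OF \<psi>f[OF f(1)] _ r'])
      fix z
      show "0 \<le> \<psi> z * f z"
      proof (cases "z \<in> \<D>")
        case True
        then show ?thesis using D_square f(2) \<psi>(2) by (intro mult_nonneg_nonneg) auto
      next
        case False
        then have "\<psi> z = 0" using \<rho>12 by (intro \<psi>(5)) auto
        then show ?thesis by simp
      qed
    qed
  qed blast
  interpret \<mu>: finite_measure \<mu> by fact
  have space: "space \<mu> = UNIV" using sets_eq_imp_space_eq[OF \<mu>(1)] by simp
  have AE_sq: "AE z in \<mu>. z \<in> square"
    using \<mu>(4) by (intro AE_I'[of "- square"]) (auto simp: null_sets_def \<mu>(1) square_def)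
  have int: "integrable \<mu> f" if "smooth f" for f
  proof -
    have "compact (f ` square)"
      by (intro compact_continuous_image smooth_continuous_on[OF that]) (simp add: square_def compact_cbox)
    then have "bounded (f ` square)" by (rule compact_imp_bounded)
    then obtain B where B: "\<And>z. z \<in> square \<Longrightarrow> norm (f z) \<le> B" unfolding bounded_iff by blast
    show ?thesis
    proof (rule \<mu>.integrable_const_bound)
      show "AE z in \<mu>. norm (f z) \<le> B" using AE_sq by (rule AE_mp) (intro AE_I2 impI B)
      show "f \<in> borel_measurable \<mu>"
        using smooth_borel_measurable[OF that] \<mu>(1) by (simp cong: measurable_cong_sets)
    qed
  qed
  have null: "emeasure \<mu> {z. 0 < f z} = 0" if f: "smooth f" "\<And>z. 0 \<le> f z" "L f = 0" for f
  proof -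
    have "{z. 0 < f z} \<in> sets borel" using smooth_borel_measurable[OF f(1)] by measurable
    then show ?thesis
      using null_set_positivity[OF int[OF f(1)] f(2)] \<mu>(3)[OF f(1)] f(3) by (simp add: space \<mu>(1))
  qed
  have null_outside: "emeasure \<mu> (- \<D>) = 0"
  proof -
    (* A smooth function that is positive exactly where the cutoff has no influence. *)
    let ?f = "\<lambda>z :: complex. flat 0 ((norm (z - 0))\<^sup>2 - \<rho>2\<^sup>2)"
    have pos: "0 < ?f z \<longleftrightarrow> \<rho>2 < norm z" for z
    proof -
      have "(norm (z - 0))\<^sup>2 \<le> \<rho>2\<^sup>2 \<longleftrightarrow> norm z \<le> \<rho>2"
        using power_mono_iff[of "norm z" \<rho>2 2] \<rho>12 by simp
      then show ?thesis unfolding flat_pos by (simp add: not_le[symmetric] del: not_le)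
    qed
    have "L ?f = excess r (\<lambda>z. 0 * \<psi> z)"
      unfolding L_def
    proof (rule arg_cong[where f = "excess r"], rule ext)
      fix z
      show "\<psi> z * ?f z = 0 * \<psi> z"
      proof (cases "norm z \<ge> \<rho>2")
        case False
        then have "\<not> 0 < ?f z" unfolding pos by simp
        then have "?f z = 0" using flat_nonneg[of "(norm (z - 0))\<^sup>2 - \<rho>2\<^sup>2"] by linarith
        then show ?thesis by simp
      qed (simp add: \<psi>(5))
    qed
    also have "\<dots> = 0" using excess_cmult[OF \<psi>f[OF smooth_const[of 1]], of r 0] by simp
    finally have "emeasure \<mu> {z. 0 < ?f z} = 0"
      by (intro null smooth_flat smooth_diff smooth_norm_square smooth_const flat_nonneg)
    moreover have "- \<D> \<subseteq> {z. 0 < ?f z}" unfolding pos using \<rho>12 by auto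
    moreover have "{z. 0 < ?f z} \<in> sets \<mu>" unfolding pos \<mu>(1) by measurable
    ultimately show ?thesis by (metis emeasure_mono le_zero_eq)
  qed
  have pair: "(LINT z|\<mu>. \<phi> z) = excess r \<phi>" if \<phi>: "test_function \<D> \<phi>" for \<phi>
  proof -
    note sm = test_function_smooth[OF \<phi>]
    obtain K where K: "compact K" "K \<subseteq> \<D>" "\<And>z. z \<notin> K \<Longrightarrow> \<phi> z = 0" using \<phi> by (rule test_functionE) blast
    have t: "test_function {z \<in> \<D>. ereal r < u z} (\<lambda>z. (1 - \<psi> z) * \<phi> z)"
    proof (rule test_functionI[of _ "K \<inter> {z. \<rho>1 \<le> norm z}"])
      show "smooth (\<lambda>z. (1 - \<psi> z) * \<phi> z)" by (intro smooth_mult smooth_diff smooth_const \<psi> sm)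
      show "compact (K \<inter> {z. \<rho>1 \<le> norm z})"
        using K(1) by (intro compact_Int_closed closed_Collect_le continuous_intros)
      show "K \<inter> {z. \<rho>1 \<le> norm z} \<subseteq> {z \<in> \<D>. ereal r < u z}"
        using K(2) \<rho>(3) \<rho>12 by fastforce
      show "z \<in> K \<inter> {z. \<rho>1 \<le> norm z}" if "(1 - \<psi> z) * \<phi> z \<noteq> 0" for z
        using that K(3)[of z] \<psi>(4)[of z] by (cases "norm z \<le> \<rho>1") auto
    qed
    have t': "test_function \<D> (\<lambda>z. (1 - \<psi> z) * \<phi> z)" using t by (rule test_function_mono) auto
    have "excess r \<phi> = excess r (\<lambda>z. \<psi> z * \<phi> z + (1 - \<psi> z) * \<phi> z)" by (simp add: algebra_simps)
    also have "\<dots> = L \<phi> + 0"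
      unfolding excess_add[OF \<psi>f[OF sm] t' r'] excess_above[OF t] L_def ..
    finally show ?thesis using \<mu>(3)[OF sm] by simp
  qed
  have level: "level_measure u r = \<mu>"
    by (rule level_measure_eqI[OF r' \<mu>(1,2) null_outside pair])
  show "sets (level_measure u r) = sets borel" "finite_measure (level_measure u r)"
    "emeasure (level_measure u r) (- \<D>) = 0"
    unfolding level by fact+
  show "emeasure (level_measure u r) (ball 0 \<sigma>) = 0" if \<sigma>: "0 < \<sigma>" "cball 0 \<sigma> \<subseteq> sublevel u r" for \<sigma>
  proof -
    obtain f where f: "smooth f" "\<And>z. 0 \<le> f z" "\<And>z. 0 < f z \<longleftrightarrow> z \<in> ball 0 \<sigma>"
      using bump_ball[OF \<sigma>(1), of 0] by blast
    have "L f = 0"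
      unfolding L_def
    proof (rule excess_below[OF \<psi>f[OF f(1)] _ _ \<sigma>(2)])
      show "z \<in> cball 0 \<sigma>" if "\<psi> z * f z \<noteq> 0" for z
        using that f(2)[of z] f(3)[of z] by (cases "f z = 0") auto
    qed simp
    moreover have "{z. 0 < f z} = ball 0 \<sigma>" using f(3) by blast
    ultimately show ?thesis using null[OF f(1,2)] by (simp only: level)
  qed
  fix h assume h: "smooth h" "\<And>z. classical_laplacian h z = 0"
  have "pairing r (\<lambda>z. \<psi> z * h z) = 2 * pi * (LINT z|\<nu>. \<psi> z * h z)"
  proof (rule pairing_eq_\<nu>[OF \<psi>f[OF h(1)]])
    fix z assume z: "z \<in> \<D>" "classical_laplacian (\<lambda>z. \<psi> z * h z) z \<noteq> 0"
    have "\<rho>1 \<le> norm z"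
    proof (rule ccontr)
      assume "\<not> ?thesis"
      then have "classical_laplacian (\<lambda>z. \<psi> z * h z) z = classical_laplacian h z"
        by (intro classical_laplacian_local[of "ball 0 \<rho>1"]) (auto simp: \<psi>(4))
      with z(2) h(2) show False by simp
    qed
    with \<rho>(3)[OF z(1)] \<rho>12 show "ereal r < u z" by simp
  qed
  then have "L h = (LINT z|\<nu>. \<psi> z * h z * indicator UNIV z) - (LINT z|\<nu>. \<psi> z * h z * indicator (outer r) z)"
    by (simp add: L_def excess_def)
  also have "\<dots> = (LINT z|\<nu>. \<psi> z * h z * indicator UNIV z - \<psi> z * h z * indicator (outer r) z)"
    by (intro Bochner_Integration.integral_diff[symmetric] integrable_\<nu>_smooth smooth_mult \<psi> h) auto
  also have "\<dots> = (LINT z|\<nu>. h z * indicator (sublevel u r) z)"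
  proof (rule integral_cong_AE)
    show "(\<lambda>z. \<psi> z * h z * indicator UNIV z - \<psi> z * h z * indicator (outer r) z) \<in> borel_measurable \<nu>"
      "(\<lambda>z. h z * indicator (sublevel u r) z) \<in> borel_measurable \<nu>"
      using smooth_borel_measurable[OF \<psi>(1)] smooth_borel_measurable[OF h(1)] by measurable
    show "AE z in \<nu>. \<psi> z * h z * indicator UNIV z - \<psi> z * h z * indicator (outer r) z = h z * indicator (sublevel u r) z"
      using AE_\<nu>
    proof (rule AE_mp, intro AE_I2 impI)
      fix z assume "z \<in> \<D>"
      then show "\<psi> z * h z * indicator UNIV z - \<psi> z * h z * indicator (outer r) z = h z * indicator (sublevel u r) z"
        using sub_\<rho>[of z] \<psi>(4)[of z] \<rho>12 by (cases "z \<in> sublevel u r") auto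
    qed
  qed
  finally show "(LINT z|level_measure u r. h z) = (LINT z|\<nu>. h z * indicator (sublevel u r) z)"
    unfolding level \<mu>(3)[OF h(1)] .
qed

end

section \<open>Harmonic polynomials\<close>

text \<open>
  Real parts of polynomials, generated in the form in which their Laplacians, Poisson integrals and
  products on the circle can be treated by induction.
\<close>

inductive harmonic_poly :: "(complex \<Rightarrow> real) \<Rightarrow> bool"
  where
    power: "harmonic_poly (\<lambda>z. Re (c * z ^ n))"
  | add: "harmonic_poly f \<Longrightarrow> harmonic_poly g \<Longrightarrow> harmonic_poly (\<lambda>z. f z + g z)"

lemma harmonic_poly_smooth: "harmonic_poly h \<Longrightarrow> smooth h"
proof (induction rule: harmonic_poly.induct)
  case (power c n)
  show ?case by (rule smooth_Re_power)
next
  case (add f g)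
  show ?case by (rule smooth_add[OF add.IH])
qed

lemma harmonic_poly_laplacian: "harmonic_poly h \<Longrightarrow> classical_laplacian h z = 0"
  by (induction rule: harmonic_poly.induct)
    (simp_all only: classical_laplacian_Re_power classical_laplacian_add harmonic_poly_smooth)

lemma harmonic_poly_const: "harmonic_poly (\<lambda>z. c)"
  using harmonic_poly.power[of "of_real c" 0] by simp

lemma poisson_kernel_mult_integrable:
  assumes "smooth h" "norm z < 1"
  shows "integrable circle_measure (\<lambda>\<zeta>. poisson_kernel z \<zeta> * h \<zeta>)"
proof -
  obtain B where B: "\<And>\<zeta>. \<zeta> \<in> cball 0 1 \<Longrightarrow> norm (h \<zeta>) \<le> B"
    using compact_imp_bounded[OF compact_continuous_image[OF smooth_continuous_on[OF assms(1)] compact_cball[of 0 1]]]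
    unfolding bounded_iff by blast
  have [measurable]: "h \<in> borel_measurable borel" by (rule smooth_borel_measurable[OF assms(1)])
  show ?thesis
  proof (rule circle_integrable_bounded)
    fix \<zeta> :: complex assume \<zeta>: "norm \<zeta> = 1"
    show "norm (poisson_kernel z \<zeta> * h \<zeta>) \<le> 2 / (1 - norm z) * B"
      unfolding norm_mult
      using poisson_kernel_bounds(1)[OF assms(2) \<zeta>] poisson_kernel_nonneg[of z \<zeta>] assms(2) B[of \<zeta>] \<zeta>
      by (intro mult_mono) auto
  qed measurable
qed

lemma harmonic_poly_poisson:
  assumes "norm z < 1"
  shows "harmonic_poly h \<Longrightarrow> (LINT \<zeta>|circle_measure. poisson_kernel z \<zeta> * h \<zeta>) = h z"
proof (induction rule: harmonic_poly.induct)
  case (power c n)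
  show ?case by (rule poisson_formula_power[OF assms])
next
  case (add f g)
  then show ?case
    unfolding distrib_left
    using poisson_kernel_mult_integrable[OF harmonic_poly_smooth assms]
    by (subst Bochner_Integration.integral_add) auto
qed

text \<open>
  On the circle \<open>cnj \<zeta>\<close> is the inverse of \<open>\<zeta>\<close>, so \<open>2 Re a Re b = Re (a b) + Re (a cnj b)\<close> expresses a
  product of two monomials by monomials, after a conjugation if the difference of the exponents
  is negative.
\<close>

lemma harmonic_poly_circle_mult:
  assumes "harmonic_poly f" "harmonic_poly g"
  shows "\<exists>h. harmonic_poly h \<and> (\<forall>\<zeta>. norm \<zeta> = 1 \<longrightarrow> f \<zeta> * g \<zeta> = h \<zeta>)"
  using assms
proof (induction arbitrary: g rule: harmonic_poly.induct)
  case (power c m)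
  from power show ?case
  proof (induction rule: harmonic_poly.induct)
    case (power d n)
    have split: "Re a * Re b = Re (a * b / 2) + Re (a * cnj b / 2)" for a b
      by (simp add: field_simps)
    have cnj: "\<exists>e k. \<forall>\<zeta>. norm \<zeta> = 1 \<longrightarrow> Re ((c * \<zeta> ^ m) * cnj (d * \<zeta> ^ n) / 2) = Re (e * \<zeta> ^ k)"
    proof (cases "n \<le> m")
      case True
      have "(c * \<zeta> ^ m) * cnj (d * \<zeta> ^ n) / 2 = (c * cnj d / 2) * \<zeta> ^ (m - n)" if "norm \<zeta> = 1" for \<zeta>
      proof -
        have "\<zeta> ^ n * cnj \<zeta> ^ n = 1"
          using complex_norm_square[of \<zeta>] that by (simp flip: power_mult_distrib)
        moreover have "\<zeta> ^ m = \<zeta> ^ (m - n) * \<zeta> ^ n" using True by (simp flip: power_add)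
        ultimately show ?thesis by (simp add: algebra_simps)
      qed
      then show ?thesis by metis
    next
      case False
      have "Re ((c * \<zeta> ^ m) * cnj (d * \<zeta> ^ n) / 2) = Re ((cnj c * d / 2) * \<zeta> ^ (n - m))" if "norm \<zeta> = 1" for \<zeta>
      proof -
        have "\<zeta> ^ m * cnj \<zeta> ^ m = 1"
          using complex_norm_square[of \<zeta>] that by (simp flip: power_mult_distrib)
        moreover have "\<zeta> ^ n = \<zeta> ^ (n - m) * \<zeta> ^ m" using False by (simp flip: power_add)
        ultimately have "cnj ((c * \<zeta> ^ m) * cnj (d * \<zeta> ^ n) / 2) = (cnj c * d / 2) * \<zeta> ^ (n - m)"
          by (simp add: algebra_simps)
        then show ?thesis by (metis complex_cnj(1) complex_surj cnj.sel(1))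
      qed
      then show ?thesis by metis
    qed
    then obtain e k where ek: "\<And>\<zeta>. norm \<zeta> = 1 \<Longrightarrow> Re ((c * \<zeta> ^ m) * cnj (d * \<zeta> ^ n) / 2) = Re (e * \<zeta> ^ k)"
      by blast
    have "Re (c * \<zeta> ^ m) * Re (d * \<zeta> ^ n) = Re ((c * d / 2) * \<zeta> ^ (m + n)) + Re (e * \<zeta> ^ k)" if "norm \<zeta> = 1" for \<zeta>
    proof -
      have "(c * \<zeta> ^ m) * (d * \<zeta> ^ n) / 2 = (c * d / 2) * \<zeta> ^ (m + n)" by (simp add: power_add)
      then show ?thesis using split[of "c * \<zeta> ^ m" "d * \<zeta> ^ n"] ek[OF that] by (simp only:)
    qed
    then show ?case
      by (intro exI[of _ "\<lambda>\<zeta>. Re ((c * d / 2) * \<zeta> ^ (m + n)) + Re (e * \<zeta> ^ k)"] conjI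
          harmonic_poly.add harmonic_poly.power) blast
  next
    case (add f g)
    then obtain h1 h2 where "harmonic_poly h1" "\<forall>\<zeta>. norm \<zeta> = 1 \<longrightarrow> Re (c * \<zeta> ^ m) * f \<zeta> = h1 \<zeta>"
      "harmonic_poly h2" "\<forall>\<zeta>. norm \<zeta> = 1 \<longrightarrow> Re (c * \<zeta> ^ m) * g \<zeta> = h2 \<zeta>" by blast
    then show ?case
      by (intro exI[of _ "\<lambda>z. h1 z + h2 z"] conjI harmonic_poly.add) (simp_all only: distrib_left, simp)
  qed
next
  case (add f1 f2)
  obtain h1 where h1: "harmonic_poly h1" "\<forall>\<zeta>. norm \<zeta> = 1 \<longrightarrow> f1 \<zeta> * g \<zeta> = h1 \<zeta>" using add.IH(1)[OF add.prems] by blast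
  obtain h2 where h2: "harmonic_poly h2" "\<forall>\<zeta>. norm \<zeta> = 1 \<longrightarrow> f2 \<zeta> * g \<zeta> = h2 \<zeta>" using add.IH(2)[OF add.prems] by blast
  show ?case
    using h1 h2 by (intro exI[of _ "\<lambda>z. h1 z + h2 z"] conjI harmonic_poly.add) (simp_all add: distrib_right)
qed

lemma real_polynomial_circle:
  "real_polynomial_function p \<Longrightarrow> \<exists>h. harmonic_poly h \<and> (\<forall>\<zeta>::complex. norm \<zeta> = 1 \<longrightarrow> p \<zeta> = h \<zeta>)"
proof (induction rule: real_polynomial_function.induct)
  case (linear f)
  interpret bounded_linear f by fact
  have "f \<zeta> = Re (Complex (f 1) (- f \<i>) * \<zeta> ^ 1)" for \<zeta>
  proof -
    have "\<zeta> = Re \<zeta> *\<^sub>R 1 + Im \<zeta> *\<^sub>R \<i>" by (simp add: complex_eq_iff)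
    then have "f \<zeta> = f (Re \<zeta> *\<^sub>R 1 + Im \<zeta> *\<^sub>R \<i>)" by simp
    also have "\<dots> = Re \<zeta> * f 1 + Im \<zeta> * f \<i>" by (simp only: add scaleR real_scaleR_def)
    finally show ?thesis by (simp add: mult.commute)
  qed
  then show ?case by (intro exI[of _ "\<lambda>\<zeta>. Re (Complex (f 1) (- f \<i>) * \<zeta> ^ 1)"] conjI harmonic_poly.power) blast
next
  case (const c)
  then show ?case using harmonic_poly_const by blast
next
  case (add f g)
  then obtain h1 h2 where "harmonic_poly h1" "\<forall>\<zeta>. norm \<zeta> = 1 \<longrightarrow> f \<zeta> = h1 \<zeta>"
    "harmonic_poly h2" "\<forall>\<zeta>. norm \<zeta> = 1 \<longrightarrow> g \<zeta> = h2 \<zeta>" by blast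
  then show ?case by (intro exI[of _ "\<lambda>z. h1 z + h2 z"] conjI harmonic_poly.add) simp_all
next
  case (mult f g)
  then obtain h1 h2 where h: "harmonic_poly h1" "\<forall>\<zeta>. norm \<zeta> = 1 \<longrightarrow> f \<zeta> = h1 \<zeta>"
    "harmonic_poly h2" "\<forall>\<zeta>. norm \<zeta> = 1 \<longrightarrow> g \<zeta> = h2 \<zeta>" by blast
  obtain h where "harmonic_poly h" "\<forall>\<zeta>. norm \<zeta> = 1 \<longrightarrow> h1 \<zeta> * h2 \<zeta> = h \<zeta>"
    using harmonic_poly_circle_mult[OF h(1,3)] by blast
  with h show ?case by (intro exI[of _ h]) simp
qed

text \<open>
  The Stone--Weierstrass theorem gives a real polynomial close to \<open>\<phi>\<close>, and on the circle this polynomial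
  equals a harmonic one; by compactness the two remain close in an annulus at the circle.
\<close>

lemma harmonic_poly_approximation:
  fixes \<phi> :: "complex \<Rightarrow> real"
  assumes "continuous_on (cball 0 1) \<phi>" "0 < e"
  obtains h \<sigma> where "harmonic_poly h" "0 < \<sigma>" "\<sigma> < 1"
    "\<And>z. \<sigma> \<le> norm z \<Longrightarrow> norm z \<le> 1 \<Longrightarrow> \<bar>\<phi> z - h z\<bar> \<le> e"
proof -
  obtain p where p: "real_polynomial_function p" "\<And>z. z \<in> cball 0 1 \<Longrightarrow> \<bar>\<phi> z - p z\<bar> < e / 2"
    using Stone_Weierstrass_real_polynomial_function[OF compact_cball assms(1), of "e / 2"] assms(2) by auto
  obtain h where h: "harmonic_poly h" "\<And>\<zeta>. norm \<zeta> = 1 \<Longrightarrow> p \<zeta> = h \<zeta>"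
    using real_polynomial_circle[OF p(1)] by blast
  define K where "K = {z \<in> cball 0 1. e / 2 \<le> \<bar>\<phi> z - h z\<bar>}"
  have cont: "continuous_on (cball 0 1) (\<lambda>z. \<bar>\<phi> z - h z\<bar>)"
    by (intro continuous_intros assms(1) smooth_continuous_on harmonic_poly_smooth h(1))
  have "closedin (top_of_set (cball 0 1)) K"
    using continuous_closedin_preimage[OF cont, of "{e / 2..}"] by (simp add: K_def Int_def vimage_def)
  then have "compact K" by (rule closedin_compact[OF compact_cball])
  moreover have "K \<subseteq> ball 0 1"
  proof
    fix z assume z: "z \<in> K"
    then have "norm z \<noteq> 1" using p(2)[of z] h(2)[of z] by (auto simp: K_def)
    with z show "z \<in> ball 0 1" by (simp add: K_def)
  qed
  ultimately obtain \<rho> where \<rho>: "0 < \<rho>" "\<rho> < 1" "K \<subseteq> cball 0 \<rho>" by (rule compact_subset_disc) blast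
  show ?thesis
  proof (rule that[OF h(1), of "(1 + \<rho>) / 2"])
    fix z :: complex assume z: "(1 + \<rho>) / 2 \<le> norm z" "norm z \<le> 1"
    then have "z \<notin> cball 0 \<rho>" using \<rho>(2) by simp
    then have "z \<notin> K" using \<rho>(3) by blast
    then show "\<bar>\<phi> z - h z\<bar> \<le> e" using z assms(2) by (auto simp: K_def)
  qed (use \<rho> in auto)
qed

section \<open>Sweeping the Laplacian to the circle\<close>

text \<open>
  The density with respect to \<^const>\<open>circle_measure\<close> of the balayage of a measure on the disc
  to the circle.
\<close>

definition poisson_sweep :: "complex measure \<Rightarrow> complex \<Rightarrow> ennreal"
  where "poisson_sweep \<nu> \<zeta> = (\<integral>\<^sup>+z\<in>\<D>. ennreal (poisson_kernel z \<zeta>) \<partial>\<nu>)"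

lemma disc_measurable [measurable]: "\<D> \<in> sets (borel :: complex measure)"
  by simp

context exhaustion
begin

abbreviation swept :: "complex measure"
  where "swept \<equiv> density circle_measure (poisson_sweep \<nu>)"

lemma poisson_sweep_measurable [measurable]: "poisson_sweep \<nu> \<in> borel_measurable borel"
  unfolding poisson_sweep_def by (rule \<nu>.borel_measurable_nn_integral) measurable

lemma poisson_sweep_integral:
  assumes [measurable]: "g \<in> borel_measurable borel"
  shows "(\<integral>\<^sup>+\<zeta>. g \<zeta> * poisson_sweep \<nu> \<zeta> \<partial>circle_measure) =
    (\<integral>\<^sup>+z\<in>\<D>. (\<integral>\<^sup>+\<zeta>. g \<zeta> * ennreal (poisson_kernel z \<zeta>) \<partial>circle_measure) \<partial>\<nu>)"
proof -
  interpret P: pair_sigma_finite circle_measure \<nu> by unfold_locales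
  have "(\<integral>\<^sup>+\<zeta>. g \<zeta> * poisson_sweep \<nu> \<zeta> \<partial>circle_measure) =
      (\<integral>\<^sup>+\<zeta>. (\<integral>\<^sup>+z. g \<zeta> * (ennreal (poisson_kernel z \<zeta>) * indicator \<D> z) \<partial>\<nu>) \<partial>circle_measure)"
    unfolding poisson_sweep_def by (intro nn_integral_cong nn_integral_cmult[symmetric]) measurable
  also have "\<dots> = (\<integral>\<^sup>+z. (\<integral>\<^sup>+\<zeta>. g \<zeta> * (ennreal (poisson_kernel z \<zeta>) * indicator \<D> z) \<partial>circle_measure) \<partial>\<nu>)"
    by (rule P.Fubini'[symmetric]) measurable
  also have "\<dots> = (\<integral>\<^sup>+z\<in>\<D>. (\<integral>\<^sup>+\<zeta>. g \<zeta> * ennreal (poisson_kernel z \<zeta>) \<partial>circle_measure) \<partial>\<nu>)"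
    by (intro nn_integral_cong) (auto simp: indicator_def)
  finally show ?thesis .
qed

lemma sets_swept: "sets swept = sets borel" and space_swept: "space swept = UNIV"
  by simp_all

lemma swept_mass: "emeasure swept UNIV = emeasure \<nu> \<D>"
  and poisson_sweep_total: "(\<integral>\<^sup>+\<zeta>. poisson_sweep \<nu> \<zeta> \<partial>circle_measure) = emeasure \<nu> \<D>"
proof -
  have "(\<integral>\<^sup>+\<zeta>. 1 * poisson_sweep \<nu> \<zeta> \<partial>circle_measure) =
      (\<integral>\<^sup>+z\<in>\<D>. (\<integral>\<^sup>+\<zeta>. 1 * ennreal (poisson_kernel z \<zeta>) \<partial>circle_measure) \<partial>\<nu>)"
    by (rule poisson_sweep_integral) simp
  also have "\<dots> = (\<integral>\<^sup>+z. indicator \<D> z \<partial>\<nu>)"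
  proof (rule nn_integral_cong)
    fix z
    show "(\<integral>\<^sup>+\<zeta>. 1 * ennreal (poisson_kernel z \<zeta>) \<partial>circle_measure) * indicator \<D> z = indicator \<D> z"
    proof (cases "z \<in> \<D>")
      case True
      then have z: "norm z < 1" by simp
      have "(\<integral>\<^sup>+\<zeta>. ennreal (poisson_kernel z \<zeta>) \<partial>circle_measure) = ennreal (LINT \<zeta>|circle_measure. poisson_kernel z \<zeta>)"
        using poisson_kernel_mult_integrable[OF smooth_const[of 1] z] poisson_kernel_nonneg[of z] z
        by (intro nn_integral_eq_integral) auto
      then show ?thesis by (simp add: poisson_integral_1[OF z])
    qed simp
  qed
  also have "\<dots> = emeasure \<nu> \<D>" by simp
  finally show "(\<integral>\<^sup>+\<zeta>. poisson_sweep \<nu> \<zeta> \<partial>circle_measure) = emeasure \<nu> \<D>" by simp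
  then show "emeasure swept UNIV = emeasure \<nu> \<D>" by (simp add: emeasure_density)
qed

lemma finite_swept: "finite_measure swept"
  by (rule finite_measureI) (use swept_mass finite_mass in \<open>simp add: less_top\<close>)

lemma AE_swept: "AE \<zeta> in swept. norm \<zeta> = 1"
  by (subst AE_density) (use AE_circle in \<open>auto elim: AE_mp\<close>)

lemma swept_integrable: "integrable swept f" if "f \<in> borel_measurable borel" "\<And>\<zeta>. norm \<zeta> = 1 \<Longrightarrow> \<bar>f \<zeta>\<bar> \<le> B" for f :: "complex \<Rightarrow> real"
proof (rule finite_measure.integrable_const_bound[OF finite_swept])
  show "AE \<zeta> in swept. norm (f \<zeta>) \<le> B"
    using AE_swept by (rule AE_mp) (use that(2) in auto)
qed (use that(1) in simp)

text \<open>
  By Tonelli the integral against the swept measure is the integral over \<open>\<nu>\<close> of the Poisson integral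
  of \<open>h\<close>, which is \<open>h\<close>. Tonelli's theorem requires \<open>h\<close> to be nonnegative; the general case follows by adding a
  constant to \<open>h\<close>.
\<close>

lemma swept_harmonic_poly_nonneg:
  assumes h: "harmonic_poly h" and pos: "\<And>z. norm z \<le> 1 \<Longrightarrow> 0 \<le> h z"
  shows "(LINT \<zeta>|swept. h \<zeta>) = (LINT z|\<nu>. h z)"
proof -
  note sm = harmonic_poly_smooth[OF h]
  note [measurable] = smooth_borel_measurable[OF sm]
  have "(\<integral>\<^sup>+\<zeta>. ennreal (h \<zeta>) \<partial>swept) = (\<integral>\<^sup>+\<zeta>. ennreal (h \<zeta>) * poisson_sweep \<nu> \<zeta> \<partial>circle_measure)"
    by (simp add: nn_integral_density mult.commute)
  also have "\<dots> = (\<integral>\<^sup>+z\<in>\<D>. (\<integral>\<^sup>+\<zeta>. ennreal (h \<zeta>) * ennreal (poisson_kernel z \<zeta>) \<partial>circle_measure) \<partial>\<nu>)"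
    by (rule poisson_sweep_integral) measurable
  also have "\<dots> = (\<integral>\<^sup>+z. ennreal (h z) \<partial>\<nu>)"
  proof (rule nn_integral_cong_AE)
    show "AE z in \<nu>. (\<integral>\<^sup>+\<zeta>. ennreal (h \<zeta>) * ennreal (poisson_kernel z \<zeta>) \<partial>circle_measure) * indicator \<D> z = ennreal (h z)"
      using AE_\<nu>
    proof (rule AE_mp, intro AE_I2 impI)
      fix z assume "z \<in> \<D>"
      then have z: "norm z < 1" by simp
      have nonneg: "AE \<zeta> in circle_measure. 0 \<le> poisson_kernel z \<zeta> * h \<zeta>"
        using AE_circle by (rule AE_mp) (use poisson_kernel_nonneg[of z] z pos in auto)
      have "(\<integral>\<^sup>+\<zeta>. ennreal (h \<zeta>) * ennreal (poisson_kernel z \<zeta>) \<partial>circle_measure) =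
          (\<integral>\<^sup>+\<zeta>. ennreal (poisson_kernel z \<zeta> * h \<zeta>) \<partial>circle_measure)"
        using poisson_kernel_nonneg[of z] z by (intro nn_integral_cong) (simp add: ennreal_mult'' mult.commute flip: ennreal_mult')
      also have "\<dots> = ennreal (h z)"
        using nn_integral_eq_integral[OF poisson_kernel_mult_integrable[OF sm z] nonneg]
        by (simp add: harmonic_poly_poisson[OF z h])
      finally show "(\<integral>\<^sup>+\<zeta>. ennreal (h \<zeta>) * ennreal (poisson_kernel z \<zeta>) \<partial>circle_measure) * indicator \<D> z = ennreal (h z)"
        using \<open>z \<in> \<D>\<close> by simp
    qed
  qed
  finally have eq: "(\<integral>\<^sup>+\<zeta>. ennreal (h \<zeta>) \<partial>swept) = (\<integral>\<^sup>+z. ennreal (h z) \<partial>\<nu>)" .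
  have "(LINT \<zeta>|swept. h \<zeta>) = enn2real (\<integral>\<^sup>+\<zeta>. ennreal (h \<zeta>) \<partial>swept)"
  proof (rule integral_eq_nn_integral)
    show "AE \<zeta> in swept. 0 \<le> h \<zeta>" using AE_swept by (rule AE_mp) (use pos in auto)
  qed simp
  also have "\<dots> = (LINT z|\<nu>. h z)"
    unfolding eq
  proof (rule integral_eq_nn_integral[symmetric])
    show "AE z in \<nu>. 0 \<le> h z" using AE_\<nu> by (rule AE_mp) (use pos in auto)
  qed simp
  finally show ?thesis .
qed

lemma swept_harmonic_poly:
  assumes h: "harmonic_poly h"
  shows "(LINT \<zeta>|swept. h \<zeta>) = (LINT z|\<nu>. h z)"
proof -
  note sm = harmonic_poly_smooth[OF h]
  obtain B where B: "\<And>\<zeta>. \<zeta> \<in> cball 0 1 \<Longrightarrow> norm (h \<zeta>) \<le> B"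
    using compact_imp_bounded[OF compact_continuous_image[OF smooth_continuous_on[OF sm] compact_cball[of 0 1]]]
    unfolding bounded_iff by blast
  have hB: "harmonic_poly (\<lambda>z. h z + B)" by (intro harmonic_poly.add h harmonic_poly_const)
  have pos: "0 \<le> h z + B" "0 \<le> B" if "norm z \<le> 1" for z
    using B[of z] that by (auto simp: abs_le_iff)
  have B0: "0 \<le> B" using pos(2)[of 0] by simp
  have int: "integrable swept h" "integrable \<nu> h"
    using swept_integrable[of h B] B smooth_borel_measurable[OF sm] integrable_\<nu>_smooth[OF sm, of UNIV] by auto
  have const: "integrable swept (\<lambda>_. B)" "integrable \<nu> (\<lambda>_. B)"
    using swept_integrable[of "\<lambda>_. B" B] B0 integrable_\<nu>_smooth[OF smooth_const[of B], of UNIV] by auto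
  have "(LINT \<zeta>|swept. h \<zeta> + B) = (LINT z|\<nu>. h z + B)"
    by (rule swept_harmonic_poly_nonneg[OF hB pos(1)])
  moreover have "(LINT \<zeta>|swept. B) = (LINT z|\<nu>. B)"
    by (rule swept_harmonic_poly_nonneg[OF harmonic_poly_const B0])
  ultimately show ?thesis using int const by (simp only: Bochner_Integration.integral_add)
qed

text \<open>
  On a compact disc the maximum of \<open>u\<close> is negative, so the disc lies below every level close to 0.
\<close>

lemma eventually_sublevel:
  assumes "\<sigma> < 1"
  shows "eventually (\<lambda>r. r < 0 \<and> cball (0 :: complex) \<sigma> \<subseteq> sublevel u r) (at_left 0)"
proof (cases "cball (0 :: complex) \<sigma> = {}")
  case True
  then show ?thesis by (simp add: eventually_at_left_field) (intro exI[of _ "-1"], simp)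
next
  case False
  have sub: "cball (0 :: complex) \<sigma> \<subseteq> \<D>" using assms by auto
  obtain w where w: "w \<in> cball 0 \<sigma>" "\<And>z. z \<in> cball 0 \<sigma> \<Longrightarrow> u z \<le> u w"
    using continuous_attains_sup[OF compact_cball False continuous_on_subset[OF u_continuous sub]] by blast
  have "u w < 0" using u_neg w(1) sub by blast
  then obtain s where s: "u w < ereal s" "ereal s < 0" using ereal_dense2 by blast
  then have "s < 0" by (simp add: zero_ereal_def)
  moreover have "cball (0 :: complex) \<sigma> \<subseteq> sublevel u r" if "s < r" for r
  proof
    fix z :: complex assume z: "z \<in> cball 0 \<sigma>"
    have "u z < ereal s" using w(2)[OF z] s(1) by (rule order_le_less_trans)
    also have "ereal s < ereal r" using that by simp
    finally show "z \<in> sublevel u r" using z sub by (auto simp: sublevel_def)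
  qed
  ultimately show ?thesis by (auto simp: eventually_at_left_field)
qed

lemma \<nu>_tail:
  assumes "0 < e"
  obtains \<sigma> where "0 < \<sigma>" "\<sigma> < 1" "measure \<nu> (\<D> - ball 0 \<sigma>) < e"
proof -
  define A where "A n = \<D> - ball 0 (1 - inverse (real (Suc n)))" for n
  have "(\<lambda>n. measure \<nu> (A n)) \<longlonglongrightarrow> measure \<nu> (\<Inter>n. A n)"
  proof (rule \<nu>.finite_Lim_measure_decseq)
    show "decseq A"
      unfolding decseq_def A_def
      by (intro allI impI Diff_mono subset_ball diff_left_mono) (auto intro!: le_imp_inverse_le)
  qed (auto simp: A_def)
  moreover have "(\<Inter>n. A n) = {}"
  proof -
    have "\<exists>n. z \<notin> A n" if "z \<in> \<D>" for z
    proof -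
      have "0 < 1 - norm z" using that by simp
      then obtain n where "inverse (real (Suc n)) < 1 - norm z" using reals_Archimedean by blast
      then show ?thesis by (auto simp: A_def intro!: exI[of _ n])
    qed
    then show ?thesis by (auto simp: A_def)
  qed
  ultimately have "(\<lambda>n. measure \<nu> (A n)) \<longlonglongrightarrow> 0" by simp
  then have "eventually (\<lambda>n. measure \<nu> (A n) < e) sequentially"
    using assms by (rule order_tendstoD)
  then obtain N where N: "\<And>n. N \<le> n \<Longrightarrow> measure \<nu> (A n) < e" by (auto simp: eventually_sequentially)
  have "inverse (real (Suc (Suc N))) < 1" by (simp add: inverse_less_1_iff)
  then show ?thesis
    using N[of "Suc N"] by (intro that[of "1 - inverse (real (Suc (Suc N)))"]) (simp_all add: A_def)
qed

text \<open>
  Let \<open>h\<close> be a harmonic polynomial close to \<open>\<phi>\<close> in an annulus \<open>\<sigma> \<le> |z| \<le> 1\<close>. For \<open>r\<close> near 0 the level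
  measure lives in this annulus and has mass at most that of \<open>\<nu>\<close>, so \<open>\<phi>\<close> may be replaced by \<open>h\<close>. Its
  integral of \<open>h\<close> is \<open>\<integral>\<^bsub>{u < r}\<^esub> h d\<nu>\<close>, which differs from \<open>\<integral> h d\<nu>\<close> by at most the tail of \<open>\<nu>\<close>
  near the circle, and \<open>\<integral> h d\<nu>\<close> is the integral of \<open>h\<close> against the swept measure.
\<close>

lemma weak_star_limit_swept: "weak_star_limit (level_measure u) swept (at_left 0)"
  unfolding weak_star_limit_def
proof (intro allI impI tendstoI)
  fix \<phi> :: "complex \<Rightarrow> real" and e :: real
  assume \<phi>: "continuous_on (cball 0 1) \<phi>" and e: "0 < e"
  define \<Phi> where "\<Phi> z = indicator (cball 0 1) z *\<^sub>R \<phi> z" for z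
  have [measurable]: "\<Phi> \<in> borel_measurable borel"
    unfolding \<Phi>_def[abs_def] by (intro borel_measurable_continuous_on_indicator \<phi>) auto
  define m where "m = measure \<nu> UNIV"
  have m: "0 \<le> m" by (simp add: m_def)
  (* Two replacements of phi by h cost m times epsilon each, the tail costs one more epsilon. *)
  define \<epsilon> where "\<epsilon> = e / (2 * m + 2)"
  have \<epsilon>0: "0 < \<epsilon>" using e m by (simp add: \<epsilon>_def)
  have "\<epsilon> * (2 * m + 2) = e" using m by (simp add: \<epsilon>_def)
  then have "2 * m * \<epsilon> + \<epsilon> = e - \<epsilon>" by (simp add: algebra_simps)
  with \<epsilon>0 have \<epsilon>: "0 < \<epsilon>" "2 * m * \<epsilon> + \<epsilon> < e" by simp_all
  obtain h \<sigma>0 where h: "harmonic_poly h" and \<sigma>0: "0 < \<sigma>0" "\<sigma>0 < 1"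
    "\<And>z. \<sigma>0 \<le> norm z \<Longrightarrow> norm z \<le> 1 \<Longrightarrow> \<bar>\<phi> z - h z\<bar> \<le> \<epsilon>"
    by (rule harmonic_poly_approximation[OF \<phi> \<epsilon>(1)]) blast
  note sm = harmonic_poly_smooth[OF h]
  note [measurable] = smooth_borel_measurable[OF sm]
  obtain B where B: "\<And>z. z \<in> cball 0 1 \<Longrightarrow> norm (h z) \<le> B"
    using compact_imp_bounded[OF compact_continuous_image[OF smooth_continuous_on[OF sm] compact_cball[of 0 1]]]
    unfolding bounded_iff by blast
  have B0: "0 \<le> B" using B[of 0] by (simp add: order_trans[OF abs_ge_zero])
  obtain B\<Phi> where "\<And>z. z \<in> cball 0 1 \<Longrightarrow> norm (\<phi> z) \<le> B\<Phi>"
    using compact_imp_bounded[OF compact_continuous_image[OF \<phi> compact_cball]] unfolding bounded_iff by blast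
  then have B\<Phi>: "norm (\<Phi> z) \<le> \<bar>B\<Phi>\<bar>" for z by (cases "z \<in> cball 0 1") (fastforce simp: \<Phi>_def)+
  obtain \<sigma>1 where \<sigma>1: "0 < \<sigma>1" "\<sigma>1 < 1" "measure \<nu> (\<D> - ball 0 \<sigma>1) < \<epsilon> / (B + 1)"
    using \<nu>_tail[of "\<epsilon> / (B + 1)"] \<epsilon>(1) B0 by (metis add_nonneg_pos divide_pos_pos zero_less_one)
  define \<sigma> where "\<sigma> = max \<sigma>0 \<sigma>1"
  have \<sigma>: "0 < \<sigma>" "\<sigma> < 1" "\<sigma>0 \<le> \<sigma>" "\<sigma>1 \<le> \<sigma>" using \<sigma>0 \<sigma>1 by (auto simp: \<sigma>_def)
  have limit_part: "\<bar>(LINT z|swept. \<Phi> z) - (LINT z|swept. h z)\<bar> \<le> \<epsilon> * m"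
  proof -
    interpret S: finite_measure swept by (rule finite_swept)
    have int: "integrable swept \<Phi>" "integrable swept h"
      using swept_integrable[of \<Phi> "\<bar>B\<Phi>\<bar>"] swept_integrable[of h B] B B\<Phi> by auto
    have "\<bar>(LINT z|swept. \<Phi> z) - (LINT z|swept. h z)\<bar> = \<bar>LINT z|swept. \<Phi> z - h z\<bar>"
      using int by simp
    also have "\<dots> \<le> (LINT z|swept. \<bar>\<Phi> z - h z\<bar>)" by (rule integral_abs_bound)
    also have "\<dots> \<le> (LINT z|swept. \<epsilon>)"
    proof (rule integral_mono_AE)
      show "AE z in swept. \<bar>\<Phi> z - h z\<bar> \<le> \<epsilon>"
        using AE_swept by (rule AE_mp) (use \<sigma>0 in \<open>auto simp: \<Phi>_def\<close>)
    qed (use int in auto)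
    also have "\<dots> = \<epsilon> * measure swept UNIV" by simp
    also have "measure swept UNIV = m"
      using swept_mass emeasure_Diff_null_set[of "- \<D>" \<nu> UNIV] null_\<nu>
      by (simp add: measure_def m_def null_sets_def Compl_eq_Diff_UNIV[symmetric])
    finally show ?thesis .
  qed
  show "\<forall>\<^sub>F r in at_left 0. dist (LINT z:cball 0 1|level_measure u r. \<phi> z) (LINT z:cball 0 1|swept. \<phi> z) < e"
    using eventually_sublevel[OF \<sigma>(2)]
  proof (rule eventually_mono)
    fix r assume r: "r < 0 \<and> cball 0 \<sigma> \<subseteq> sublevel u r"
    let ?\<mu> = "level_measure u r"
    note \<mu> = level_measure_properties[OF r[THEN conjunct1]]
    interpret \<mu>: finite_measure ?\<mu> by (rule \<mu>(2))
    have space: "space ?\<mu> = UNIV" using sets_eq_imp_space_eq[OF \<mu>(1)] by simp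
    have meas: "f \<in> borel_measurable ?\<mu>" if "f \<in> borel_measurable borel" for f :: "complex \<Rightarrow> real"
      using that \<mu>(1) by (simp cong: measurable_cong_sets)
    have AE1: "AE z in ?\<mu>. z \<in> \<D>"
      using \<mu>(3) by (intro AE_I'[of "- \<D>"]) (auto simp: null_sets_def \<mu>(1))
    have AE2: "AE z in ?\<mu>. z \<notin> ball 0 \<sigma>"
      using \<mu>(4)[OF \<sigma>(1) r[THEN conjunct2]] by (intro AE_I'[of "ball 0 \<sigma>"]) (auto simp: null_sets_def \<mu>(1))
    have ind_int: "integrable \<nu> (\<lambda>z. indicator (sublevel u r) z :: real)"
      using integrable_\<nu>_smooth[OF smooth_const[of 1], of "sublevel u r"] by simp
    have "measure ?\<mu> UNIV = (LINT z|?\<mu>. 1)" using space by simp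
    also have "\<dots> = (LINT z|\<nu>. 1 * indicator (sublevel u r) z)"
      by (rule \<mu>(5)[OF harmonic_poly_smooth harmonic_poly_laplacian]; rule harmonic_poly_const)
    also have "\<dots> \<le> (LINT z|\<nu>. 1)"
      using ind_int by (intro integral_mono) (auto simp: indicator_def)
    also have "\<dots> = m" by (simp add: m_def)
    finally have mass: "measure ?\<mu> UNIV \<le> m" .
    have int: "integrable ?\<mu> \<Phi>" "integrable ?\<mu> h"
    proof -
      show "integrable ?\<mu> \<Phi>"
        by (rule \<mu>.integrable_const_bound[of _ "\<bar>B\<Phi>\<bar>"]) (intro AE_I2 B\<Phi>, rule meas, measurable)
      show "integrable ?\<mu> h"
      proof (rule \<mu>.integrable_const_bound)
        show "AE z in ?\<mu>. norm (h z) \<le> B" using AE1 by (rule AE_mp) (use B in auto)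
      qed (intro meas, measurable)
    qed
    have "\<bar>(LINT z|?\<mu>. \<Phi> z) - (LINT z|?\<mu>. h z)\<bar> = \<bar>LINT z|?\<mu>. \<Phi> z - h z\<bar>" using int by simp
    also have "\<dots> \<le> (LINT z|?\<mu>. \<bar>\<Phi> z - h z\<bar>)" by (rule integral_abs_bound)
    also have "\<dots> \<le> (LINT z|?\<mu>. \<epsilon>)"
    proof (rule integral_mono_AE)
      show "AE z in ?\<mu>. \<bar>\<Phi> z - h z\<bar> \<le> \<epsilon>"
        using AE1 AE2
      proof (eventually_elim)
        case (elim z)
        then show ?case using \<sigma>0(3)[of z] \<sigma>(3) by (simp add: \<Phi>_def)
      qed
    qed (use int in auto)
    also have "\<dots> \<le> \<epsilon> * m" using mass \<epsilon>(1) space by (simp add: mult.commute mult_left_mono)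
    finally have part1: "\<bar>(LINT z|?\<mu>. \<Phi> z) - (LINT z|?\<mu>. h z)\<bar> \<le> \<epsilon> * m" .
    have int_h: "integrable \<nu> h" "integrable \<nu> (\<lambda>z. h z * indicator (sublevel u r) z)"
      using integrable_\<nu>_smooth[OF sm, of UNIV] integrable_\<nu>_smooth[OF sm, of "sublevel u r"] by auto
    have tail_int: "integrable \<nu> (\<lambda>z. B * indicator (\<D> - ball 0 \<sigma>1) z)"
      using integrable_\<nu>_smooth[OF smooth_const[of B], of "\<D> - ball 0 \<sigma>1"] by simp
    have "\<bar>(LINT z|?\<mu>. h z) - (LINT z|\<nu>. h z)\<bar> = \<bar>LINT z|\<nu>. h z * indicator (sublevel u r) z - h z\<bar>"
      using int_h by (simp add: \<mu>(5)[OF sm harmonic_poly_laplacian[OF h]])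
    also have "\<dots> \<le> (LINT z|\<nu>. \<bar>h z * indicator (sublevel u r) z - h z\<bar>)" by (rule integral_abs_bound)
    also have "\<dots> \<le> (LINT z|\<nu>. B * indicator (\<D> - ball 0 \<sigma>1) z)"
    proof (rule integral_mono_AE[OF _ tail_int])
      show "integrable \<nu> (\<lambda>z. \<bar>h z * indicator (sublevel u r) z - h z\<bar>)"
        using int_h by (intro integrable_abs Bochner_Integration.integrable_diff)
      show "AE z in \<nu>. \<bar>h z * indicator (sublevel u r) z - h z\<bar> \<le> B * indicator (\<D> - ball 0 \<sigma>1) z"
        using AE_\<nu>
      proof (eventually_elim)
        case (elim z)
        show ?case
        proof (cases "z \<in> sublevel u r")
          case False
          then have "z \<notin> cball 0 \<sigma>" using r by blast
          then have "z \<notin> ball 0 \<sigma>1" using \<sigma>(4) by auto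
          then show ?thesis using False elim B[of z] by simp
        qed (use B0 in auto)
      qed
    qed
    also have "\<dots> = B * measure \<nu> (\<D> - ball 0 \<sigma>1)" by simp
    also have "\<dots> \<le> B * (\<epsilon> / (B + 1))" using \<sigma>1(3) B0 by (intro mult_left_mono) auto
    also have "\<dots> \<le> \<epsilon>" using B0 \<epsilon>(1) by (simp add: field_simps)
    finally have part2: "\<bar>(LINT z|?\<mu>. h z) - (LINT z|\<nu>. h z)\<bar> \<le> \<epsilon>" .
    have "\<bar>(LINT z|?\<mu>. \<Phi> z) - (LINT z|swept. \<Phi> z)\<bar> \<le> \<epsilon> * m + \<epsilon> + \<epsilon> * m"
      using part1 part2 limit_part unfolding swept_harmonic_poly[OF h] by linarith
    also have "\<dots> < e" using \<epsilon>(2) by (simp add: algebra_simps)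
    finally show "dist (LINT z:cball 0 1|?\<mu>. \<phi> z) (LINT z:cball 0 1|swept. \<phi> z) < e"
      by (simp add: set_lebesgue_integral_def dist_real_def \<Phi>_def)
  qed
qed

lemma null_swept: "emeasure swept (- cball 0 1) = 0"
proof -
  have "(AE \<zeta> in swept. norm \<zeta> \<le> 1) \<longleftrightarrow> emeasure swept (- cball 0 1) = 0"
    by (rule AE_iff_measurable) auto
  moreover have "AE \<zeta> in swept. norm \<zeta> \<le> 1" using AE_swept by (rule AE_mp) simp
  ultimately show ?thesis by blast
qed

text \<open>
  The disc of radius 2 is an open neighbourhood of the closed disc, so test functions on it see the
  mass on the circle.
\<close>

lemma demailly_measure_eq: "demailly_measure u = swept"
  unfolding demailly_measure_def
proof (rule the_equality)
  show "sets swept = sets borel \<and> finite_measure swept \<and> emeasure swept (- cball 0 1) = 0 \<and>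
      weak_star_limit (level_measure u) swept (at_left 0)"
    using finite_swept null_swept weak_star_limit_swept by simp
  fix \<mu> assume \<mu>: "sets \<mu> = sets borel \<and> finite_measure \<mu> \<and> emeasure \<mu> (- cball 0 1) = 0 \<and>
    weak_star_limit (level_measure u) \<mu> (at_left 0)"
  have null2: "emeasure L (- ball 0 2) = 0" "(LINT z|L. \<phi> z) = (LINT z:cball 0 1|L. \<phi> z)"
    if L: "sets L = sets borel" "emeasure L (- cball 0 1) = 0" and \<phi>: "smooth \<phi>" for L and \<phi> :: "complex \<Rightarrow> real"
  proof -
    have "emeasure L (- ball 0 2) \<le> emeasure L (- cball 0 1)"
      by (rule emeasure_mono) (use L in auto)
    then show "emeasure L (- ball 0 2) = 0" using L(2) by simp
    have meas: "f \<in> borel_measurable L" if "f \<in> borel_measurable borel" for f :: "complex \<Rightarrow> real"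
      using that L(1) by (simp cong: measurable_cong_sets)
    note [measurable] = smooth_borel_measurable[OF \<phi>]
    show "(LINT z|L. \<phi> z) = (LINT z:cball 0 1|L. \<phi> z)"
      unfolding set_lebesgue_integral_def
    proof (rule integral_cong_AE)
      show "AE z in L. \<phi> z = indicator (cball 0 1) z *\<^sub>R \<phi> z"
        using L by (intro AE_I'[of "- cball 0 1"]) (auto simp: null_sets_def indicator_def)
      show "\<phi> \<in> borel_measurable L" by (rule meas) measurable
      show "(\<lambda>z. indicator (cball 0 1) z *\<^sub>R \<phi> z) \<in> borel_measurable L"
        by (intro meas borel_measurable_continuous_on_indicator smooth_continuous_on \<phi>) simp
    qed
  qed
  show "\<mu> = swept"
  proof (rule measure_eqI_test_functions[of _ _ 2])
    fix \<phi> assume "test_function (ball 0 2) \<phi>"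
    note sm = test_function_smooth[OF this]
    note cont = smooth_continuous_on[OF sm, of "cball 0 1"]
    have "((\<lambda>r. LINT z:cball 0 1|level_measure u r. \<phi> z) \<longlongrightarrow> (LINT z:cball 0 1|\<mu>. \<phi> z)) (at_left 0)"
      "((\<lambda>r. LINT z:cball 0 1|level_measure u r. \<phi> z) \<longlongrightarrow> (LINT z:cball 0 1|swept. \<phi> z)) (at_left 0)"
      using \<mu> weak_star_limit_swept cont unfolding weak_star_limit_def by blast+
    then have "(LINT z:cball 0 1|\<mu>. \<phi> z) = (LINT z:cball 0 1|swept. \<phi> z)"
      by (rule tendsto_unique[rotated]) simp
    then show "(LINT z|\<mu>. \<phi> z) = (LINT z|swept. \<phi> z)"
      using null2(2)[OF _ _ sm] \<mu> null_swept sets_swept by metis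
  next
    show "emeasure \<mu> K < \<infinity>" for K
      using \<mu> finite_measure.emeasure_finite[of \<mu> K] by (auto simp: less_top)
    show "emeasure swept K < \<infinity>" for K
      using finite_measure.emeasure_finite[OF finite_swept, of K] by (simp add: less_top)
    show "emeasure \<mu> (- ball 0 2) = 0" "emeasure swept (- ball 0 2) = 0"
      using null2(1)[OF _ _ smooth_const[of 0]] \<mu> null_swept sets_swept by metis+
  qed (use \<mu> in auto)
qed

end

section \<open>Positive mass, lower bound and lower semicontinuity\<close>

lemma circle_avg_mono:
  assumes "v \<in> borel_measurable borel" "w \<in> borel_measurable borel"
    "\<And>\<zeta>. norm \<zeta> = 1 \<Longrightarrow> v (z + of_real h * \<zeta>) \<le> w (z + of_real h * \<zeta>)"
    "\<And>\<zeta>. norm \<zeta> = 1 \<Longrightarrow> \<bar>v (z + of_real h * \<zeta>)\<bar> \<le> B" "\<And>\<zeta>. norm \<zeta> = 1 \<Longrightarrow> \<bar>w (z + of_real h * \<zeta>)\<bar> \<le> C"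
  shows "circle_avg v z h \<le> circle_avg w z h"
  unfolding circle_avg_def
proof (rule integral_mono_AE)
  note [measurable] = assms(1,2)
  show "integrable circle_measure (\<lambda>\<zeta>. v (z + of_real h * \<zeta>))"
    by (rule circle_integrable_bounded[where B = B]) (measurable, simp add: assms(4))
  show "integrable circle_measure (\<lambda>\<zeta>. w (z + of_real h * \<zeta>))"
    by (rule circle_integrable_bounded[where B = C]) (measurable, simp add: assms(5))
  show "AE \<zeta> in circle_measure. v (z + of_real h * \<zeta>) \<le> w (z + of_real h * \<zeta>)"
    using AE_circle by (rule AE_mp) (intro AE_I2 impI assms(3))
qed

lemma circle_avg_quadratic:
  "circle_avg (\<lambda>z. a + \<kappa> * (norm z)\<^sup>2) z h = a + \<kappa> * (norm z)\<^sup>2 + \<kappa> * h\<^sup>2"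
proof -
  have int: "integrable circle_measure (\<lambda>\<zeta>. Re \<zeta>)" "integrable circle_measure (\<lambda>\<zeta>. Im \<zeta>)"
  proof -
    have le: "norm (Re \<zeta>) \<le> 1" "norm (Im \<zeta>) \<le> 1" if "norm \<zeta> = 1" for \<zeta>
      using abs_Re_le_cmod[of \<zeta>] abs_Im_le_cmod[of \<zeta>] that by simp_all
    show "integrable circle_measure (\<lambda>\<zeta>. Re \<zeta>)" by (rule circle_integrable_bounded[OF _ le(1)]) simp_all
    show "integrable circle_measure (\<lambda>\<zeta>. Im \<zeta>)" by (rule circle_integrable_bounded[OF _ le(2)]) simp_all
  qed
  have "circle_avg (\<lambda>z. a + \<kappa> * (norm z)\<^sup>2) z h =
      (LINT \<zeta>|circle_measure. (a + \<kappa> * (norm z)\<^sup>2 + \<kappa> * h\<^sup>2) + 2 * \<kappa> * h * (Re z * Re \<zeta> + Im z * Im \<zeta>))"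
    unfolding circle_avg_def
  proof (rule circle_integral_cong)
    fix \<zeta> :: complex assume "norm \<zeta> = 1"
    then have "(Re \<zeta>)\<^sup>2 + (Im \<zeta>)\<^sup>2 = 1" by (simp flip: cmod_power2)
    then have "h\<^sup>2 * ((Re \<zeta>)\<^sup>2 + (Im \<zeta>)\<^sup>2) = h\<^sup>2" by simp
    then have "(norm (z + of_real h * \<zeta>))\<^sup>2 = (norm z)\<^sup>2 + h\<^sup>2 + 2 * h * (Re z * Re \<zeta> + Im z * Im \<zeta>)"
      unfolding cmod_power2 by (simp add: power2_eq_square algebra_simps)
    then show "a + \<kappa> * (norm (z + of_real h * \<zeta>))\<^sup>2 =
        (a + \<kappa> * (norm z)\<^sup>2 + \<kappa> * h\<^sup>2) + 2 * \<kappa> * h * (Re z * Re \<zeta> + Im z * Im \<zeta>)"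
      by (simp add: algebra_simps)
  qed measurable
  also have "\<dots> = a + \<kappa> * (norm z)\<^sup>2 + \<kappa> * h\<^sup>2"
    using int circle.prob_space by (simp add: circle_real_moments)
  finally show ?thesis .
qed

lemma smooth_integral_pos:
  assumes "smooth \<eta>" "integrable lborel \<eta>" "\<And>z. 0 \<le> \<eta> z" "0 < \<eta> a"
  shows "0 < (LINT z|lborel. \<eta> z)"
proof (rule ccontr)
  assume "\<not> ?thesis"
  then have zero: "(LINT z|lborel. \<eta> z) = 0"
    using Bochner_Integration.integral_nonneg[of lborel \<eta>, OF assms(3)] by simp
  have op: "open {z. 0 < \<eta> z}"
    by (intro open_Collect_less continuous_intros smooth_continuous_on assms(1))
  have "emeasure lborel {z. 0 < \<eta> z} = 0"
    using null_set_positivity[OF assms(2,3) zero] borel_open[OF op] by simp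
  then have "{z. 0 < \<eta> z} \<in> null_sets lebesgue"
    using borel_open[OF op] by (intro null_sets_completionI) (simp add: null_sets_def)
  then have "negligible {z. 0 < \<eta> z}" by (simp add: negligible_iff_null_sets)
  then show False using open_not_negligible[OF op] assms(4) by auto
qed

context exhaustion
begin

text \<open>
  Suppose \<open>\<nu> = 0\<close>. Raise \<open>u\<close> to \<open>w = max(u, q)\<close>, where \<open>q\<close> is a multiple of \<open>|z|\<^sup>2\<close> plus a constant, chosen so
  that \<open>q\<close> exceeds \<open>u\<close> near the origin and lies below \<open>u\<close> near the circle. The total mass of the
  Laplacian is read off from a cutoff, hence from values near the circle, and is still 0. But \<open>w\<close> is
  subharmonic and equals \<open>q\<close> near the origin, where it has a positive Laplacian.
\<close>

lemma mass_pos: "0 < emeasure \<nu> \<D>"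
proof (rule ccontr)
  assume "\<not> ?thesis"
  then have "emeasure \<nu> \<D> = 0" by simp
  then have "\<D> \<in> null_sets \<nu>" by (simp add: null_sets_def)
  have AE_False: "AE z in \<nu>. False"
    using AE_not_in[OF \<open>\<D> \<in> null_sets \<nu>\<close>] AE_\<nu> by eventually_elim auto
  have "u 0 < 0" by (rule u_neg) simp
  then obtain s where s: "u 0 < ereal s" "ereal s < 0" using ereal_dense2 by blast
  then have s_neg: "s < 0" by (simp add: zero_ereal_def)
  define \<kappa> where "\<kappa> = - s / 4"
  (* With u 0 < s < 0 the values of q on the disc lie between 3 s / 4 and s / 2. *)
  define q where "q z = 3 * s / 4 + \<kappa> * (norm z)\<^sup>2" for z :: complex
  define w where "w z = (if z \<in> \<D> then max (trunc s z) (q z) else 0)" for z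
  have \<kappa>: "0 < \<kappa>" using s_neg by (simp add: \<kappa>_def)
  have q_bounds: "3 * s / 4 \<le> q z" "q z \<le> s / 2" if "norm z \<le> 1" for z
  proof -
    show "3 * s / 4 \<le> q z" using \<kappa> by (simp add: q_def)
    have "\<kappa> * (norm z)\<^sup>2 \<le> \<kappa> * 1" using that \<kappa> by (intro mult_left_mono power_le_one) auto
    then show "q z \<le> s / 2" by (simp add: q_def \<kappa>_def)
  qed
  have [measurable]: "q \<in> borel_measurable borel" unfolding q_def by measurable
  have [measurable]: "w \<in> borel_measurable borel" unfolding w_def by measurable
  have w_bound: "\<bar>w z\<bar> \<le> \<bar>s\<bar>" for z
  proof (cases "z \<in> \<D>")
    case True
    then have z: "norm z \<le> 1" by simp
    show ?thesis
      using True trunc_bounds[of s z] q_bounds[OF z] s_neg by (auto simp: w_def max_def abs_le_iff)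
  qed (simp add: w_def)
  have w_sub: "w z \<le> circle_avg w z h" and w_sub_q: "q z + \<kappa> * h\<^sup>2 \<le> circle_avg w z h"
    if h: "0 < h" "cball z h \<subseteq> \<D>" for z h
  proof -
    have in_D: "z + of_real h * \<zeta> \<in> \<D>" if "norm \<zeta> = 1" for \<zeta>
    proof -
      have "z + of_real h * \<zeta> \<in> cball z h" using h(1) that by (simp add: dist_norm norm_mult)
      with h(2) show ?thesis by blast
    qed
    have "z \<in> \<D>" using h by (auto simp: subset_iff)
    have "circle_avg (trunc s) z h \<le> circle_avg w z h"
    proof (rule circle_avg_mono[where B = "\<bar>s\<bar>" and C = "\<bar>s\<bar>"])
      show "trunc s (z + of_real h * \<zeta>) \<le> w (z + of_real h * \<zeta>)" if "norm \<zeta> = 1" for \<zeta>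
        using in_D[OF that] by (simp add: w_def)
      show "\<bar>trunc s (z + of_real h * \<zeta>)\<bar> \<le> \<bar>s\<bar>" for \<zeta>
        using s_neg by (intro trunc_bounds) simp
      show "\<bar>w (z + of_real h * \<zeta>)\<bar> \<le> \<bar>s\<bar>" for \<zeta> by (rule w_bound)
    qed measurable
    then have 1: "trunc s z \<le> circle_avg w z h"
      using trunc_submean[OF h, of s] s_neg by linarith
    have q_abs: "\<bar>q y\<bar> \<le> \<bar>s\<bar>" if "y \<in> \<D>" for y
    proof -
      have "norm y \<le> 1" using that by simp
      from q_bounds[OF this] show ?thesis using s_neg by (simp add: abs_le_iff)
    qed
    have "circle_avg q z h \<le> circle_avg w z h"
    proof (rule circle_avg_mono[where B = "\<bar>s\<bar>" and C = "\<bar>s\<bar>"])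
      show "q (z + of_real h * \<zeta>) \<le> w (z + of_real h * \<zeta>)" if "norm \<zeta> = 1" for \<zeta>
        using in_D[OF that] by (simp add: w_def)
      show "\<bar>q (z + of_real h * \<zeta>)\<bar> \<le> \<bar>s\<bar>" if "norm \<zeta> = 1" for \<zeta>
        by (rule q_abs[OF in_D[OF that]])
      show "\<bar>w (z + of_real h * \<zeta>)\<bar> \<le> \<bar>s\<bar>" for \<zeta> by (rule w_bound)
    qed measurable
    then show 2: "q z + \<kappa> * h\<^sup>2 \<le> circle_avg w z h"
      unfolding q_def[abs_def] circle_avg_quadratic .
    have "0 \<le> \<kappa> * h\<^sup>2" using \<kappa> by simp
    with 1 2 \<open>z \<in> \<D>\<close> show "w z \<le> circle_avg w z h" by (simp add: w_def)
  qed
  obtain \<rho> where \<rho>: "0 < \<rho>" "\<rho> < 1" "\<And>z. z \<in> \<D> \<Longrightarrow> \<rho> \<le> norm z \<Longrightarrow> ereal (s / 2) < u z"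
    using boundary_layer[of "s / 2"] s_neg by (metis divide_neg_pos zero_less_numeral)
  define \<rho>1 \<rho>2 where "\<rho>1 = (2 * \<rho> + 1) / 3" and "\<rho>2 = (\<rho> + 2) / 3"
  have \<rho>12: "\<rho> < \<rho>1" "\<rho>1 < \<rho>2" "\<rho>2 < 1" "0 \<le> \<rho>1" "0 < \<rho>1" using \<rho> by (auto simp: \<rho>1_def \<rho>2_def)
  obtain \<psi> where \<psi>: "smooth \<psi>" "\<And>z. 0 \<le> \<psi> z" "\<And>z. \<psi> z \<le> 1"
      "\<And>z. norm z \<le> \<rho>1 \<Longrightarrow> \<psi> z = 1" "\<And>z. norm z \<ge> \<rho>2 \<Longrightarrow> \<psi> z = 0"
    using radial_cutoff[OF \<rho>12(4,2)] by blast
  have t\<psi>: "test_function \<D> \<psi>"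
  proof (rule test_functionI[of _ "cball 0 \<rho>2"])
    show "z \<in> cball 0 \<rho>2" if "\<psi> z \<noteq> 0" for z
      using that \<psi>(5)[of z] by (cases "\<rho>2 \<le> norm z") auto
  qed (use \<rho>12 \<psi>(1) in auto)
  define U where "U = ball 0 \<rho>1 \<inter> sublevel u (3 * s / 4)"
  have "open U" unfolding U_def using open_sublevel by (intro open_Int) auto
  moreover have "{0} \<subseteq> U"
  proof -
    have "ereal s < ereal (3 * s / 4)" using s_neg by simp
    with s(1) have "u 0 < ereal (3 * s / 4)" by (rule less_trans)
    then show ?thesis using \<rho>12(5) by (simp add: U_def sublevel_def)
  qed
  moreover have "compact {0 :: complex}" by simp
  ultimately obtain \<eta> K' where \<eta>: "smooth \<eta>" "\<And>z. 0 \<le> \<eta> z" "\<And>z. \<eta> z \<le> 1" "\<eta> 0 = 1"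
    and K': "compact K'" "K' \<subseteq> U" "\<And>z. z \<notin> K' \<Longrightarrow> \<eta> z = 0"
    using smooth_urysohn[of "{0}" U] by (metis singletonI)
  have t\<eta>: "test_function U \<eta>"
    by (rule test_functionI[of _ K']) (use K' \<eta>(1) compact_imp_closed in auto)
  have U_D: "U \<subseteq> \<D>" by (auto simp: U_def sublevel_def)
  have t\<eta>_D: "test_function \<D> \<eta>" by (rule test_function_mono[OF t\<eta> U_D])
  have t\<psi>\<eta>: "test_function \<D> (\<lambda>z. \<psi> z + (-1) * \<eta> z)"
    by (intro test_function_add t\<psi> test_function_cmult t\<eta>_D)
  have disc: "cball z h \<subseteq> \<D>" if "norm z \<le> \<rho>2" "h < 1 - \<rho>2" for z h
    using that by (auto simp: cball_subset_ball_iff)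
  have near: "norm z \<le> \<rho>2" if "\<eta> z \<noteq> 0 \<or> \<psi> z \<noteq> 0" for z
  proof (cases "\<eta> z \<noteq> 0")
    case True
    then have "z \<in> U" using K' by blast
    then show ?thesis using \<rho>12 by (simp add: U_def)
  next
    case False
    then show ?thesis using that \<psi>(5)[of z] by (cases "\<rho>2 \<le> norm z") auto
  qed
  have part1: "4 * \<kappa> * (LINT z|lborel. \<eta> z) \<le> (LINT z|lborel. w z * classical_laplacian \<eta> z)"
  proof (rule laplacian_lower_bound[where B = "\<bar>s\<bar>" and ?h0.0 = "1 - \<rho>2"])
    show "test_function UNIV \<eta>" by (rule test_function_mono[OF t\<eta>]) simp
    show "w z + \<kappa> * h\<^sup>2 \<le> circle_avg w z h" if "\<eta> z \<noteq> 0" "0 < h" "h < 1 - \<rho>2" for z h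
    proof -
      have z: "z \<in> U" using that(1) K' by blast
      then have "ereal (trunc s z) \<le> ereal (3 * s / 4)"
        using s_neg U_D by (subst ereal_trunc) (auto simp: U_def sublevel_def)
      then have "w z = q z"
        using q_bounds(1)[of z] z U_D by (auto simp: w_def)
      then show ?thesis using w_sub_q[OF that(2) disc[OF near that(3)]] that(1) by simp
    qed
  qed (use w_bound \<eta> \<rho>12 in auto)
  have part2: "4 * 0 * (LINT z|lborel. \<psi> z + (-1) * \<eta> z) \<le>
      (LINT z|lborel. w z * classical_laplacian (\<lambda>z. \<psi> z + (-1) * \<eta> z) z)"
  proof (rule laplacian_lower_bound[where B = "\<bar>s\<bar>" and ?h0.0 = "1 - \<rho>2"])
    show "test_function UNIV (\<lambda>z. \<psi> z + (-1) * \<eta> z)" by (rule test_function_mono[OF t\<psi>\<eta>]) simp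
    show "0 \<le> \<psi> z + (-1) * \<eta> z" for z
    proof (cases "z \<in> K'")
      case True
      then have "\<psi> z = 1" using K'(2) by (intro \<psi>(4)) (auto simp: U_def)
      then show ?thesis using \<eta>(3)[of z] by simp
    qed (use \<psi>(2) K'(3) in simp)
    show "w z + 0 * h\<^sup>2 \<le> circle_avg w z h" if "\<psi> z + (-1) * \<eta> z \<noteq> 0" "0 < h" "h < 1 - \<rho>2" for z h
    proof -
      have "norm z \<le> \<rho>2" using that(1) by (intro near) auto
      from w_sub[OF that(2) disc[OF this that(3)]] show ?thesis by simp
    qed
  qed (use w_bound \<rho>12 in auto)
  have int: "integrable lborel (\<lambda>z. w z * classical_laplacian \<phi> z)" if t: "test_function \<D> \<phi>" for \<phi>
  proof -
    have "integrable lborel (\<lambda>z. \<bar>s\<bar> * classical_laplacian \<phi> z)"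
      using trunc_laplacian_integrable(2)[OF t, of 0] by simp
    then show ?thesis
    proof (rule Bochner_Integration.integrable_bound)
      note [measurable] = smooth_borel_measurable[OF smooth_classical_laplacian[OF test_function_smooth[OF t]]]
      show "(\<lambda>z. w z * classical_laplacian \<phi> z) \<in> borel_measurable lborel" by measurable
      show "AE z in lborel. norm (w z * classical_laplacian \<phi> z) \<le> norm (\<bar>s\<bar> * classical_laplacian \<phi> z)"
        using w_bound by (intro AE_I2) (simp add: abs_mult mult_right_mono)
    qed
  qed
  have "(LINT z|lborel. w z * classical_laplacian \<psi> z) = pairing s \<psi>"
    unfolding pairing_def
  proof (rule Bochner_Integration.integral_cong[OF refl])
    fix z
    show "w z * classical_laplacian \<psi> z = trunc s z * classical_laplacian \<psi> z"
    proof (cases "z \<in> \<D> \<and> \<rho> \<le> norm z")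
      case True
      have "ereal (q z) \<le> ereal (s / 2)" using q_bounds(2)[of z] True by simp
      also have "\<dots> < u z" using \<rho>(3) True by blast
      also have "\<dots> \<le> ereal (trunc s z)" using True by (subst ereal_trunc) auto
      finally have "w z = trunc s z" using True by (simp add: w_def max_def)
      then show ?thesis by simp
    next
      case False
      then consider "z \<notin> \<D>" | "norm z < \<rho>1" using \<rho>12 by fastforce
      then show ?thesis
      proof cases
        case 2
        then have "classical_laplacian \<psi> z = classical_laplacian (\<lambda>z. 1) z"
          by (intro classical_laplacian_local[of "ball 0 \<rho>1"]) (auto simp: \<psi>(4))
        then show ?thesis using harmonic_poly_laplacian[OF harmonic_poly_const[of 1]] by simp
      qed (simp add: w_def trunc_def)
    qed
  qed
  also have "\<dots> = 2 * pi * (LINT z|\<nu>. \<psi> z)"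
  proof (rule pairing_eq_\<nu>[OF t\<psi>])
    fix z assume z: "z \<in> \<D>" "classical_laplacian \<psi> z \<noteq> 0"
    have "\<rho>1 \<le> norm z"
    proof (rule ccontr)
      assume "\<not> ?thesis"
      then have "classical_laplacian \<psi> z = classical_laplacian (\<lambda>z. 1) z"
        by (intro classical_laplacian_local[of "ball 0 \<rho>1"]) (auto simp: \<psi>(4))
      with z(2) harmonic_poly_laplacian[OF harmonic_poly_const[of 1]] show False by simp
    qed
    then have "ereal (s / 2) < u z" using \<rho>(3)[OF z(1)] \<rho>12 by simp
    moreover have "ereal s < ereal (s / 2)" using s_neg by simp
    ultimately show "ereal s < u z" by (rule less_trans[rotated])
  qed
  also have "(LINT z|\<nu>. \<psi> z) = (LINT z|\<nu>. 0)"
  proof (rule integral_cong_AE)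
    show "\<psi> \<in> borel_measurable \<nu>" using smooth_borel_measurable[OF \<psi>(1)] by simp
    show "AE z in \<nu>. \<psi> z = 0" using AE_False by eventually_elim simp
  qed simp
  finally have zero: "(LINT z|lborel. w z * classical_laplacian \<psi> z) = 0" by simp
  have "(LINT z|lborel. w z * classical_laplacian (\<lambda>z. \<psi> z + (-1) * \<eta> z) z) =
      (LINT z|lborel. w z * classical_laplacian \<psi> z + (-1) * (w z * classical_laplacian \<eta> z))"
    by (simp only: classical_laplacian_add[OF \<psi>(1) smooth_cmult[OF \<eta>(1)]] classical_laplacian_cmult[OF \<eta>(1)]
        distrib_left mult.left_commute)
  also have "\<dots> = 0 - (LINT z|lborel. w z * classical_laplacian \<eta> z)"
    using int[OF t\<psi>] int[OF t\<eta>_D] zero by simp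
  finally have "(LINT z|lborel. w z * classical_laplacian \<eta> z) \<le> 0" using part2 by simp
  with part1 have "4 * \<kappa> * (LINT z|lborel. \<eta> z) \<le> 0" by linarith
  moreover have "0 < (LINT z|lborel. \<eta> z)"
  proof (rule smooth_integral_pos[OF \<eta>(1) _ \<eta>(2)])
    show "integrable lborel \<eta>"
      using \<eta> K' by (intro integrable_compact_support[of \<eta> K' 1] smooth_borel_measurable) auto
    show "0 < \<eta> 0" using \<eta>(4) by simp
  qed
  ultimately show False using \<kappa> by (simp add: mult_le_0_iff)
qed

lemma poisson_sweep_lower_bound: "\<exists>c::real. 0 < c \<and> (\<forall>\<zeta>\<in>\<T>. ennreal c \<le> poisson_sweep \<nu> \<zeta>)"
proof -
  define I where "I = (\<integral>\<^sup>+z\<in>\<D>. ennreal ((1 - norm z) / 2) \<partial>\<nu>)"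
  have "I \<le> (\<integral>\<^sup>+z. indicator \<D> z \<partial>\<nu>)"
    unfolding I_def by (intro nn_integral_mono) (auto simp: indicator_def ennreal_le_1 intro: order_trans[OF _ norm_ge_zero])
  also have "\<dots> < \<infinity>" using finite_mass by simp
  finally have fin: "I < \<infinity>" .
  have "I \<noteq> 0"
  proof
    assume "I = 0"
    then have "AE z in \<nu>. ennreal ((1 - norm z) / 2) * indicator \<D> z = 0"
      unfolding I_def by (subst (asm) nn_integral_0_iff_AE) auto
    then have "AE z in \<nu>. z \<notin> \<D>" by (rule AE_mp) (auto simp: indicator_def)
    then have "emeasure \<nu> \<D> = 0"
      by (subst (asm) AE_iff_measurable[of \<D>]) auto
    with mass_pos show False by simp
  qed
  moreover have "I \<le> poisson_sweep \<nu> \<zeta>" if "\<zeta> \<in> \<T>" for \<zeta>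
    unfolding I_def poisson_sweep_def
  proof (rule nn_integral_mono)
    fix z
    show "ennreal ((1 - norm z) / 2) * indicator \<D> z \<le> ennreal (poisson_kernel z \<zeta>) * indicator \<D> z"
      using poisson_kernel_bounds(2)[of z \<zeta>] that by (cases "z \<in> \<D>") (auto intro!: ennreal_leI)
  qed
  moreover have "ennreal (enn2real I) = I" using fin by (simp add: less_top)
  moreover have "0 < enn2real I" using fin \<open>I \<noteq> 0\<close> by (simp add: enn2real_positive_iff less_top zero_less_iff_neq_zero)
  ultimately show ?thesis by (intro exI[of _ "enn2real I"]) simp
qed

text \<open>
  For fixed \<open>z\<close> in the disc the Poisson kernel is continuous on the circle, and Fatou's lemma applies
  to the integral over \<open>\<nu>\<close>.
\<close>

lemma poisson_sweep_lsc: "lower_semicontinuous_on \<T> (poisson_sweep \<nu>)"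
  unfolding lower_semicontinuous_on_def
proof
  fix t
  define F where "F = {x \<in> \<T>. poisson_sweep \<nu> x \<le> t}"
  have "closed F"
    unfolding closed_sequential_limits
  proof (intro allI impI)
    fix x l assume xl: "(\<forall>n. x n \<in> F) \<and> x \<longlonglongrightarrow> l"
    then have x: "\<And>n. norm (x n) = 1" "\<And>n. poisson_sweep \<nu> (x n) \<le> t" by (auto simp: F_def)
    have "l \<in> \<T>" by (rule closed_sequentially[of \<T> x]) (use xl x in auto)
    then have l: "norm l = 1" by simp
    have lim: "(\<lambda>n. ennreal (poisson_kernel z (x n)) * indicator \<D> z) \<longlonglongrightarrow> ennreal (poisson_kernel z l) * indicator \<D> z" for z
    proof (cases "z \<in> \<D>")
      case True
      then have "l \<noteq> z" using l by auto
      then have "(\<lambda>n. poisson_kernel z (x n)) \<longlonglongrightarrow> poisson_kernel z l"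
        unfolding poisson_kernel_def using xl by (intro tendsto_intros) auto
      then show ?thesis using True by (simp add: tendsto_ennrealI)
    qed simp
    have "poisson_sweep \<nu> l = (\<integral>\<^sup>+z. liminf (\<lambda>n. ennreal (poisson_kernel z (x n)) * indicator \<D> z) \<partial>\<nu>)"
      unfolding poisson_sweep_def
      by (intro nn_integral_cong lim_imp_Liminf[symmetric] lim) simp
    also have "\<dots> \<le> liminf (\<lambda>n. poisson_sweep \<nu> (x n))"
      unfolding poisson_sweep_def by (rule nn_integral_liminf) measurable
    also have "\<dots> \<le> liminf (\<lambda>n. t)" using x(2) by (intro Liminf_mono always_eventually) auto
    also have "\<dots> = t" by (simp add: Liminf_const)
    finally show "l \<in> F" using \<open>l \<in> \<T>\<close> by (simp add: F_def)
  qed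
  then have "openin (top_of_set \<T>) (\<T> \<inter> - F)" by (intro openin_open_Int open_Compl)
  moreover have "\<T> \<inter> - F = {x \<in> \<T>. t < poisson_sweep \<nu> x}" by (auto simp: F_def)
  ultimately show "openin (top_of_set \<T>) {x \<in> \<T>. t < poisson_sweep \<nu> x}" by simp
qed

end

section \<open>An example with unbounded density\<close>

text \<open>
  \<open>1 - |b|\<^sup>2\<close> for the disc automorphism \<open>b(z) = (z - t) / (1 - t z)\<close>: a positive superharmonic function
  that vanishes on the circle.
\<close>

definition moebius_gap :: "real \<Rightarrow> complex \<Rightarrow> real"
  where "moebius_gap t z = (1 - t\<^sup>2) * (1 - (norm z)\<^sup>2) / (norm (1 - of_real t * z))\<^sup>2"

text \<open>
  The mean of \<^const>\<open>moebius_gap\<close> over the circle of radius \<open>h\<close> at \<open>z\<close> falls short of its value at \<open>z\<close> by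
  exactly \<open>h\<^sup>2\<close> times this number. For \<open>h = 0\<close> it is \<open>|b'(z)|\<^sup>2\<close>, a quarter of the Laplacian of \<open>|b|\<^sup>2\<close>.
\<close>

definition gap_laplacian :: "real \<Rightarrow> complex \<Rightarrow> real \<Rightarrow> real"
  where "gap_laplacian t z h = (1 - t\<^sup>2)\<^sup>2 /
    ((norm (1 - of_real t * z))\<^sup>2 * ((norm (1 - of_real t * z))\<^sup>2 - t\<^sup>2 * h\<^sup>2))"

lemma moebius_gap_measurable [measurable]: "moebius_gap t \<in> borel_measurable borel"
  unfolding moebius_gap_def by measurable

lemma gap_laplacian_measurable [measurable]: "(\<lambda>z. gap_laplacian t z h) \<in> borel_measurable borel"
  unfolding gap_laplacian_def by measurable

context
  fixes t :: real and z :: complex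
  assumes t: "0 \<le> t" "t < 1" and z: "norm z < 1"
begin

lemma moebius_denominator:
  "1 - norm z \<le> norm (1 - of_real t * z)" "1 - t \<le> norm (1 - of_real t * z)"
  "norm (1 - z) \<le> 2 * norm (1 - of_real t * z)" "0 < norm (1 - of_real t * z)"
  "1 - t * norm z \<le> norm (1 - of_real t * z)"
proof -
  show 1: "1 - t * norm z \<le> norm (1 - of_real t * z)"
    using norm_triangle_ineq2[of 1 "of_real t * z"] t by (simp add: norm_mult)
  have "t * norm z \<le> t" "t * norm z \<le> norm z" using t z by (simp_all add: mult_left_le mult_left_le_one_le)
  with 1 show 2: "1 - norm z \<le> norm (1 - of_real t * z)" and 3: "1 - t \<le> norm (1 - of_real t * z)"
    by linarith+
  show "0 < norm (1 - of_real t * z)" using 3 t by linarith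
  have split: "1 - z = (1 - of_real t * z) - of_real (1 - t) * z" by (simp add: algebra_simps)
  have "norm (1 - z) \<le> norm (1 - of_real t * z) + norm (of_real (1 - t) * z)"
    by (subst split) (rule norm_triangle_ineq4)
  also have "norm (of_real (1 - t) * z) = (1 - t) * norm z" using t by (simp only: norm_mult norm_of_real)
  also have "\<dots> \<le> 1 - t" using t z by (simp add: mult_left_le)
  finally show "norm (1 - z) \<le> 2 * norm (1 - of_real t * z)" using 3 by linarith
qed

lemma moebius_gap_eq: "moebius_gap t z = 1 - (norm ((z - of_real t) / (1 - of_real t * z)))\<^sup>2"
proof -
  have "(norm (1 - of_real t * z))\<^sup>2 - (norm (z - of_real t))\<^sup>2 = (1 - t\<^sup>2) * (1 - (norm z)\<^sup>2)"
    unfolding cmod_power2 by (simp add: power2_eq_square algebra_simps)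
  then show ?thesis
    using moebius_denominator(4) unfolding moebius_gap_def norm_divide power_divide
    by (simp add: field_simps)
qed

lemma moebius_gap_bounds:
  "0 < moebius_gap t z" "moebius_gap t z \<le> 1" "moebius_gap t z \<le> 4 * (1 - norm z) / (1 - t)"
proof -
  have t2: "t\<^sup>2 < 1" "(norm z)\<^sup>2 < 1" using t z by (simp_all add: power_less_one_iff abs_square_less_1)
  show "0 < moebius_gap t z"
    unfolding moebius_gap_def using t2 moebius_denominator(4) by (intro divide_pos_pos mult_pos_pos) auto
  show "moebius_gap t z \<le> 1" unfolding moebius_gap_eq by simp
  have a: "1 - t\<^sup>2 \<le> 2 * (1 - t)" "1 - (norm z)\<^sup>2 \<le> 2 * (1 - norm z)"
    using zero_le_power2[of "1 - t"] zero_le_power2[of "1 - norm z"]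
    by (simp_all add: power2_eq_square algebra_simps)
  have "moebius_gap t z \<le> (2 * (1 - t)) * (2 * (1 - norm z)) / (1 - t)\<^sup>2"
    unfolding moebius_gap_def using a t2 t z moebius_denominator(2)
    by (intro frac_le mult_mono power_mono) auto
  also have "\<dots> = 4 * (1 - norm z) / (1 - t)"
  proof -
    have "(2 * r) * (2 * x) / r\<^sup>2 = 4 * x / r" for r x :: real by (simp add: power2_eq_square)
    then show ?thesis .
  qed
  finally show "moebius_gap t z \<le> 4 * (1 - norm z) / (1 - t)" .
qed

text \<open>
  The gap is at most 1 and at most \<open>4 (1 - |z|) / (1 - t)\<close>, hence at most the square root of the latter.
  This sacrifices decay in \<open>1 - |z|\<close> for a milder singularity in \<open>1 - t\<close>, which a series can absorb.
\<close>

lemma moebius_gap_sqrt: "moebius_gap t z \<le> 2 * sqrt (1 - norm z) / sqrt (1 - t)"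
proof -
  have "(moebius_gap t z)\<^sup>2 \<le> moebius_gap t z * 1"
    unfolding power2_eq_square using moebius_gap_bounds by (intro mult_left_mono) auto
  also have "\<dots> \<le> 4 * (1 - norm z) / (1 - t)" using moebius_gap_bounds by simp
  finally have "moebius_gap t z \<le> sqrt (4 * (1 - norm z) / (1 - t))" by (rule real_le_rsqrt)
  then show ?thesis by (simp only: real_sqrt_divide real_sqrt_mult real_sqrt_four)
qed

text \<open>
  On the circle around \<open>z\<close> one has \<open>b = \<beta> + \<gamma> \<zeta> / (1 - k \<zeta>)\<close> with constants \<open>\<beta>\<close>, \<open>\<gamma>\<close> and \<open>|k| < 1\<close>. In the
  expansion of \<open>|b|\<^sup>2\<close> the cross term has mean 0, and \<open>1 / |1 - k \<zeta>|\<^sup>2\<close> is a multiple of a Poisson kernel.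
\<close>

lemma circle_avg_moebius_gap:
  assumes h: "0 < h" "norm z + h < 1"
  shows "circle_avg (moebius_gap t) z h = moebius_gap t z - h\<^sup>2 * gap_laplacian t z h"
proof -
  define a where "a = 1 - of_real t * z"
  define k where "k = of_real (t * h) / a"
  define \<beta> where "\<beta> = (z - of_real t) / a"
  define \<gamma> where "\<gamma> = of_real (h * (1 - t\<^sup>2)) / a\<^sup>2"
  have a0: "a \<noteq> 0" "0 < norm a" using moebius_denominator(4) by (auto simp: a_def)
  have "t * h < norm a"
  proof -
    have "t * (norm z + h) \<le> norm z + h" using t h by (intro mult_left_le_one_le) auto
    then show ?thesis using moebius_denominator(5) h(2) by (simp add: a_def algebra_simps)
  qed
  then have k: "norm k < 1" using t h a0 by (simp add: k_def norm_divide norm_mult divide_simps)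
  have nz: "1 - k * \<zeta> \<noteq> 0" and lower: "1 - norm k \<le> norm (1 - k * \<zeta>)" if "norm \<zeta> = 1" for \<zeta>
  proof -
    show "1 - norm k \<le> norm (1 - k * \<zeta>)"
      using norm_triangle_ineq2[of 1 "k * \<zeta>"] that by (simp add: norm_mult)
    with k show "1 - k * \<zeta> \<noteq> 0" by (metis diff_gt_0_iff_gt norm_zero not_le)
  qed
  define f where "f \<zeta> = \<zeta> ^ Suc 0 / (1 - k * \<zeta>)" for \<zeta>
  have [measurable]: "f \<in> borel_measurable borel" unfolding f_def by measurable
  have int_f: "integrable circle_measure (\<lambda>\<zeta>. cnj \<beta> * \<gamma> * f \<zeta>)"
  proof (rule circle_integrable_bounded)
    show "norm (cnj \<beta> * \<gamma> * f \<zeta>) \<le> norm (cnj \<beta> * \<gamma>) * (1 / (1 - norm k))" if "norm \<zeta> = 1" for \<zeta>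
    proof -
      have "norm (f \<zeta>) = 1 / norm (1 - k * \<zeta>)" using that by (simp add: f_def norm_divide)
      also have "\<dots> \<le> 1 / (1 - norm k)" using lower[OF that] k by (intro frac_le) auto
      finally show ?thesis unfolding norm_mult[of _ "f \<zeta>"] by (rule mult_left_mono) simp
    qed
  qed measurable
  have int_P: "integrable circle_measure (poisson_kernel (cnj k))"
    using poisson_kernel_mult_integrable[OF smooth_const[of 1], of "cnj k"] k by simp
  have "circle_avg (moebius_gap t) z h = (LINT \<zeta>|circle_measure. moebius_gap t z - 2 * Re (cnj \<beta> * \<gamma> * f \<zeta>) -
      (norm \<gamma>)\<^sup>2 / (1 - (norm k)\<^sup>2) * poisson_kernel (cnj k) \<zeta>)"
    unfolding circle_avg_def
  proof (rule circle_integral_cong)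
    fix \<zeta> :: complex assume \<zeta>: "norm \<zeta> = 1"
    define w where "w = z + of_real h * \<zeta>"
    have w: "norm w < 1" using norm_triangle_ineq[of z "of_real h * \<zeta>"] \<zeta> h by (simp add: w_def norm_mult)
    have aw: "1 - of_real t * w = a * (1 - k * \<zeta>)"
      using a0 by (simp add: a_def k_def w_def field_simps)
    have "(w - of_real t) / (1 - of_real t * w) = \<beta> + \<gamma> * f \<zeta>"
    proof -
      have cross: "(w - of_real t) * a = (z - of_real t) * (a * (1 - k * \<zeta>)) + of_real (h * (1 - t\<^sup>2)) * \<zeta>"
        by (simp only: aw[symmetric]) (simp add: a_def w_def power2_eq_square algebra_simps)
      have "(w - of_real t) / (a * (1 - k * \<zeta>)) = ((w - of_real t) * a) / (a * (a * (1 - k * \<zeta>)))"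
        using a0 by simp
      also have "\<dots> = ((z - of_real t) * (a * (1 - k * \<zeta>)) + of_real (h * (1 - t\<^sup>2)) * \<zeta>) / (a * (a * (1 - k * \<zeta>)))"
        by (simp only: cross)
      also have "\<dots> = \<beta> + \<gamma> * f \<zeta>"
        using a0 nz[OF \<zeta>] by (simp add: \<beta>_def \<gamma>_def f_def add_divide_distrib power2_eq_square)
      finally show ?thesis by (simp only: aw)
    qed
    moreover have "moebius_gap t w = 1 - (norm ((w - of_real t) / (1 - of_real t * w)))\<^sup>2"
    proof -
      have "0 < norm (1 - of_real t * w)" unfolding aw using a0 nz[OF \<zeta>] by simp
      moreover have "(norm (1 - of_real t * w))\<^sup>2 - (norm (w - of_real t))\<^sup>2 = (1 - t\<^sup>2) * (1 - (norm w)\<^sup>2)"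
        unfolding cmod_power2 by (simp add: power2_eq_square algebra_simps)
      ultimately show ?thesis unfolding moebius_gap_def norm_divide power_divide by (simp add: field_simps)
    qed
    moreover have "(norm (\<beta> + y))\<^sup>2 = (norm \<beta>)\<^sup>2 + 2 * Re (cnj \<beta> * y) + (norm y)\<^sup>2" for y
      unfolding cmod_power2 by (simp add: power2_eq_square algebra_simps)
    ultimately have "moebius_gap t w = 1 - (norm \<beta>)\<^sup>2 - 2 * Re (cnj \<beta> * (\<gamma> * f \<zeta>)) - (norm (\<gamma> * f \<zeta>))\<^sup>2"
      by (simp only: diff_diff_eq add.assoc)
    also have "1 - (norm \<beta>)\<^sup>2 = moebius_gap t z" by (simp only: moebius_gap_eq \<beta>_def a_def)
    also have "(norm (\<gamma> * f \<zeta>))\<^sup>2 = (norm \<gamma>)\<^sup>2 / (1 - (norm k)\<^sup>2) * poisson_kernel (cnj k) \<zeta>"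
    proof -
      have "norm (1 - k * \<zeta>) = norm (\<zeta> - cnj k)"
      proof -
        have "\<zeta> * cnj (1 - k * \<zeta>) = \<zeta> - cnj k"
          using complex_norm_square[of \<zeta>] \<zeta> by (simp add: algebra_simps)
        then have "norm \<zeta> * norm (cnj (1 - k * \<zeta>)) = norm (\<zeta> - cnj k)" by (metis norm_mult)
        then show ?thesis using \<zeta> by (simp only: complex_mod_cnj mult_1)
      qed
      moreover have "1 - (norm k)\<^sup>2 \<noteq> 0" using k abs_square_less_1[of "norm k"] by auto
      ultimately show ?thesis
        using \<zeta> by (simp add: f_def norm_mult norm_divide power_mult_distrib power_divide poisson_kernel_def)
    qed
    finally show "moebius_gap t (z + of_real h * \<zeta>) = moebius_gap t z - 2 * Re (cnj \<beta> * \<gamma> * f \<zeta>) -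
        (norm \<gamma>)\<^sup>2 / (1 - (norm k)\<^sup>2) * poisson_kernel (cnj k) \<zeta>"
      by (simp only: w_def mult.assoc)
  qed measurable
  also have "\<dots> = moebius_gap t z - 2 * Re (LINT \<zeta>|circle_measure. cnj \<beta> * \<gamma> * f \<zeta>) - (norm \<gamma>)\<^sup>2 / (1 - (norm k)\<^sup>2)"
    using int_P circle.prob_space poisson_integral_1[of "cnj k"] k integral_Re[OF int_f] integrable_Re[OF int_f]
    by (simp del: integral_Re times_complex.sel)
  also have "(LINT \<zeta>|circle_measure. cnj \<beta> * \<gamma> * f \<zeta>) = 0"
    using circle_geometric(2)[OF k, of 0] unfolding f_def[symmetric] by simp
  also have "(norm \<gamma>)\<^sup>2 / (1 - (norm k)\<^sup>2) = h\<^sup>2 * gap_laplacian t z h"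
  proof -
    have "(norm \<gamma>)\<^sup>2 = h\<^sup>2 * (1 - t\<^sup>2)\<^sup>2 / ((norm a)\<^sup>2 * (norm a)\<^sup>2)"
      unfolding \<gamma>_def norm_divide norm_of_real norm_power power_divide power2_abs power_mult_distrib by (simp add: power2_eq_square)
    moreover have "1 - (norm k)\<^sup>2 = ((norm a)\<^sup>2 - t\<^sup>2 * h\<^sup>2) / (norm a)\<^sup>2"
      unfolding k_def norm_divide norm_of_real power_divide power2_abs power_mult_distrib using a0 by (simp add: field_simps)
    moreover have "1 - (norm k)\<^sup>2 \<noteq> 0" using k abs_square_less_1[of "norm k"] by auto
    ultimately show ?thesis
      using a0 unfolding gap_laplacian_def a_def[symmetric] by (simp add: field_simps)
  qed
  finally show ?thesis by simp
qed

lemma gap_laplacian_0: "gap_laplacian t z 0 = (1 - t\<^sup>2)\<^sup>2 / norm (1 - of_real t * z) ^ 4"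
  by (simp add: gap_laplacian_def power_add[of _ 2 2, simplified])

lemma gap_laplacian_bounds:
  assumes d: "0 < d" "d \<le> 1 - norm z" and h: "0 \<le> h" "h < d"
  shows "0 \<le> gap_laplacian t z 0" "gap_laplacian t z 0 \<le> 1 / d ^ 4"
    "gap_laplacian t z 0 \<le> gap_laplacian t z h"
    "gap_laplacian t z h \<le> gap_laplacian t z 0 / (1 - h\<^sup>2 / d\<^sup>2)"
proof -
  let ?a = "norm (1 - of_real t * z)"
  have a: "d \<le> ?a" "0 < ?a" using moebius_denominator(1) d by auto
  have t2: "0 \<le> 1 - t\<^sup>2" "1 - t\<^sup>2 \<le> 1" using t by (simp_all add: power_le_one)
  show "0 \<le> gap_laplacian t z 0" unfolding gap_laplacian_0 by simp
  show "gap_laplacian t z 0 \<le> 1 / d ^ 4"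
    unfolding gap_laplacian_0 using a d t2 by (intro frac_le power_mono power_le_one) auto
  have hd: "h\<^sup>2 / d\<^sup>2 < 1" using h d by (simp add: power_strict_mono)
  have "t\<^sup>2 * h\<^sup>2 \<le> h\<^sup>2" using t2 by (simp add: mult_left_le_one_le)
  also have "h\<^sup>2 \<le> ?a\<^sup>2 * (h\<^sup>2 / d\<^sup>2)"
  proof -
    have "d\<^sup>2 * (h\<^sup>2 / d\<^sup>2) \<le> ?a\<^sup>2 * (h\<^sup>2 / d\<^sup>2)" using a d by (intro mult_right_mono power_mono) auto
    then show ?thesis using d by simp
  qed
  finally have le: "?a\<^sup>2 * (1 - h\<^sup>2 / d\<^sup>2) \<le> ?a\<^sup>2 - t\<^sup>2 * h\<^sup>2" by (simp add: algebra_simps)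
  have pos: "0 < ?a\<^sup>2 * (1 - h\<^sup>2 / d\<^sup>2)" using a hd by (intro mult_pos_pos) auto
  have pos': "0 < ?a\<^sup>2 - t\<^sup>2 * h\<^sup>2" using pos le by linarith
  have "(1 - t\<^sup>2)\<^sup>2 / (?a\<^sup>2 * (?a\<^sup>2 - t\<^sup>2 * 0\<^sup>2)) \<le> (1 - t\<^sup>2)\<^sup>2 / (?a\<^sup>2 * (?a\<^sup>2 - t\<^sup>2 * h\<^sup>2))"
    using a(2) pos' by (intro divide_left_mono mult_left_mono mult_pos_pos) simp_all
  then show "gap_laplacian t z 0 \<le> gap_laplacian t z h" unfolding gap_laplacian_def .
  have "gap_laplacian t z h \<le> (1 - t\<^sup>2)\<^sup>2 / (?a\<^sup>2 * (?a\<^sup>2 * (1 - h\<^sup>2 / d\<^sup>2)))"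
    unfolding gap_laplacian_def
    by (intro divide_left_mono mult_left_mono mult_pos_pos le pos pos' zero_le_power2 zero_less_power a(2))
  also have "\<dots> = gap_laplacian t z 0 / (1 - h\<^sup>2 / d\<^sup>2)"
    by (simp add: gap_laplacian_def mult.assoc)
  finally show "gap_laplacian t z h \<le> gap_laplacian t z 0 / (1 - h\<^sup>2 / d\<^sup>2)" .
qed

end

text \<open>
  With \<open>\<tau>\<^sub>n = 1 - node n\<close> and the weights \<open>c\<^sub>n = (1/8)\<^sup>n\<close>, the numbers \<open>c\<^sub>n / sqrt \<tau>\<^sub>n = 2\<^bsup>-n\<^esup>\<close> are summable, which
  makes the weighted series of gaps tend to 0 at the circle, while \<open>c\<^sub>n / \<tau>\<^sub>n = 2\<^sup>n\<close>, which is comparable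
  to the contribution of the \<open>n\<close>-th term to the density at 1, is unbounded.
\<close>

definition node :: "nat \<Rightarrow> real"
  where "node n = 1 - (1 / 16) ^ n"

lemma node: "0 \<le> node n" "node n < 1" "1 - node n = (1 / 16) ^ n"
  by (simp_all add: node_def power_le_one)

definition gap_series :: "complex \<Rightarrow> real"
  where "gap_series z = (\<Sum>n. (1 / 8) ^ n * moebius_gap (node n) z)"

definition gap_density :: "complex \<Rightarrow> real \<Rightarrow> real"
  where "gap_density z h = (\<Sum>n. (1 / 8) ^ n * gap_laplacian (node n) z h)"

definition unbounded_example :: "complex \<Rightarrow> ereal"
  where "unbounded_example z = ereal (- gap_series z)"

text \<open>
  The factor \<open>2/\<pi>\<close> is \<open>4 / (2\<pi>)\<close>: the Laplacian of \<open>|b|\<^sup>2\<close> is \<open>4 |b'|\<^sup>2\<close>, and \<open>2\<pi>\<close> is the normalization.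
\<close>

definition example_measure :: "complex measure"
  where "example_measure = density lborel (\<lambda>z. ennreal (indicator \<D> z * (2 / pi * gap_density z 0)))"

lemma weights: "summable (\<lambda>n. (1 / 8 :: real) ^ n)" "(\<Sum>n. (1 / 8 :: real) ^ n) = 8 / 7"
  using summable_geometric[of "1 / 8 :: real"] suminf_geometric[of "1 / 8 :: real"] by simp_all

lemma gap_series_summable:
  assumes "norm z < 1"
  shows "summable (\<lambda>n. (1 / 8) ^ n * moebius_gap (node n) z)"
proof (rule summable_comparison_test'[OF weights(1)])
  show "norm ((1 / 8) ^ n * moebius_gap (node n) z) \<le> (1 / 8) ^ n" for n
    using moebius_gap_bounds[OF node(1,2) assms, of n] by (simp add: mult_left_le)
qed

lemma gap_series_bounds:
  assumes z: "norm z < 1"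
  shows "0 < gap_series z" "gap_series z \<le> 2" "gap_series z \<le> 4 * sqrt (1 - norm z)"
proof -
  note gb = moebius_gap_bounds[OF node(1,2) z]
  show "0 < gap_series z"
    unfolding gap_series_def using gb by (intro suminf_pos gap_series_summable z mult_pos_pos) auto
  have "gap_series z \<le> (\<Sum>n. (1 / 8) ^ n)"
    unfolding gap_series_def using gb less_imp_le[OF gb(1)]
    by (intro suminf_le gap_series_summable z weights) (simp add: mult_left_le)
  then show "gap_series z \<le> 2" unfolding weights by simp
  have half: "(\<lambda>n. 2 * sqrt (1 - norm z) * (1 / 2) ^ n) sums (2 * sqrt (1 - norm z) * (1 / (1 - 1 / 2)))"
    by (intro sums_mult geometric_sums) simp
  have "gap_series z \<le> (\<Sum>n. 2 * sqrt (1 - norm z) * (1 / 2) ^ n)"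
    unfolding gap_series_def
  proof (intro suminf_le gap_series_summable z sums_summable[OF half])
    fix n
    have "sqrt ((1 / 16) ^ n) = (1 / 4 :: real) ^ n"
      by (rule real_sqrt_unique) (simp_all add: power2_eq_square flip: power_mult_distrib)
    then have "moebius_gap (node n) z \<le> 2 * sqrt (1 - norm z) / (1 / 4) ^ n"
      using moebius_gap_sqrt[OF node(1,2) z, of n] unfolding node(3) by simp
    then have "(1 / 8) ^ n * moebius_gap (node n) z \<le> (1 / 8) ^ n * (2 * sqrt (1 - norm z) / (1 / 4) ^ n)"
      by (intro mult_left_mono) auto
    also have "\<dots> = 2 * sqrt (1 - norm z) * ((1 / 8) ^ n / (1 / 4) ^ n)" by simp
    also have "(1 / 8) ^ n / (1 / 4) ^ n = (1 / 2 :: real) ^ n" by (simp flip: power_divide)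
    finally show "(1 / 8) ^ n * moebius_gap (node n) z \<le> 2 * sqrt (1 - norm z) * (1 / 2) ^ n" .
  qed
  then show "gap_series z \<le> 4 * sqrt (1 - norm z)" using sums_unique[OF half] by simp
qed

lemma gap_series_continuous: "continuous_on \<D> gap_series"
proof -
  have "uniform_limit \<D> (\<lambda>n z. \<Sum>i<n. (1 / 8) ^ i * moebius_gap (node i) z) gap_series sequentially"
    unfolding gap_series_def[abs_def]
  proof (rule Weierstrass_m_test[OF _ weights(1)])
    show "norm ((1 / 8) ^ n * moebius_gap (node n) z) \<le> (1 / 8) ^ n" if "z \<in> \<D>" for n z
      using moebius_gap_bounds[OF node(1,2), of z n] that by (simp add: mult_left_le)
  qed
  then show ?thesis
  proof (rule uniform_limit_theorem[rotated])
    have "continuous_on \<D> (moebius_gap (node i))" for i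
      unfolding moebius_gap_def
      using moebius_denominator(4)[OF node(1,2)[of i]] by (intro continuous_intros) fastforce
    then show "\<forall>\<^sub>F n in sequentially. continuous_on \<D> (\<lambda>z. \<Sum>i<n. (1 / 8) ^ i * moebius_gap (node i) z)"
      by (intro always_eventually allI continuous_intros)
  qed simp
qed

lemma gap_series_measurable [measurable]: "gap_series \<in> borel_measurable borel"
  unfolding gap_series_def by measurable

lemma gap_density_measurable [measurable]: "(\<lambda>z. gap_density z h) \<in> borel_measurable borel"
  unfolding gap_density_def by measurable

lemma gap_density_bounds:
  assumes d: "0 < d" "d \<le> 1 - norm z" and h: "0 \<le> h" "h < d"
  shows "summable (\<lambda>n. (1 / 8) ^ n * gap_laplacian (node n) z h)"
    "0 \<le> gap_density z 0" "gap_density z 0 \<le> 2 / d ^ 4"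
    "gap_density z 0 \<le> gap_density z h"
    "gap_density z h \<le> gap_density z 0 / (1 - h\<^sup>2 / d\<^sup>2)"
proof -
  have z: "norm z < 1" using d by simp
  note b = gap_laplacian_bounds[OF node(1,2) z d]
  have hd: "0 < 1 - h\<^sup>2 / d\<^sup>2" using h d by (simp add: power_strict_mono)
  have sum0: "summable (\<lambda>n. (1 / 8) ^ n * gap_laplacian (node n) z 0)"
  proof (rule summable_comparison_test'[OF summable_mult[OF weights(1), of "1 / d ^ 4"]])
    show "norm ((1 / 8) ^ n * gap_laplacian (node n) z 0) \<le> 1 / d ^ 4 * (1 / 8) ^ n" for n
      using b(1,2)[of 0 n] d mult_left_mono[OF b(2)[of 0 n], of "(1 / 8) ^ n"] by (simp add: mult.commute)
  qed
  have le: "(1 / 8) ^ n * gap_laplacian (node n) z h \<le> ((1 / 8) ^ n * gap_laplacian (node n) z 0) / (1 - h\<^sup>2 / d\<^sup>2)" for n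
    using mult_left_mono[OF b(4)[OF h, of n], of "(1 / 8) ^ n"] by simp
  have nonneg: "0 \<le> (1 / 8) ^ n * gap_laplacian (node n) z h" for n
    using b(1)[of 0 n] b(3)[OF h, of n] d by (intro mult_nonneg_nonneg) auto
  show sumh: "summable (\<lambda>n. (1 / 8) ^ n * gap_laplacian (node n) z h)"
    by (rule summable_comparison_test'[OF summable_divide[OF sum0, of "1 - h\<^sup>2 / d\<^sup>2"]]) (use le nonneg in simp)
  show "0 \<le> gap_density z 0"
    unfolding gap_density_def using b(1)[of 0] d by (intro suminf_nonneg sum0 mult_nonneg_nonneg) auto
  have "gap_density z 0 \<le> (\<Sum>n. 1 / d ^ 4 * (1 / 8) ^ n)"
    unfolding gap_density_def
  proof (intro suminf_le sum0 summable_mult weights)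
    show "(1 / 8) ^ n * gap_laplacian (node n) z 0 \<le> 1 / d ^ 4 * (1 / 8) ^ n" for n
      using mult_left_mono[OF b(2)[of 0 n], of "(1 / 8) ^ n"] d by (simp add: mult.commute)
  qed
  also have "\<dots> = 8 / 7 / d ^ 4" by (subst suminf_mult[OF weights(1)]) (simp add: weights)
  also have "\<dots> \<le> 2 / d ^ 4" using d by (intro divide_right_mono) auto
  finally show "gap_density z 0 \<le> 2 / d ^ 4" .
  show "gap_density z 0 \<le> gap_density z h"
    unfolding gap_density_def using b(3)[OF h] by (intro suminf_le sum0 sumh mult_left_mono) auto
  have "gap_density z h \<le> (\<Sum>n. ((1 / 8) ^ n * gap_laplacian (node n) z 0) / (1 - h\<^sup>2 / d\<^sup>2))"
    unfolding gap_density_def by (intro suminf_le sumh summable_divide sum0 le)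
  also have "\<dots> = gap_density z 0 / (1 - h\<^sup>2 / d\<^sup>2)"
    unfolding gap_density_def by (rule suminf_divide[OF sum0])
  finally show "gap_density z h \<le> gap_density z 0 / (1 - h\<^sup>2 / d\<^sup>2)" .
qed

definition example_potential :: "complex \<Rightarrow> real"
  where "example_potential z = (if z \<in> \<D> then - gap_series z else 0)"

lemma example_potential_measurable [measurable]: "example_potential \<in> borel_measurable borel"
  unfolding example_potential_def by measurable

lemma example_potential_bound: "\<bar>example_potential z\<bar> \<le> 2"
  using gap_series_bounds[of z] by (auto simp: example_potential_def)

lemma circle_avg_example:
  assumes h: "0 < h" "norm z + h < 1"
  shows "circle_avg example_potential z h = example_potential z + h\<^sup>2 * gap_density z h"
proof -
  have z: "norm z < 1" using h by linarith
  have in_D: "norm (z + of_real h * \<zeta>) < 1" if "norm \<zeta> = 1" for \<zeta>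
    using norm_triangle_ineq[of z "of_real h * \<zeta>"] that h by (simp add: norm_mult)
  let ?f = "\<lambda>n \<zeta>. (1 / 8) ^ n * moebius_gap (node n) (z + of_real h * \<zeta>)"
  have f_bound: "norm (?f n \<zeta>) \<le> (1 / 8) ^ n" if "norm \<zeta> = 1" for n \<zeta>
    using moebius_gap_bounds[OF node(1,2) in_D[OF that], of n] by (simp add: mult_left_le)
  have int: "integrable circle_measure (?f n)" for n
    by (rule circle_integrable_bounded[OF _ f_bound]) measurable
  have "(\<lambda>n. LINT \<zeta>|circle_measure. ?f n \<zeta>) sums (LINT \<zeta>|circle_measure. (\<Sum>n. ?f n \<zeta>))"
  proof (rule sums_integral[OF int])
    show "AE \<zeta> in circle_measure. summable (\<lambda>n. norm (?f n \<zeta>))"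
      using AE_circle
    proof (rule AE_mp, intro AE_I2 impI)
      show "summable (\<lambda>n. norm (?f n \<zeta>))" if "norm \<zeta> = 1" for \<zeta>
        by (rule summable_comparison_test'[OF weights(1)]) (use f_bound[OF that] in simp)
    qed
    show "summable (\<lambda>n. LINT \<zeta>|circle_measure. norm (?f n \<zeta>))"
    proof (rule summable_comparison_test'[OF weights(1)])
      fix n
      have "(LINT \<zeta>|circle_measure. norm (?f n \<zeta>)) \<le> (LINT \<zeta>|circle_measure. (1 / 8) ^ n)"
      proof (rule integral_mono_AE)
        show "AE \<zeta> in circle_measure. norm (?f n \<zeta>) \<le> (1 / 8) ^ n"
          using AE_circle by (rule AE_mp) (intro AE_I2 impI f_bound)
      qed (intro integrable_norm int, simp)
      moreover have "0 \<le> (LINT \<zeta>|circle_measure. norm (?f n \<zeta>))"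
        by (rule Bochner_Integration.integral_nonneg) (rule norm_ge_zero)
      ultimately show "norm (LINT \<zeta>|circle_measure. norm (?f n \<zeta>)) \<le> (1 / 8) ^ n"
        using circle.prob_space by simp
    qed
  qed
  moreover have "(LINT \<zeta>|circle_measure. (\<Sum>n. ?f n \<zeta>)) = - circle_avg example_potential z h"
  proof -
    have "(LINT \<zeta>|circle_measure. (\<Sum>n. ?f n \<zeta>)) = (LINT \<zeta>|circle_measure. - example_potential (z + of_real h * \<zeta>))"
    proof (rule circle_integral_cong)
      show "(\<Sum>n. ?f n \<zeta>) = - example_potential (z + of_real h * \<zeta>)" if "norm \<zeta> = 1" for \<zeta>
        using in_D[OF that] by (simp add: example_potential_def gap_series_def)
    qed measurable
    then show ?thesis by (simp add: circle_avg_def)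
  qed
  moreover have "(LINT \<zeta>|circle_measure. ?f n \<zeta>) =
      (1 / 8) ^ n * moebius_gap (node n) z - h\<^sup>2 * ((1 / 8) ^ n * gap_laplacian (node n) z h)" for n
    using circle_avg_moebius_gap[OF node(1,2) z h, of n] by (simp add: circle_avg_def right_diff_distrib)
  ultimately have "(\<lambda>n. (1 / 8) ^ n * moebius_gap (node n) z - h\<^sup>2 * ((1 / 8) ^ n * gap_laplacian (node n) z h))
      sums (- circle_avg example_potential z h)" by (simp only:)
  moreover have "(\<lambda>n. (1 / 8) ^ n * moebius_gap (node n) z - h\<^sup>2 * ((1 / 8) ^ n * gap_laplacian (node n) z h))
      sums (gap_series z - h\<^sup>2 * gap_density z h)"
    unfolding gap_series_def gap_density_def
    using gap_density_bounds(1)[of "1 - norm z" z h] h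
    by (intro sums_diff sums_mult summable_sums gap_series_summable z) auto
  ultimately have "- circle_avg example_potential z h = gap_series z - h\<^sup>2 * gap_density z h"
    by (rule sums_unique2)
  then show ?thesis using z by (simp add: example_potential_def)
qed

text \<open>
  By the exact formula for circle averages, the difference quotients of the potential are
  \<^const>\<open>gap_density\<close> at \<open>h > 0\<close>, which on the support of \<open>\<phi>\<close> is squeezed between its value at
  \<open>h = 0\<close> and a multiple tending to it.
\<close>

lemma example_pairing:
  assumes \<phi>: "test_function \<D> \<phi>"
  shows "(LINT z|lborel. example_potential z * classical_laplacian \<phi> z) = 4 * (LINT z|lborel. \<phi> z * gap_density z 0)"
proof -
  obtain K where K: "compact K" "K \<subseteq> \<D>" "\<And>z. z \<notin> K \<Longrightarrow> \<phi> z = 0" using \<phi> by (rule test_functionE) blast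
  obtain \<rho> where \<rho>: "0 < \<rho>" "\<rho> < 1" "K \<subseteq> cball 0 \<rho>" using compact_subset_disc[OF K(1,2)] by blast
  note sm = test_function_smooth[OF \<phi>]
  note [measurable] = smooth_borel_measurable[OF sm]
  obtain C where C: "0 < C" "\<And>z. \<bar>\<phi> z\<bar> \<le> C"
    using bounded_of_compact_support[OF smooth_continuous_on[OF sm] K(1,3)] by blast
  have int_\<phi>: "integrable lborel \<phi>" by (rule integrable_compact_support[OF _ K(1,3) C(2)]) measurable
  define d where "d = 1 - \<rho>"
  have d: "0 < d" "d \<le> 1" using \<rho> by (simp_all add: d_def)
  have near: "d \<le> 1 - norm z" if "\<phi> z \<noteq> 0" for z
  proof -
    have "z \<in> K" using that K(3) by blast
    then show ?thesis using \<rho>(3) by (auto simp: d_def)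
  qed
  define h where "h k = d / 2 * inverse (real (Suc k))" for k
  have h: "0 < h k" "h k \<le> d / 2" for k
  proof -
    show "0 < h k" using d by (simp add: h_def)
    have "d / 2 * inverse (real (Suc k)) \<le> d / 2 * 1" using d by (intro mult_left_mono) (auto simp: inverse_le_1_iff)
    then show "h k \<le> d / 2" by (simp add: h_def)
  qed
  have h_lim: "h \<longlonglongrightarrow> 0"
    unfolding h_def using tendsto_mult_right[OF LIMSEQ_inverse_real_of_nat, of "d / 2"] by (simp add: mult.commute)
  have lim1: "(\<lambda>k. (LINT z|lborel. \<phi> z * (circle_avg example_potential z (h k) - example_potential z)) / (h k)\<^sup>2)
    \<longlonglongrightarrow> (LINT z|lborel. example_potential z * classical_laplacian \<phi> z) / 4"
  proof (rule laplacian_limit[OF example_potential_measurable example_potential_bound _ h(1) _ h_lim])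
    show "test_function UNIV \<phi>" by (rule test_function_mono[OF \<phi>]) simp
    show "h n \<le> 1" for n using h(2)[of n] d by linarith
  qed
  have eq: "\<phi> z * (circle_avg example_potential z (h k) - example_potential z) / (h k)\<^sup>2 = \<phi> z * gap_density z (h k)" for z k
  proof (cases "\<phi> z = 0")
    case False
    have "norm z + h k < 1" using near[OF False] h(2)[of k] d by linarith
    from circle_avg_example[OF h(1) this] show ?thesis using h(1)[of k] by simp
  qed simp
  have quot: "(h k)\<^sup>2 / d\<^sup>2 \<le> 1 / 4" for k
  proof -
    have "(h k)\<^sup>2 \<le> (d / 2)\<^sup>2" using h[of k] by (intro power_mono) auto
    then show ?thesis using d by (simp add: power_divide divide_simps)
  qed
  have gd: "0 \<le> gap_density z 0" "gap_density z 0 \<le> 2 / d ^ 4" "gap_density z 0 \<le> gap_density z (h k)"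
    "gap_density z (h k) \<le> gap_density z 0 / (1 - (h k)\<^sup>2 / d\<^sup>2)" if "\<phi> z \<noteq> 0" for z k
  proof -
    have "0 \<le> h k" "h k < d" using h[of k] d by linarith+
    from gap_density_bounds(2-5)[OF d(1) near[OF that] this]
    show "0 \<le> gap_density z 0" "gap_density z 0 \<le> 2 / d ^ 4" "gap_density z 0 \<le> gap_density z (h k)"
      "gap_density z (h k) \<le> gap_density z 0 / (1 - (h k)\<^sup>2 / d\<^sup>2)" .
  qed
  have lim2: "(\<lambda>k. LINT z|lborel. \<phi> z * (circle_avg example_potential z (h k) - example_potential z) / (h k)\<^sup>2)
    \<longlonglongrightarrow> (LINT z|lborel. \<phi> z * gap_density z 0)"
  proof (rule integral_dominated_convergence[where w = "\<lambda>z. \<bar>\<phi> z\<bar> * (4 / d ^ 4)"])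
    show "integrable lborel (\<lambda>z. \<bar>\<phi> z\<bar> * (4 / d ^ 4))" using int_\<phi> by (intro integrable_mult_left integrable_abs)
    show "AE z in lborel. (\<lambda>k. \<phi> z * (circle_avg example_potential z (h k) - example_potential z) / (h k)\<^sup>2)
        \<longlonglongrightarrow> \<phi> z * gap_density z 0"
      unfolding eq
    proof (rule AE_I2)
      fix z
      show "(\<lambda>k. \<phi> z * gap_density z (h k)) \<longlonglongrightarrow> \<phi> z * gap_density z 0"
      proof (cases "\<phi> z = 0")
        case False
        have "(\<lambda>k. gap_density z 0 / (1 - (h k)\<^sup>2 / d\<^sup>2)) \<longlonglongrightarrow> gap_density z 0 / (1 - 0\<^sup>2 / d\<^sup>2)"
          using d by (intro tendsto_intros h_lim) auto
        then have "(\<lambda>k. gap_density z 0 / (1 - (h k)\<^sup>2 / d\<^sup>2)) \<longlonglongrightarrow> gap_density z 0" by simp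
        then have "(\<lambda>k. gap_density z (h k)) \<longlonglongrightarrow> gap_density z 0"
          by (rule tendsto_sandwich[OF _ _ tendsto_const[of "gap_density z 0"], rotated 2])
            (auto intro!: always_eventually gd(3,4)[OF False])
        then show ?thesis by (intro tendsto_intros)
      qed simp
    qed
    show "AE z in lborel. norm (\<phi> z * (circle_avg example_potential z (h k) - example_potential z) / (h k)\<^sup>2)
        \<le> \<bar>\<phi> z\<bar> * (4 / d ^ 4)" for k
      unfolding eq
    proof (rule AE_I2)
      fix z
      show "norm (\<phi> z * gap_density z (h k)) \<le> \<bar>\<phi> z\<bar> * (4 / d ^ 4)"
      proof (cases "\<phi> z = 0")
        case False
        have "gap_density z (h k) \<le> gap_density z 0 / (1 - (h k)\<^sup>2 / d\<^sup>2)" by (rule gd(4)[OF False])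
        also have "\<dots> \<le> (2 / d ^ 4) / (1 / 2)"
        proof (rule frac_le)
          show "0 \<le> 2 / d ^ 4" using d by simp
          show "gap_density z 0 \<le> 2 / d ^ 4" by (rule gd(2)[OF False])
          show "1 / 2 \<le> 1 - (h k)\<^sup>2 / d\<^sup>2" using quot[of k] by linarith
        qed simp
        finally have "gap_density z (h k) \<le> 4 / d ^ 4" by simp
        moreover have "0 \<le> gap_density z (h k)" using gd(1)[OF False] gd(3)[OF False, of k] by linarith
        ultimately show ?thesis unfolding real_norm_def abs_mult by (intro mult_left_mono) simp_all
      qed simp
    qed
  qed measurable
  have "(LINT z|lborel. example_potential z * classical_laplacian \<phi> z) / 4 = (LINT z|lborel. \<phi> z * gap_density z 0)"
    using LIMSEQ_unique[OF lim1] lim2 by simp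
  then show ?thesis by simp
qed

lemma lorentzian_nn_integral:
  assumes "0 < \<tau>"
  shows "(\<integral>\<^sup>+x. ennreal (1 / (\<tau>\<^sup>2 + (x - s)\<^sup>2)) \<partial>lborel) \<le> ennreal (pi / \<tau>)"
proof -
  define f where "f x = 1 / (\<tau>\<^sup>2 + (x - s)\<^sup>2)" for x
  have [measurable]: "f \<in> borel_measurable borel" unfolding f_def by measurable
  have pos: "0 < \<tau>\<^sup>2 + (x - s)\<^sup>2" for x using assms by (intro add_pos_nonneg) auto
  have right: "(\<integral>\<^sup>+x. ennreal (f x) * indicator {s..} x \<partial>lborel) = ennreal (pi / (2 * \<tau>))"
  proof -
    have "(\<integral>\<^sup>+x. ennreal (f x) * indicator {s..} x \<partial>lborel) = ennreal (pi / 2 / \<tau> - arctan ((s - s) / \<tau>) / \<tau>)"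
    proof (rule nn_integral_FTC_atLeast[where F = "\<lambda>x. arctan ((x - s) / \<tau>) / \<tau>" and T = "pi / 2 / \<tau>"])
      show "DERIV (\<lambda>x. arctan ((x - s) / \<tau>) / \<tau>) x :> f x" for x
      proof -
        have "\<tau> * (1 + ((x - s) / \<tau>)\<^sup>2) * \<tau> = \<tau>\<^sup>2 + (x - s)\<^sup>2"
          using assms by (simp add: power2_eq_square field_simps)
        then have "inverse (1 + ((x - s) / \<tau>)\<^sup>2) / \<tau> / \<tau> = f x"
          unfolding f_def using assms pos[of x] by (simp add: divide_simps)
        then show ?thesis
          using assms by (auto intro!: derivative_eq_intros)
      qed
      show "0 \<le> f x" for x unfolding f_def using pos[of x] by simp
      have "filterlim (\<lambda>x. (x - s) / \<tau>) at_top at_top"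
      proof -
        have "filterlim (\<lambda>x. (1 / \<tau>) * (- s + x)) at_top at_top"
          using assms by (intro filterlim_tendsto_pos_mult_at_top[OF tendsto_const]
              filterlim_tendsto_add_at_top[OF tendsto_const] filterlim_ident) auto
        then show ?thesis by (simp add: field_simps)
      qed
      then have "((\<lambda>x. arctan ((x - s) / \<tau>)) \<longlongrightarrow> pi / 2) at_top"
        by (rule filterlim_compose[OF tendsto_arctan_at_top])
      then show "((\<lambda>x. arctan ((x - s) / \<tau>) / \<tau>) \<longlongrightarrow> pi / 2 / \<tau>) at_top"
        using assms by (intro tendsto_intros) auto
    qed simp
    then show ?thesis by simp
  qed
  have left: "(\<integral>\<^sup>+x. ennreal (f x) * indicator {..s} x \<partial>lborel) = (\<integral>\<^sup>+x. ennreal (f x) * indicator {s..} x \<partial>lborel)"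
  proof -
    have "(\<integral>\<^sup>+x. ennreal (f x) * indicator {..s} x \<partial>lborel) =
        ennreal \<bar>-1\<bar> * (\<integral>\<^sup>+x. ennreal (f (2 * s + (-1) * x)) * indicator {..s} (2 * s + (-1) * x) \<partial>lborel)"
      by (rule nn_integral_real_affine[where c = "-1" and t = "2 * s" and f = "\<lambda>x. ennreal (f x) * indicator {..s} x"]) auto
    also have "\<dots> = (\<integral>\<^sup>+x. ennreal (f (2 * s + (-1) * x)) * indicator {..s} (2 * s + (-1) * x) \<partial>lborel)" by simp
    also have "\<dots> = (\<integral>\<^sup>+x. ennreal (f x) * indicator {s..} x \<partial>lborel)"
    proof (rule nn_integral_cong)
      fix x
      have "(2 * s + (-1) * x - s)\<^sup>2 = (x - s)\<^sup>2" by (simp add: power2_eq_square algebra_simps)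
      then show "ennreal (f (2 * s + (-1) * x)) * indicator {..s} (2 * s + (-1) * x) = ennreal (f x) * indicator {s..} x"
        by (auto simp: f_def indicator_def)
    qed
    finally show ?thesis .
  qed
  have "(\<integral>\<^sup>+x. ennreal (f x) \<partial>lborel) \<le>
      (\<integral>\<^sup>+x. ennreal (f x) * indicator {s..} x + ennreal (f x) * indicator {..s} x \<partial>lborel)"
    by (intro nn_integral_mono) (auto simp: indicator_def)
  also have "\<dots> = ennreal (pi / (2 * \<tau>)) + ennreal (pi / (2 * \<tau>))"
    by (subst nn_integral_add) (simp_all add: left right)
  also have "\<dots> = ennreal (pi / \<tau>)" using assms by (simp flip: ennreal_plus)
  finally show ?thesis unfolding f_def .
qed

text \<open>
  A bound for the area of the image of the disc under \<open>b\<close> that is uniform in \<open>t\<close>. Since \<open>|1 - t z|\<close>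
  dominates both \<open>1 - t\<close> and \<open>|1 - z| / 2\<close>, the integrand is bounded by a product of a function of the
  real part and one of the imaginary part, both with an explicit integral over the line.
\<close>

lemma gap_laplacian_mass:
  assumes t: "0 \<le> t" "t < 1"
  shows "(\<integral>\<^sup>+z\<in>\<D>. ennreal (gap_laplacian t z 0) \<partial>lborel) \<le> ennreal (256 * pi\<^sup>2)"
proof -
  define \<tau> where "\<tau> = 1 - t"
  have \<tau>: "0 < \<tau>" using t by (simp add: \<tau>_def)
  let ?F = "\<lambda>z. 1 / (\<tau>\<^sup>2 + (Re z - 1)\<^sup>2) * (1 / (\<tau>\<^sup>2 + (Im z - 0)\<^sup>2))"
  have bound: "gap_laplacian t z 0 \<le> 256 * \<tau>\<^sup>2 * ?F z" if z: "norm z < 1" for z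
  proof -
    let ?a = "norm (1 - of_real t * z)"
    note den = moebius_denominator[OF t z]
    have "\<tau>\<^sup>2 \<le> ?a\<^sup>2" using den(2) \<tau> by (intro power_mono) (auto simp: \<tau>_def)
    moreover have "(norm (1 - z))\<^sup>2 \<le> (2 * ?a)\<^sup>2" using den(3) by (intro power_mono) auto
    moreover have "(2 * ?a)\<^sup>2 = 4 * ?a\<^sup>2" by (simp add: power_mult_distrib)
    ultimately have "\<tau>\<^sup>2 + (norm (1 - z))\<^sup>2 \<le> 8 * ?a\<^sup>2" using zero_le_power2[of ?a] by linarith
    moreover have "(norm (1 - z))\<^sup>2 = (Re z - 1)\<^sup>2 + (Im z - 0)\<^sup>2"
      unfolding cmod_power2 by (simp add: power2_commute)
    ultimately have le: "\<tau>\<^sup>2 + (Re z - 1)\<^sup>2 \<le> 8 * ?a\<^sup>2" "\<tau>\<^sup>2 + (Im z - 0)\<^sup>2 \<le> 8 * ?a\<^sup>2"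
      using zero_le_power2[of "Re z - 1"] zero_le_power2[of "Im z - 0"] by linarith+
    have pos: "0 < \<tau>\<^sup>2 + (Re z - 1)\<^sup>2" "0 < \<tau>\<^sup>2 + (Im z - 0)\<^sup>2" using \<tau> by (intro add_pos_nonneg; simp)+
    have "(\<tau>\<^sup>2 + (Re z - 1)\<^sup>2) * (\<tau>\<^sup>2 + (Im z - 0)\<^sup>2) \<le> (8 * ?a\<^sup>2) * (8 * ?a\<^sup>2)"
      using le pos by (intro mult_mono) auto
    also have "\<dots> = 64 * ?a ^ 4" by (simp add: power_add[of ?a 2 2, simplified])
    finally have prod: "(\<tau>\<^sup>2 + (Re z - 1)\<^sup>2) * (\<tau>\<^sup>2 + (Im z - 0)\<^sup>2) \<le> 64 * ?a ^ 4" .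
    have num: "(1 - t\<^sup>2)\<^sup>2 \<le> 4 * \<tau>\<^sup>2"
    proof -
      have "1 - t\<^sup>2 = \<tau> * (1 + t)" by (simp add: \<tau>_def power2_eq_square algebra_simps)
      also have "\<dots> \<le> \<tau> * 2" using t \<tau> by (intro mult_left_mono) auto
      finally have "(1 - t\<^sup>2)\<^sup>2 \<le> (\<tau> * 2)\<^sup>2" using t by (intro power_mono) (auto simp: power_le_one)
      then show ?thesis by (simp add: power_mult_distrib mult.commute)
    qed
    have "gap_laplacian t z 0 = 64 * (1 - t\<^sup>2)\<^sup>2 / (64 * ?a ^ 4)" unfolding gap_laplacian_0[OF t z] by simp
    also have "\<dots> \<le> 64 * (4 * \<tau>\<^sup>2) / ((\<tau>\<^sup>2 + (Re z - 1)\<^sup>2) * (\<tau>\<^sup>2 + (Im z - 0)\<^sup>2))"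
      using num prod pos by (intro frac_le mult_pos_pos) auto
    finally show ?thesis by simp
  qed
  define f where "f b x = (if b = (1 :: complex) then ennreal (1 / (\<tau>\<^sup>2 + (x - 1)\<^sup>2)) else ennreal (1 / (\<tau>\<^sup>2 + (x - 0)\<^sup>2)))"
    for b and x :: real
  have [measurable]: "f b \<in> borel_measurable borel" for b unfolding f_def by measurable
  have nonneg: "0 \<le> 1 / (\<tau>\<^sup>2 + (x - s)\<^sup>2)" for x s by (intro divide_nonneg_nonneg add_nonneg_nonneg) auto
  have "(\<integral>\<^sup>+z\<in>\<D>. ennreal (gap_laplacian t z 0) \<partial>lborel) \<le> (\<integral>\<^sup>+z. ennreal (256 * \<tau>\<^sup>2) * (\<Prod>b\<in>Basis. f b (z \<bullet> b)) \<partial>lborel)"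
  proof (rule nn_integral_mono)
    fix z :: complex
    have prod: "(\<Prod>b\<in>Basis. f b (z \<bullet> b)) = ennreal (?F z)"
      using nonneg by (simp add: Basis_complex_def f_def ennreal_mult'[symmetric])
    show "ennreal (gap_laplacian t z 0) * indicator \<D> z \<le> ennreal (256 * \<tau>\<^sup>2) * (\<Prod>b\<in>Basis. f b (z \<bullet> b))"
    proof (cases "z \<in> \<D>")
      case True
      then show ?thesis
        unfolding prod using bound[of z] by (simp add: ennreal_leI flip: ennreal_mult')
    qed simp
  qed
  also have "\<dots> = ennreal (256 * \<tau>\<^sup>2) * (\<integral>\<^sup>+z. (\<Prod>b\<in>Basis. f b (z \<bullet> b)) \<partial>lborel)"
    by (rule nn_integral_cmult) measurable
  also have "(\<integral>\<^sup>+z. (\<Prod>b\<in>Basis. f b (z \<bullet> b)) \<partial>lborel) = (\<Prod>b\<in>Basis. (\<integral>\<^sup>+x. f b x \<partial>lborel))"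
    by (rule nn_integral_lborel_prod) auto
  also have "\<dots> = (\<integral>\<^sup>+x. ennreal (1 / (\<tau>\<^sup>2 + (x - 1)\<^sup>2)) \<partial>lborel) * (\<integral>\<^sup>+x. ennreal (1 / (\<tau>\<^sup>2 + (x - 0)\<^sup>2)) \<partial>lborel)"
    by (simp add: Basis_complex_def f_def)
  also have "\<dots> \<le> ennreal (pi / \<tau>) * ennreal (pi / \<tau>)"
    by (intro mult_mono lorentzian_nn_integral \<tau>) auto
  also have "ennreal (256 * \<tau>\<^sup>2) * (ennreal (pi / \<tau>) * ennreal (pi / \<tau>)) = ennreal (256 * pi\<^sup>2)"
    using \<tau> by (simp add: power2_eq_square flip: ennreal_mult')
  finally show ?thesis by (simp add: mult_left_mono)
qed

lemma example_measure_nn_integral: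
  assumes [measurable]: "g \<in> borel_measurable borel"
  shows "(\<integral>\<^sup>+z. g z \<partial>example_measure) = (\<integral>\<^sup>+z\<in>\<D>. ennreal (2 / pi * gap_density z 0) * g z \<partial>lborel)"
  unfolding example_measure_def
  by (subst nn_integral_density) (auto intro!: nn_integral_cong simp: indicator_def)

lemma example_density_series:
  assumes "norm z < 1"
  shows "ennreal (2 / pi * gap_density z 0) = (\<Sum>n. ennreal (2 / pi * (1 / 8) ^ n) * ennreal (gap_laplacian (node n) z 0))"
proof -
  have d: "0 < 1 - norm z" "1 - norm z \<le> 1 - norm z" using assms by simp_all
  note b = gap_laplacian_bounds(1)[OF node(1,2) assms d order_refl d(1)]
  have "2 / pi * gap_density z 0 = (\<Sum>n. 2 / pi * ((1 / 8) ^ n * gap_laplacian (node n) z 0))"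
    unfolding gap_density_def by (rule suminf_mult[symmetric, OF gap_density_bounds(1)[OF d order_refl d(1)]])
  also have "ennreal \<dots> = (\<Sum>n. ennreal (2 / pi * ((1 / 8) ^ n * gap_laplacian (node n) z 0)))"
    using b by (intro suminf_ennreal2[symmetric] summable_mult gap_density_bounds(1)[OF d order_refl d(1)]) auto
  also have "\<dots> = (\<Sum>n. ennreal (2 / pi * (1 / 8) ^ n) * ennreal (gap_laplacian (node n) z 0))"
    by (intro suminf_cong, subst ennreal_mult'[symmetric]) (simp_all add: mult.assoc)
  finally show ?thesis .
qed

lemma example_mass: "emeasure example_measure UNIV < \<infinity>"
proof -
  have "emeasure example_measure UNIV = (\<integral>\<^sup>+z. 1 \<partial>example_measure)" by (simp add: example_measure_def)
  also have "\<dots> = (\<integral>\<^sup>+z\<in>\<D>. ennreal (2 / pi * gap_density z 0) * 1 \<partial>lborel)"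
    by (rule example_measure_nn_integral) simp
  also have "\<dots> = (\<integral>\<^sup>+z. (\<Sum>n. ennreal (2 / pi * (1 / 8) ^ n) * (ennreal (gap_laplacian (node n) z 0) * indicator \<D> z)) \<partial>lborel)"
  proof (rule nn_integral_cong)
    fix z :: complex
    show "ennreal (2 / pi * gap_density z 0) * 1 * indicator \<D> z =
        (\<Sum>n. ennreal (2 / pi * (1 / 8) ^ n) * (ennreal (gap_laplacian (node n) z 0) * indicator \<D> z))"
    proof (cases "z \<in> \<D>")
      case True
      then show ?thesis using example_density_series[of z] by simp
    qed simp
  qed
  also have "\<dots> = (\<Sum>n. \<integral>\<^sup>+z. ennreal (2 / pi * (1 / 8) ^ n) * (ennreal (gap_laplacian (node n) z 0) * indicator \<D> z) \<partial>lborel)"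
    by (rule nn_integral_suminf) measurable
  also have "\<dots> = (\<Sum>n. ennreal (2 / pi * (1 / 8) ^ n) * (\<integral>\<^sup>+z\<in>\<D>. ennreal (gap_laplacian (node n) z 0) \<partial>lborel))"
    by (intro suminf_cong nn_integral_cmult) measurable
  also have "\<dots> \<le> (\<Sum>n. ennreal (2 / pi * (1 / 8) ^ n) * ennreal (256 * pi\<^sup>2))"
    by (intro suminf_le mult_left_mono gap_laplacian_mass node) auto
  also have "\<dots> = (\<Sum>n. ennreal (2 / pi * 256 * pi\<^sup>2 * (1 / 8) ^ n))"
    by (simp add: mult_ac flip: ennreal_mult')
  also have "\<dots> = ennreal (\<Sum>n. 2 / pi * 256 * pi\<^sup>2 * (1 / 8) ^ n)"
    by (intro suminf_ennreal2 summable_mult weights) auto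
  also have "\<dots> < \<infinity>" by simp
  finally show ?thesis .
qed

lemma example_has_laplacian: "has_laplacian unbounded_example example_measure"
  unfolding has_laplacian_def locally_integrable_on_def
proof (intro conjI allI impI)
  show "unbounded_example \<in> borel_measurable (restrict_space borel \<D>)"
    unfolding unbounded_example_def[abs_def] by (intro measurable_restrict_space1) measurable
  show "(\<integral>\<^sup>+z\<in>K. e2ennreal \<bar>unbounded_example z\<bar> \<partial>lborel) < \<infinity>" if K: "compact K" "K \<subseteq> \<D>" for K
  proof -
    have "(\<integral>\<^sup>+z\<in>K. e2ennreal \<bar>unbounded_example z\<bar> \<partial>lborel) \<le> (\<integral>\<^sup>+z. ennreal 2 * indicator K z \<partial>lborel)"
    proof (rule nn_integral_mono)
      fix z
      show "e2ennreal \<bar>unbounded_example z\<bar> * indicator K z \<le> ennreal 2 * indicator K z"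
      proof (cases "z \<in> K")
        case True
        then have "norm z < 1" using K by auto
        from gap_series_bounds[OF this] have "\<bar>unbounded_example z\<bar> = ereal (gap_series z)" "gap_series z \<le> 2"
          by (simp_all add: unbounded_example_def)
        then show ?thesis using True ennreal_leI[of "gap_series z" 2] by simp
      qed simp
    qed
    also have "\<dots> = ennreal 2 * emeasure lborel K"
      using borel_compact[OF K(1)] by (intro nn_integral_cmult_indicator) simp
    also have "\<dots> < \<infinity>" using emeasure_compact_finite[OF K(1)] by (simp add: ennreal_mult_less_top)
    finally show ?thesis .
  qed
  show "sets example_measure = sets borel" by (simp add: example_measure_def)
  show "emeasure example_measure (- \<D>) = 0"
    unfolding example_measure_def
    by (subst emeasure_density) (auto simp: nn_integral_0_iff_AE indicator_def)
  show "emeasure example_measure K < \<infinity>" if "compact K" for K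
  proof -
    have "emeasure example_measure K \<le> emeasure example_measure UNIV"
      by (intro emeasure_mono) (auto simp: example_measure_def)
    then show ?thesis using example_mass by (rule order_le_less_trans)
  qed
  fix \<phi> assume \<phi>: "test_function \<D> \<phi>"
  note [measurable] = smooth_borel_measurable[OF test_function_smooth[OF \<phi>]]
  obtain K where K: "K \<subseteq> \<D>" "\<And>z. z \<notin> K \<Longrightarrow> \<phi> z = 0" using \<phi> by (rule test_functionE) blast
  have nonneg: "0 \<le> indicator \<D> z * (2 / pi * gap_density z 0)" for z
    using gap_density_bounds(2)[of "1 - norm z" z 0] by (cases "z \<in> \<D>") auto
  have "(LINT z|example_measure. \<phi> z) = (LINT z|lborel. (indicator \<D> z * (2 / pi * gap_density z 0)) *\<^sub>R \<phi> z)"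
    unfolding example_measure_def using nonneg by (intro integral_density) auto
  also have "\<dots> = (LINT z|lborel. 2 / pi * (\<phi> z * gap_density z 0))"
  proof (rule Bochner_Integration.integral_cong[OF refl])
    fix z
    show "(indicator \<D> z * (2 / pi * gap_density z 0)) *\<^sub>R \<phi> z = 2 / pi * (\<phi> z * gap_density z 0)"
    proof (cases "z \<in> \<D>")
      case False
      then have "\<phi> z = 0" using K by blast
      then show ?thesis by simp
    qed simp
  qed
  also have "\<dots> = (LINT z|lborel. example_potential z * classical_laplacian \<phi> z) / (2 * pi)"
    unfolding example_pairing[OF \<phi>] by simp
  also have "(LINT z|lborel. example_potential z * classical_laplacian \<phi> z) =
      (LINT z:\<D>|lborel. real_of_ereal (unbounded_example z) * classical_laplacian \<phi> z)"
    unfolding set_lebesgue_integral_def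
    by (rule Bochner_Integration.integral_cong[OF refl])
      (simp add: example_potential_def unbounded_example_def indicator_def)
  finally show "(LINT z|example_measure. \<phi> z) =
      (LINT z:\<D>|lborel. real_of_ereal (unbounded_example z) * classical_laplacian \<phi> z) / (2 * pi)" .
qed

lemma example_subharmonic: "subharmonic_on \<D> unbounded_example"
  unfolding subharmonic_on_def
proof (intro conjI ballI allI impI)
  have cont: "continuous_on \<D> unbounded_example"
    unfolding unbounded_example_def[abs_def]
    by (rule continuous_on_ereal[OF continuous_on_minus[OF gap_series_continuous]])
  show "unbounded_example z < \<infinity>" for z by (simp add: unbounded_example_def)
  show "openin (top_of_set \<D>) {z \<in> \<D>. unbounded_example z < t}" for t
    using continuous_openin_preimage_gen[OF cont, of "{..<t}"] by (simp add: Int_def vimage_def)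
  fix a :: complex and \<rho> :: real assume \<rho>: "0 < \<rho>" "cball a \<rho> \<subseteq> \<D>"
  then have a\<rho>: "norm a + \<rho> < 1" by (simp add: cball_subset_ball_iff)
  have in_D: "norm (a + of_real \<rho> * \<zeta>) < 1" if "norm \<zeta> = 1" for \<zeta>
    using norm_triangle_ineq[of a "of_real \<rho> * \<zeta>"] that \<rho> a\<rho> by (simp add: norm_mult)
  have "(\<integral>\<^sup>+\<zeta>\<in>\<T>. e2ennreal (unbounded_example (a + of_real \<rho> * \<zeta>)) \<partial>circle_measure) = (\<integral>\<^sup>+\<zeta>. 0 \<partial>circle_measure)"
    using gap_series_bounds(1)[OF in_D]
    by (intro nn_integral_cong) (auto simp: indicator_def unbounded_example_def ennreal_neg less_imp_le)
  then have zero: "(\<integral>\<^sup>+\<zeta>\<in>\<T>. e2ennreal (unbounded_example (a + of_real \<rho> * \<zeta>)) \<partial>circle_measure) = 0" by simp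
  have int: "integrable circle_measure (\<lambda>\<zeta>. - example_potential (a + of_real \<rho> * \<zeta>))"
    by (rule circle_integrable_bounded[where B = 2]) (measurable, simp add: example_potential_bound)
  have nonneg: "0 \<le> - example_potential z" for z
    using gap_series_bounds(1)[of z] by (auto simp: example_potential_def intro: less_imp_le)
  have "(\<integral>\<^sup>+\<zeta>\<in>\<T>. e2ennreal (- unbounded_example (a + of_real \<rho> * \<zeta>)) \<partial>circle_measure) =
      (\<integral>\<^sup>+\<zeta>. ennreal (- example_potential (a + of_real \<rho> * \<zeta>)) \<partial>circle_measure)"
  proof (rule nn_integral_cong_AE)
    show "AE \<zeta> in circle_measure. e2ennreal (- unbounded_example (a + of_real \<rho> * \<zeta>)) * indicator \<T> \<zeta> =
        ennreal (- example_potential (a + of_real \<rho> * \<zeta>))"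
      using AE_circle
      by (rule AE_mp) (use in_D in \<open>auto simp: unbounded_example_def example_potential_def\<close>)
  qed
  also have "\<dots> = ennreal (LINT \<zeta>|circle_measure. - example_potential (a + of_real \<rho> * \<zeta>))"
    using nonneg by (intro nn_integral_eq_integral int) simp
  also have "(LINT \<zeta>|circle_measure. - example_potential (a + of_real \<rho> * \<zeta>)) = - circle_avg example_potential a \<rho>"
    by (simp add: circle_avg_def)
  finally have mean: "circle_mean unbounded_example a \<rho> = - enn2ereal (ennreal (- circle_avg example_potential a \<rho>))"
    unfolding circle_mean_def zero by (simp add: zero_ennreal.rep_eq)
  have avg: "circle_avg example_potential a \<rho> = example_potential a + \<rho>\<^sup>2 * gap_density a \<rho>"
    by (rule circle_avg_example[OF \<rho>(1) a\<rho>])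
  have "0 \<le> gap_density a \<rho>"
    using gap_density_bounds(2,4)[of "1 - norm a" a \<rho>] \<rho>(1) a\<rho> by auto
  then have ge: "example_potential a \<le> circle_avg example_potential a \<rho>" unfolding avg by simp
  have "0 \<le> - circle_avg example_potential a \<rho>"
    unfolding circle_avg_def using nonneg Bochner_Integration.integral_nonneg[of circle_measure "\<lambda>\<zeta>. - example_potential (a + of_real \<rho> * \<zeta>)"]
    by simp
  then have "circle_mean unbounded_example a \<rho> = ereal (circle_avg example_potential a \<rho>)"
    unfolding mean by (simp add: enn2ereal_ennreal)
  moreover have "unbounded_example a = ereal (example_potential a)"
    using a\<rho> \<rho>(1) by (simp add: unbounded_example_def example_potential_def)
  ultimately show "unbounded_example a \<le> circle_mean unbounded_example a \<rho>" using ge by simp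
qed

lemma example_in_E: "unbounded_example \<in> \<E>"
  unfolding class_E_def
proof (intro CollectI conjI ballI exI)
  show "continuous_on \<D> unbounded_example"
    unfolding unbounded_example_def[abs_def]
    by (rule continuous_on_ereal[OF continuous_on_minus[OF gap_series_continuous]])
  show "subharmonic_on \<D> unbounded_example" by (rule example_subharmonic)
  show "unbounded_example z < 0" if "z \<in> \<D>" for z
    using gap_series_bounds(1)[of z] that by (simp add: unbounded_example_def zero_ereal_def)
  show "has_laplacian unbounded_example example_measure" by (rule example_has_laplacian)
  have "emeasure example_measure \<D> \<le> emeasure example_measure UNIV"
    by (intro emeasure_mono) (auto simp: example_measure_def)
  then show "emeasure example_measure \<D> < \<infinity>" using example_mass by (rule order_le_less_trans)
  have "filterlim (norm :: complex \<Rightarrow> real) (at_left 1) (filtercomap norm (at_left 1))"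
    by (rule filterlim_filtercomap)
  then have norm_lim: "filterlim (norm :: complex \<Rightarrow> real) (nhds 1) (filtercomap norm (at_left 1))"
    by (rule filterlim_mono) (auto simp: at_within_le_nhds)
  have inside: "\<forall>\<^sub>F z :: complex in filtercomap norm (at_left 1). norm z < 1"
    by (rule eventually_filtercomapI[OF eventually_at_left_1])
  have lim_sqrt: "((\<lambda>z::complex. 4 * sqrt (1 - norm z)) \<longlongrightarrow> 4 * sqrt (1 - 1)) (filtercomap norm (at_left 1))"
    by (intro tendsto_intros norm_lim)
  have "(gap_series \<longlongrightarrow> 0) (filtercomap norm (at_left 1))"
  proof (rule tendsto_sandwich[OF _ _ tendsto_const[of 0]])
    show "\<forall>\<^sub>F z in filtercomap norm (at_left 1). 0 \<le> gap_series z"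
      by (rule eventually_mono[OF inside]) (rule less_imp_le[OF gap_series_bounds(1)])
    show "\<forall>\<^sub>F z in filtercomap norm (at_left 1). gap_series z \<le> 4 * sqrt (1 - norm z)"
      by (rule eventually_mono[OF inside]) (rule gap_series_bounds(3))
    show "((\<lambda>z::complex. 4 * sqrt (1 - norm z)) \<longlongrightarrow> 0) (filtercomap norm (at_left 1))"
      using lim_sqrt by simp
  qed
  then have "((\<lambda>z. ereal (- gap_series z)) \<longlongrightarrow> ereal (- 0)) (filtercomap norm (at_left 1))"
    by (intro tendsto_intros)
  then show "(unbounded_example \<longlongrightarrow> 0) (filtercomap norm (at_left 1))"
    by (simp add: unbounded_example_def[abs_def] zero_ereal_def)
qed

text \<open>
  It suffices to integrate the \<open>n\<close>-th term over a box of size comparable to \<open>\<tau>\<close> at distance comparable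
  to \<open>\<tau>\<close> from the point 1. There the Poisson kernel is at least a multiple of \<open>1/\<tau>\<close> and \<open>|b'|\<^sup>2\<close> at least
  a multiple of \<open>1/\<tau>\<^sup>2\<close>, while the area is \<open>\<tau>\<^sup>2 / 8\<close>.
\<close>

lemma example_sweep_lower: "ennreal (2 ^ n / (2592 * pi)) \<le> poisson_sweep example_measure 1"
proof -
  define \<tau> :: real where "\<tau> = (1 / 16) ^ n"
  have \<tau>: "0 < \<tau>" "\<tau> \<le> 1" by (simp_all add: \<tau>_def power_le_one)
  have node_\<tau>: "node n = 1 - \<tau>" by (simp add: node_def \<tau>_def)
  define Q where "Q = box (Complex (1 - \<tau>) 0) (Complex (1 - \<tau> / 2) (\<tau> / 4))"
  define c where "c = (1 / (8 * \<tau>)) * (2 / pi * ((1 / 8) ^ n * (1 / (81 * \<tau>\<^sup>2))))"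
  have Q: "norm z < 1" "1 / (8 * \<tau>) \<le> poisson_kernel z 1" "1 / (81 * \<tau>\<^sup>2) \<le> gap_laplacian (node n) z 0"
    if "z \<in> Q" for z
  proof -
    define x y where "x = 1 - Re z" and "y = Im z"
    have xy: "\<tau> / 2 < x" "x < \<tau>" "0 < y" "y < \<tau> / 4"
      using that by (auto simp: Q_def in_box_complex_iff x_def y_def)
    have x2: "x\<^sup>2 \<le> x" using xy \<tau> by (simp add: power2_eq_square mult_left_le)
    have x2': "x\<^sup>2 \<le> \<tau>\<^sup>2" using xy \<tau> by (intro power_mono) auto
    have y2: "y\<^sup>2 \<le> (\<tau> / 4)\<^sup>2" using xy by (intro power_mono) auto
    have \<tau>2: "\<tau>\<^sup>2 \<le> \<tau>" using \<tau> by (simp add: power2_eq_square mult_left_le)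
    have "1 - (norm z)\<^sup>2 = 2 * x - x\<^sup>2 - y\<^sup>2"
      unfolding cmod_power2 by (simp add: x_def y_def power2_eq_square algebra_simps)
    also have "\<dots> \<ge> \<tau> / 4" using xy x2 y2 \<tau>2 \<tau>(1) by (simp add: power_divide)
    finally have num: "\<tau> / 4 \<le> 1 - (norm z)\<^sup>2" .
    then have "(norm z)\<^sup>2 < 1" using \<tau>(1) by linarith
    then show z: "norm z < 1" by (simp add: abs_square_less_1)
    have sq: "(norm (1 - z))\<^sup>2 = x\<^sup>2 + y\<^sup>2"
      unfolding cmod_power2 by (simp add: x_def y_def)
    also have "\<dots> \<le> 2 * \<tau>\<^sup>2"
    proof -
      have "(\<tau> / 4)\<^sup>2 = \<tau>\<^sup>2 / 16" by (simp add: power_divide)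
      then show ?thesis using x2' y2 zero_le_power2[of \<tau>] by linarith
    qed
    finally have den: "(norm (1 - z))\<^sup>2 \<le> 2 * \<tau>\<^sup>2" .
    have den_pos: "0 < (norm (1 - z))\<^sup>2" unfolding sq using xy \<tau> by (intro add_pos_nonneg) auto
    have "1 / (8 * \<tau>) = (\<tau> / 4) / (2 * \<tau>\<^sup>2)" using \<tau>(1) by (simp add: power2_eq_square)
    also have "\<dots> \<le> poisson_kernel z 1"
      unfolding poisson_kernel_def using num den den_pos \<tau>(1) by (intro frac_le) auto
    finally show "1 / (8 * \<tau>) \<le> poisson_kernel z 1" .
    note t = node(1,2)[of n]
    have "(2 * \<tau>)\<^sup>2 = 4 * \<tau>\<^sup>2" by (simp add: power_mult_distrib)
    then have "(norm (1 - z))\<^sup>2 \<le> (2 * \<tau>)\<^sup>2" using den zero_le_power2[of \<tau>] by linarith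
    then have "norm (1 - z) \<le> 2 * \<tau>" by (rule power2_le_imp_le) (use \<tau>(1) in simp)
    moreover have "1 - of_real (node n) * z = of_real \<tau> + of_real (node n) * (1 - z)"
      unfolding node_\<tau> by (simp add: algebra_simps)
    then have "norm (1 - of_real (node n) * z) \<le> norm (of_real \<tau> :: complex) + norm (of_real (node n) * (1 - z))"
      by (metis norm_triangle_ineq)
    moreover have "norm (of_real (node n) * (1 - z)) \<le> norm (1 - z)"
      using t by (simp only: norm_mult norm_of_real) (simp add: mult_left_le_one_le)
    ultimately have a: "norm (1 - of_real (node n) * z) \<le> 3 * \<tau>" using \<tau>(1) by simp
    have "\<tau> \<le> 1 - (node n)\<^sup>2"
      using \<tau>2 unfolding node_\<tau> by (simp add: power2_eq_square algebra_simps)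
    then have num2: "\<tau>\<^sup>2 \<le> (1 - (node n)\<^sup>2)\<^sup>2" using \<tau>(1) by (intro power_mono) auto
    have "norm (1 - of_real (node n) * z) ^ 4 \<le> (3 * \<tau>) ^ 4" using a by (intro power_mono) auto
    then have "1 / (81 * \<tau>\<^sup>2) \<le> \<tau>\<^sup>2 / norm (1 - of_real (node n) * z) ^ 4"
    proof -
      have "1 / (81 * \<tau>\<^sup>2) = \<tau>\<^sup>2 / (3 * \<tau>) ^ 4"
        using \<tau>(1) by (simp add: power_mult_distrib power2_eq_square power4_eq_xxxx)
      also have "\<dots> \<le> \<tau>\<^sup>2 / norm (1 - of_real (node n) * z) ^ 4"
        using \<open>_ ^ 4 \<le> _\<close> moebius_denominator(4)[OF t z] \<tau>(1) by (intro divide_left_mono mult_pos_pos) auto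
      finally show ?thesis .
    qed
    also have "\<dots> \<le> gap_laplacian (node n) z 0"
      unfolding gap_laplacian_0[OF t z] using num2 by (intro divide_right_mono) auto
    finally show "1 / (81 * \<tau>\<^sup>2) \<le> gap_laplacian (node n) z 0" .
  qed
  have area: "emeasure lborel Q = ennreal (\<tau>\<^sup>2 / 8)"
    unfolding Q_def using \<tau>(1)
    by (subst emeasure_lborel_box) (auto simp: Basis_complex_def power2_eq_square)
  have "ennreal c * ennreal (\<tau>\<^sup>2 / 8) = (\<integral>\<^sup>+z. ennreal c * indicator Q z \<partial>lborel)"
    unfolding area[symmetric] by (rule nn_integral_cmult_indicator[symmetric]) (simp add: Q_def)
  also have "\<dots> \<le> (\<integral>\<^sup>+z\<in>\<D>. ennreal (2 / pi * gap_density z 0) * (ennreal (poisson_kernel z 1) * indicator \<D> z) \<partial>lborel)"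
  proof (rule nn_integral_mono)
    fix z
    show "ennreal c * indicator Q z \<le> ennreal (2 / pi * gap_density z 0) * (ennreal (poisson_kernel z 1) * indicator \<D> z) * indicator \<D> z"
    proof (cases "z \<in> Q")
      case True
      note q = Q[OF True]
      have d: "0 < 1 - norm z" "1 - norm z \<le> 1 - norm z" using q(1) by simp_all
      note summ = gap_density_bounds(1)[OF d order_refl d(1)]
      have "(1 / 8) ^ n * gap_laplacian (node n) z 0 \<le> gap_density z 0"
        unfolding gap_density_def
        using sum_le_suminf[OF summ, of "{n}"] gap_laplacian_bounds(1)[OF node(1,2) q(1) d order_refl d(1)] by simp
      moreover have "(1 / 8) ^ n * (1 / (81 * \<tau>\<^sup>2)) \<le> (1 / 8) ^ n * gap_laplacian (node n) z 0"
        using q(3) by (intro mult_left_mono) auto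
      ultimately have le: "2 / pi * ((1 / 8) ^ n * (1 / (81 * \<tau>\<^sup>2))) \<le> 2 / pi * gap_density z 0"
        by (intro mult_left_mono) auto
      have "c \<le> poisson_kernel z 1 * (2 / pi * gap_density z 0)"
        unfolding c_def by (rule mult_mono[OF q(2) le poisson_kernel_nonneg]) (use q(1) in simp_all)
      then have "ennreal c \<le> ennreal (poisson_kernel z 1 * (2 / pi * gap_density z 0))" by (rule ennreal_leI)
      also have "\<dots> = ennreal (2 / pi * gap_density z 0) * ennreal (poisson_kernel z 1)"
        using poisson_kernel_nonneg[of z 1] q(1) by (subst ennreal_mult') (auto simp: mult.commute)
      finally show ?thesis using True q(1) by simp
    qed simp
  qed
  also have "\<dots> = poisson_sweep example_measure 1"
    unfolding poisson_sweep_def by (rule example_measure_nn_integral[symmetric]) measurable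
  finally have "ennreal (c * (\<tau>\<^sup>2 / 8)) \<le> poisson_sweep example_measure 1"
    by (subst ennreal_mult'') simp_all
  moreover have "c * (\<tau>\<^sup>2 / 8) = 2 ^ n / (2592 * pi)"
  proof -
    have "c * (\<tau>\<^sup>2 / 8) = ((1 / 8) ^ n / \<tau>) / (2592 * pi)"
      using \<tau>(1) by (simp add: c_def power2_eq_square)
    also have "(1 / 8) ^ n / \<tau> = 2 ^ n" by (simp add: \<tau>_def flip: power_divide)
    finally show ?thesis .
  qed
  ultimately show ?thesis by (simp only:)
qed

lemma example_sweep_infinite: "ennreal M < poisson_sweep example_measure 1"
proof -
  obtain n where "2592 * pi * \<bar>M\<bar> < real n" using reals_Archimedean2 by blast
  also have "real n < 2 ^ n" by (rule of_nat_less_two_power)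
  finally have "2592 * pi * \<bar>M\<bar> < 2 ^ n" .
  moreover have "2592 * pi * M \<le> 2592 * pi * \<bar>M\<bar>" by (intro mult_left_mono) auto
  ultimately have "2592 * pi * M < 2 ^ n" by linarith
  then have "M * (2592 * pi) < 2 ^ n" by (simp only: mult.commute)
  then have "M < 2 ^ n / (2592 * pi)" by (simp add: pos_less_divide_eq)
  then have "ennreal M < ennreal (2 ^ n / (2592 * pi))" by (intro ennreal_lessI) auto
  then show ?thesis using example_sweep_lower by (rule less_le_trans)
qed

section \<open>The boundary density\<close>

lemma class_E_exhaustion:
  assumes "u \<in> \<E>"
  shows "exhaustion u (laplacian u)"
proof -
  obtain \<nu> where "has_laplacian u \<nu>" "emeasure \<nu> \<D> < \<infinity>" using assms by (auto simp: class_E_def)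
  with assms show ?thesis by (simp add: exhaustion_def laplacian_eqI)
qed

theorem proposition4p2:
  shows "\<exists>\<alpha> :: (complex \<Rightarrow> ereal) \<Rightarrow> complex \<Rightarrow> ennreal.
    (\<forall>u\<in>\<E>.
      demailly_measure u = density circle_measure (\<alpha> u) \<and>
      (\<alpha> u \<in> borel_measurable borel \<and> (\<integral>\<^sup>+\<zeta>. \<alpha> u \<zeta> \<partial>circle_measure) < \<infinity>) \<and>
      (\<forall>\<zeta>\<in>\<T>. \<alpha> u \<zeta> = (\<integral>\<^sup>+z\<in>\<D>. ennreal (poisson_kernel z \<zeta>) \<partial>laplacian u)) \<and>
      lower_semicontinuous_on \<T> (\<alpha> u) \<and>
      (\<exists>c::real. 0 < c \<and> (\<forall>\<zeta>\<in>\<T>. ennreal c \<le> \<alpha> u \<zeta>))) \<and>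
    (\<exists>u\<in>\<E>. \<forall>M::real. \<exists>\<zeta>\<in>\<T>. ennreal M < \<alpha> u \<zeta>)"
proof (intro exI[of _ "\<lambda>u. poisson_sweep (laplacian u)"] conjI ballI)
  fix u assume "u \<in> \<E>"
  then interpret exhaustion u "laplacian u" by (rule class_E_exhaustion)
  show "demailly_measure u = density circle_measure (poisson_sweep (laplacian u))"
    by (rule demailly_measure_eq)
  show "poisson_sweep (laplacian u) \<in> borel_measurable borel" by (rule poisson_sweep_measurable)
  show "(\<integral>\<^sup>+\<zeta>. poisson_sweep (laplacian u) \<zeta> \<partial>circle_measure) < \<infinity>"
    unfolding poisson_sweep_total by (rule finite_mass)
  show "lower_semicontinuous_on \<T> (poisson_sweep (laplacian u))" by (rule poisson_sweep_lsc)
  show "\<exists>c::real. 0 < c \<and> (\<forall>\<zeta>\<in>\<T>. ennreal c \<le> poisson_sweep (laplacian u) \<zeta>)"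
    by (rule poisson_sweep_lower_bound)
next
  show "\<exists>u\<in>\<E>. \<forall>M::real. \<exists>\<zeta>\<in>\<T>. ennreal M < poisson_sweep (laplacian u) \<zeta>"
    using example_in_E laplacian_eqI[OF example_has_laplacian] example_sweep_infinite
    by (intro bexI[of _ unbounded_example] allI bexI[of _ 1]) auto
qed (simp add: poisson_sweep_def)

end
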